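(* Let $\mu$ be the Möbius function, $g(x):=\sum_{n\le x}\mu(n)n^{-1}$ for $x>0$, and $g_1(x):=x^{-1}g(x^{-1})$ for $x>0$. Then the Riemann hypothesis holds if and only if $\|g_1\|_p<\infty$ for every $p\in[1,2)$. Moreover, unconditionally, $\|g_1\|_2=\infty$.
   Context: For $1\le p<\infty$, $\|f\|_p$ denotes the norm of $L_p((0,\infty),dx)$ (Lebesgue measure $dx$), i.e. $\|f\|_p=\left(\int_0^\infty |f(x)|^p\,dx\right)^{1/p}$. *)

theory Defs
  imports
    "HOL-Complex_Analysis.Complex_Analysis"
    "HOL-Computational_Algebra.Squarefree"
begin

definition moebius :: "nat \<Rightarrow> int" where
  "moebius n = (if squarefree n then (-1) ^ card (prime_factors n) else 0)"

definition mertens_g :: "real \<Rightarrow> real" where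
  "mertens_g x = (\<Sum>n | n \<ge> 1 \<and> real n \<le> x. of_int (moebius n) / real n)"

definition mertens_g1 :: "real \<Rightarrow> real" where
  "mertens_g1 x = inverse x * mertens_g (inverse x)"

(* The norm is extended-valued, so that it is infinite exactly when the integral diverges;
   powr on the reals handles the finite case. *)
definition Lp_norm :: "real \<Rightarrow> (real \<Rightarrow> real) \<Rightarrow> ennreal" where
  "Lp_norm p f =
    (let I = (\<integral>\<^sup>+x\<in>{0<..}. ennreal (\<bar>f x\<bar> powr p) \<partial>lborel)
     in if I = \<infinity> then \<infinity> else ennreal (enn2real I powr (1 / p)))"

abbreviation zeta_series :: "complex \<Rightarrow> complex" where
  "zeta_series s \<equiv> (\<Sum>n. 1 / of_nat (Suc n) powr s)"

(* Analytic continuation of the Dirichlet series. Existence and uniqueness are zeta_ex1 below;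
   the value 0 at the pole s = 1 is a convention. *)
definition zeta :: "complex \<Rightarrow> complex" where
  "zeta = (THE f. f holomorphic_on - {1} \<and> f 1 = 0 \<and> (\<forall>s. Re s > 1 \<longrightarrow> f s = zeta_series s))"

definition riemann_hypothesis :: bool where
  "riemann_hypothesis \<longleftrightarrow> (\<forall>s. zeta s = 0 \<and> 0 < Re s \<and> Re s < 1 \<longrightarrow> Re s = 1 / 2)"

lemma holomorphic_on_suminf_Weierstrass:
  fixes f :: "nat \<Rightarrow> complex \<Rightarrow> complex"
  assumes S: "open S" and hol: "\<And>n. f n holomorphic_on S"
    and bd: "\<And>z. z \<in> S \<Longrightarrow> \<exists>d>0. \<exists>M. cball z d \<subseteq> S \<and> summable M \<and> (\<forall>n. \<forall>w\<in>cball z d. norm (f n w) \<le> M n)"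
  shows "(\<lambda>z. \<Sum>n. f n z) holomorphic_on S"
proof (rule holomorphic_uniform_sequence[OF S, where f = "\<lambda>n z. \<Sum>i<n. f i z"])
  show "(\<lambda>z. \<Sum>i<n. f i z) holomorphic_on S" for n
    by (intro holomorphic_intros hol)
next
  fix z assume "z \<in> S"
  then obtain d M where d: "d > 0" "cball z d \<subseteq> S" and M: "summable M"
    and le: "\<And>n w. w \<in> cball z d \<Longrightarrow> norm (f n w) \<le> M n"
    using bd[of z] by metis
  from le M have "uniform_limit (cball z d) (\<lambda>n z. \<Sum>i<n. f i z) (\<lambda>z. \<Sum>n. f n z) sequentially"
    by (rule Weierstrass_m_test)
  with d show "\<exists>d>0. cball z d \<subseteq> S \<and> uniform_limit (cball z d) (\<lambda>n z. \<Sum>i<n. f i z) (\<lambda>z. \<Sum>n. f n z) sequentially"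
    by blast
qed

(* The continuation is obtained from the Taylor expansion of (n + 1) powr (1 - s) around n:
   summed over n, it expresses (s - 1) * zeta s through a remainder holomorphic on a larger
   half-plane and the values zeta (s + 1), ..., zeta (s + N). *)
definition powr_coeff :: "nat \<Rightarrow> complex \<Rightarrow> complex" where
  "powr_coeff k s = (\<Prod>j<k. 1 - s - of_nat j)"

definition powr_remainder :: "nat \<Rightarrow> nat \<Rightarrow> complex \<Rightarrow> complex" where
  "powr_remainder N n s = of_nat (Suc (Suc n)) powr (1 - s) - (\<Sum>k\<le>N. powr_coeff k s * of_nat (Suc n) powr (1 - s - of_nat k) / fact k)"

lemma powr_remainder_bound:
  assumes "Re s > - real N"
  shows "norm (powr_remainder N n s) \<le> norm (powr_coeff (Suc N) s) * real (Suc n) powr (- Re s - real N)"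
proof -
  define m where "m = real (Suc n)"
  have m: "m > 0" by (simp add: m_def)
  define S where "S = complex_of_real ` {m..m+1}"
  define f where "f = (\<lambda>k w. powr_coeff k s * w powr (1 - s - of_nat k))"
  have cS: "convex S" unfolding S_def
    by (rule convex_linear_image) (auto intro!: bounded_linear.linear bounded_linear_of_real)
  have 1: "(f i has_field_derivative f (Suc i) x) (at x within S)" if "x \<in> S" for i x
  proof -
    have "x \<notin> \<real>\<^sub>\<le>\<^sub>0" using that m by (auto simp: S_def)
    then show ?thesis unfolding f_def powr_coeff_def
      by (auto intro!: derivative_eq_intros simp: algebra_simps)
  qed
  have 2: "norm (f (Suc N) x) \<le> norm (powr_coeff (Suc N) s) * m powr (- Re s - real N)" if x: "x \<in> S" for x
  proof -
    from x obtain t where t: "x = of_real t" "t \<ge> m" by (auto simp: S_def)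
    have "norm (x powr (1 - s - of_nat (Suc N))) = t powr (- Re s - real N)"
      using t m by (subst norm_powr_real_powr) auto
    also have "\<dots> \<le> m powr (- Re s - real N)"
      using t m assms by (intro powr_mono2') auto
    finally show ?thesis unfolding f_def by (auto simp: norm_mult intro!: mult_left_mono)
  qed
  have "norm (f 0 (of_real (m+1)) - (\<Sum>i\<le>N. f i (of_real m) * (of_real (m+1) - of_real m) ^ i / fact i))
     \<le> norm (powr_coeff (Suc N) s) * m powr (- Re s - real N) * norm (of_real (m+1) - of_real m :: complex) ^ Suc N / fact N"
  proof (rule complex_Taylor[OF cS 1 2])
    show "of_real m \<in> S" "of_real (m + 1) \<in> S" unfolding S_def by (rule imageI, simp)+
  qed
  also have "\<dots> \<le> norm (powr_coeff (Suc N) s) * m powr (- Re s - real N)"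
  proof -
    have "B / fact N \<le> B" if "B \<ge> 0" for B :: real
      using divide_left_mono[OF fact_ge_1 that, of N] by simp
    then show ?thesis by simp
  qed
  also have "f 0 (of_real (m+1)) - (\<Sum>i\<le>N. f i (of_real m) * (of_real (m+1) - of_real m) ^ i / fact i) = powr_remainder N n s"
    unfolding f_def powr_remainder_def m_def by (simp add: powr_coeff_def add_ac)
  finally show ?thesis unfolding m_def .
qed

lemma powr_remainder_holomorphic: "powr_remainder N n holomorphic_on A"
  unfolding powr_remainder_def[abs_def] powr_coeff_def[abs_def] by (intro holomorphic_intros) (auto simp del: of_nat_Suc)

lemma summable_real_Suc_powr: "a > 1 \<Longrightarrow> summable (\<lambda>n. real (Suc n) powr (-a))"
  using summable_Suc_iff[of "\<lambda>n. real n powr (-a)"] summable_real_powr_iff[of "-a"] by simp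

lemma summable_zeta_series: "Re s > 1 \<Longrightarrow> summable (\<lambda>n. of_nat (Suc n) powr (-s) :: complex)"
  by (rule summable_norm_cancel)
     (use summable_real_Suc_powr[of "Re s"] in \<open>simp add: norm_powr_real_powr del: of_nat_Suc\<close>)

lemma zeta_series_sums: "Re s > 1 \<Longrightarrow> (\<lambda>n. of_nat (Suc n) powr (-s)) sums zeta_series s"
  using summable_sums[OF summable_zeta_series[of s]] by (simp add: powr_def exp_minus divide_inverse del: of_nat_Suc)

lemma powr_remainder_suminf_holomorphic: "(\<lambda>s. \<Sum>n. powr_remainder (Suc N) n s) holomorphic_on {s. Re s > - real N}"
proof (rule holomorphic_on_suminf_Weierstrass)
  show "open {s. Re s > - real N}" by (rule open_halfspace_Re_gt)
  fix z assume "z \<in> {s. Re s > - real N}"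
  then have z: "Re z > - real N" by simp
  define d where "d = (Re z + real N) / 2"
  have d: "d > 0" using z by (simp add: d_def)
  define K where "K = 1 + norm z + d + real (Suc (Suc N))"
  define a where "a = Re z - d + real (Suc N)"
  have a: "a > 1" using z by (simp add: a_def d_def field_simps)
  have w: "Re w \<ge> Re z - d" "norm w \<le> norm z + d" if "w \<in> cball z d" for w
    using that abs_Re_le_cmod[of "z - w"] norm_triangle_ineq2[of w z] by (auto simp: dist_norm norm_minus_commute)
  have bound: "norm (powr_remainder (Suc N) n w) \<le> K ^ Suc (Suc N) * real (Suc n) powr (-a)" if "w \<in> cball z d" for n w
  proof -
    have "norm (powr_remainder (Suc N) n w) \<le> norm (powr_coeff (Suc (Suc N)) w) * real (Suc n) powr (- Re w - real (Suc N))"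
      by (rule powr_remainder_bound) (use w[OF that] z d in \<open>simp add: d_def field_simps\<close>)
    also have "\<dots> \<le> K ^ Suc (Suc N) * real (Suc n) powr (-a)"
    proof (intro mult_mono)
      have "norm (powr_coeff (Suc (Suc N)) w) = (\<Prod>j<Suc (Suc N). norm (1 - w - of_nat j))"
        unfolding powr_coeff_def by (simp add: prod_norm)
      also have "\<dots> \<le> (\<Prod>j<Suc (Suc N). K)"
      proof (rule prod_mono)
        fix j assume "j \<in> {..<Suc (Suc N)}"
        then have "norm (1 - w - of_nat j) \<le> 1 + norm w + real (Suc (Suc N))"
          using norm_triangle_ineq4[of "1 - w" "of_nat j"] norm_triangle_ineq4[of 1 w] by auto
        then show "0 \<le> norm (1 - w - of_nat j) \<and> norm (1 - w - of_nat j) \<le> K"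
          using w[OF that] by (simp add: K_def)
      qed
      finally show "norm (powr_coeff (Suc (Suc N)) w) \<le> K ^ Suc (Suc N)" by simp
    next
      show "real (Suc n) powr (- Re w - real (Suc N)) \<le> real (Suc n) powr (-a)"
        by (rule powr_mono) (use w[OF that] in \<open>auto simp: a_def\<close>)
      show "0 \<le> K ^ Suc (Suc N)" using d by (intro zero_le_power) (simp add: K_def)
    qed auto
    finally show ?thesis .
  qed
  show "\<exists>d>0. \<exists>M. cball z d \<subseteq> {s. Re s > - real N} \<and> summable M \<and> (\<forall>n. \<forall>w\<in>cball z d. norm (powr_remainder (Suc N) n w) \<le> M n)"
  proof (intro exI[of _ d] conjI exI[of _ "\<lambda>n. K ^ Suc (Suc N) * real (Suc n) powr (-a)"])
    show "cball z d \<subseteq> {s. Re s > - real N}" using w(1) z by (force simp: d_def field_simps)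
    show "summable (\<lambda>n. K ^ Suc (Suc N) * real (Suc n) powr (-a))"
      by (intro summable_mult summable_real_Suc_powr a)
  qed (use d bound in auto)
qed (rule powr_remainder_holomorphic)

lemma tendsto_of_nat_powr_0: "Re s > 1 \<Longrightarrow> (\<lambda>n. of_nat (Suc n) powr (1 - s) :: complex) \<longlonglongrightarrow> 0"
proof (rule tendsto_norm_zero_cancel)
  assume s: "Re s > 1"
  have "(\<lambda>n. real (Suc n) powr (1 - Re s)) \<longlonglongrightarrow> 0"
    by (rule tendsto_neg_powr)
       (use s filterlim_compose[OF filterlim_real_sequentially filterlim_Suc] in auto)
  then show "(\<lambda>n. norm (of_nat (Suc n) powr (1 - s) :: complex)) \<longlonglongrightarrow> 0"
    by (simp add: norm_powr_real_powr del: of_nat_Suc)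
qed

lemma zeta_series_recursion:
  assumes s: "Re s > 1"
  shows "(s - 1) * zeta_series s = 1 + (\<Sum>n. powr_remainder (Suc N) n s) + (\<Sum>k\<in>{2..Suc N}. powr_coeff k s / fact k * zeta_series (s + of_nat k - 1))"
proof -
  have t: "(\<lambda>n. of_nat (Suc (Suc n)) powr (1 - s) - of_nat (Suc n) powr (1 - s)) sums (0 - of_nat (Suc 0) powr (1 - s) :: complex)"
    by (rule telescope_sums[OF tendsto_of_nat_powr_0[OF s]])
  have Zk: "(\<lambda>n. powr_coeff k s / fact k * of_nat (Suc n) powr (- (s + of_nat k - 1))) sums (powr_coeff k s / fact k * zeta_series (s + of_nat k - 1))"
    if "k \<ge> 1" for k
    by (intro sums_mult zeta_series_sums) (use s that in simp)
  have u: "(\<lambda>n. (of_nat (Suc (Suc n)) powr (1 - s) - of_nat (Suc n) powr (1 - s))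
      - (\<Sum>k\<in>{1..Suc N}. powr_coeff k s / fact k * of_nat (Suc n) powr (- (s + of_nat k - 1))))
     sums ((0 - of_nat (Suc 0) powr (1 - s)) - (\<Sum>k\<in>{1..Suc N}. powr_coeff k s / fact k * zeta_series (s + of_nat k - 1)))"
    by (intro sums_diff[OF t] sums_sum Zk) auto
  have eq: "{..Suc N} = insert 0 {1..Suc N}" "{1..Suc N} = insert 1 {2..Suc N}" by auto
  have "(of_nat (Suc (Suc n)) powr (1 - s) - of_nat (Suc n) powr (1 - s))
      - (\<Sum>k\<in>{1..Suc N}. powr_coeff k s / fact k * of_nat (Suc n) powr (- (s + of_nat k - 1))) = powr_remainder (Suc N) n s" for n
  proof -
    have "- (s + of_nat k - 1) = 1 - s - of_nat k" for k by simp
    then have "(\<Sum>k\<in>{1..Suc N}. powr_coeff k s / fact k * of_nat (Suc n) powr (- (s + of_nat k - 1))) =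
        (\<Sum>k\<in>{1..Suc N}. powr_coeff k s * of_nat (Suc n) powr (1 - s - of_nat k) / fact k)"
      by (simp only: times_divide_eq_left)
    moreover have "powr_coeff 0 s = 1" by (simp add: powr_coeff_def)
    moreover have "sum F {..Suc N} = F 0 + sum F {1..Suc N}" for F :: "nat \<Rightarrow> complex"
      unfolding eq(1) by (rule sum.insert) auto
    ultimately show ?thesis unfolding powr_remainder_def by (simp only:) simp
  qed
  with u have "(\<lambda>n. powr_remainder (Suc N) n s) sums (- 1 - (\<Sum>k\<in>{1..Suc N}. powr_coeff k s / fact k * zeta_series (s + of_nat k - 1)))"
    by simp
  then have "(\<Sum>n. powr_remainder (Suc N) n s) = - 1 - (\<Sum>k\<in>{1..Suc N}. powr_coeff k s / fact k * zeta_series (s + of_nat k - 1))"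
    by (rule sums_unique[symmetric])
  also have "(\<Sum>k\<in>{1..Suc N}. powr_coeff k s / fact k * zeta_series (s + of_nat k - 1)) =
     (1 - s) * zeta_series s + (\<Sum>k\<in>{2..Suc N}. powr_coeff k s / fact k * zeta_series (s + of_nat k - 1))"
    unfolding eq(2) by (simp add: powr_coeff_def)
  finally show ?thesis by (simp add: algebra_simps)
qed

lemma zeta_halfplane_continuation: "\<exists>h. h holomorphic_on {s. Re s > 1 - real N} \<and> (\<forall>s. Re s > 1 \<longrightarrow> h s = (s - 1) * zeta_series s)"
proof (induction N)
  case 0
  have "zeta_series holomorphic_on {s. Re s > 1}"
  proof (rule holomorphic_on_suminf_Weierstrass)
    show "open {s. Re s > 1}" by (rule open_halfspace_Re_gt)
    show "(\<lambda>s. 1 / of_nat (Suc n) powr s) holomorphic_on {s. Re s > 1}" for n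
      by (intro holomorphic_intros) (auto simp del: of_nat_Suc)
    fix z assume "z \<in> {s. Re s > 1}"
    then have z: "Re z > 1" by simp
    define d where "d = (Re z - 1) / 2"
    have d: "d > 0" "Re z - d > 1" using z by (simp_all add: d_def field_simps)
    have w: "Re w \<ge> Re z - d" if "w \<in> cball z d" for w
      using that abs_Re_le_cmod[of "z - w"] by (auto simp: dist_norm)
    have "norm (1 / of_nat (Suc n) powr w :: complex) \<le> real (Suc n) powr (-(Re z - d))" if "w \<in> cball z d" for n w
    proof -
      have "norm (1 / of_nat (Suc n) powr w :: complex) = real (Suc n) powr (- Re w)"
        by (simp add: norm_divide norm_inverse norm_powr_real_powr powr_minus divide_inverse del: of_nat_Suc)
      also have "\<dots> \<le> real (Suc n) powr (-(Re z - d))"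
        by (rule powr_mono) (use w[OF that] in auto)
      finally show ?thesis .
    qed
    then show "\<exists>d>0. \<exists>M. cball z d \<subseteq> {s. Re s > 1} \<and> summable M \<and> (\<forall>n. \<forall>w\<in>cball z d. norm (1 / of_nat (Suc n) powr w :: complex) \<le> M n)"
      using d w summable_real_Suc_powr[OF d(2)]
      by (intro exI[of _ d] conjI exI[of _ "\<lambda>n. real (Suc n) powr (-(Re z - d))"]) force+
  qed
  then show ?case
    by (intro exI[of _ "\<lambda>s. (s - 1) * zeta_series s"]) (auto intro!: holomorphic_intros)
next
  case (Suc N)
  then obtain h where h: "h holomorphic_on {s. Re s > 1 - real N}" "\<And>s. Re s > 1 \<Longrightarrow> h s = (s - 1) * zeta_series s"
    by blast
  define h' where "h' = (\<lambda>s. 1 + (\<Sum>n. powr_remainder (Suc N) n s) - (\<Sum>k\<in>{2..Suc N}. powr_coeff (k - 1) s / fact k * h (s + of_nat k - 1)))"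
  have "h' holomorphic_on {s. Re s > - real N}"
    unfolding h'_def
  proof (intro holomorphic_on_diff holomorphic_on_add holomorphic_on_sum holomorphic_on_mult powr_remainder_suminf_holomorphic holomorphic_on_const)
    fix k assume k: "k \<in> {2..Suc N}"
    show "(\<lambda>s. powr_coeff (k - 1) s / fact k) holomorphic_on {s. Re s > - real N}"
      unfolding powr_coeff_def by (intro holomorphic_intros) auto
    have "h \<circ> (\<lambda>s. s + of_nat k - 1) holomorphic_on {s. Re s > - real N}"
      by (rule holomorphic_on_compose_gen[OF _ h(1)]) (use k in \<open>auto intro!: holomorphic_intros\<close>)
    then show "(\<lambda>s. h (s + of_nat k - 1)) holomorphic_on {s. Re s > - real N}" by (simp add: o_def)
  qed
  moreover have "h' s = (s - 1) * zeta_series s" if s: "Re s > 1" for s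
  proof -
    have "powr_coeff k s / fact k * zeta_series (s + of_nat k - 1) = - (powr_coeff (k - 1) s / fact k * h (s + of_nat k - 1))"
      if k: "k \<in> {2..Suc N}" for k
    proof -
      obtain j where j: "k = Suc j" using k by (cases k) auto
      have "h (s + of_nat k - 1) = (s + of_nat k - 1 - 1) * zeta_series (s + of_nat k - 1)"
        by (rule h(2)) (use s k in auto)
      then have "h (s + of_nat k - 1) = (s + of_nat j - 1) * zeta_series (s + of_nat k - 1)"
        by (simp add: j)
      moreover have "powr_coeff k s = - (powr_coeff (k - 1) s * (s + of_nat j - 1))"
        unfolding j powr_coeff_def by (simp add: algebra_simps)
      ultimately show ?thesis by (simp only:) simp
    qed
    then show ?thesis unfolding h'_def zeta_series_recursion[OF s, of N]
      by (simp add: sum_negf)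
  qed
  ultimately show ?case by (intro exI[of _ h']) simp
qed

lemma holomorphic_halfplane_unique:
  assumes "f holomorphic_on {s. Re s > a}" "g holomorphic_on {s. Re s > a}" "a \<le> 1"
    "\<And>s. Re s > 1 \<Longrightarrow> f s = g s" "Re z > a"
  shows "f z = g z"
proof -
  have "f z - g z = 0"
  proof (rule analytic_continuation[of "\<lambda>z. f z - g z" "{s. Re s > a}" "{s. Re s > 1}" 2])
    show "2 islimpt {s. Re s > 1}"
      by (rule interior_limit_point) (simp add: interior_open open_halfspace_Re_gt)
    show "connected {s. Re s > a}" by (intro convex_connected convex_halfspace_Re_gt)
  qed (use assms in \<open>auto intro!: holomorphic_intros open_halfspace_Re_gt\<close>)
  then show ?thesis by simp
qed

lemma zeta_entire_continuation: "\<exists>h. h holomorphic_on UNIV \<and> (\<forall>s. Re s > 1 \<longrightarrow> h s = (s - 1) * zeta_series s)"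
proof -
  obtain h where h: "\<And>N. h N holomorphic_on {s. Re s > 1 - real N}" "\<And>N s. Re s > 1 \<Longrightarrow> h N s = (s - 1) * zeta_series s"
    using zeta_halfplane_continuation by metis
  define H where "H = (\<lambda>s. h (nat \<lceil>2 - Re s\<rceil>) s)"
  have eq: "h N s = h M s" if "N \<le> M" "Re s > 1 - real N" for N M s
  proof (rule holomorphic_halfplane_unique[of "h N" "1 - real N" "h M"])
    show "h M holomorphic_on {s. Re s > 1 - real N}"
      by (rule holomorphic_on_subset[OF h(1)[of M]]) (use that in auto)
  qed (use that h in auto)
  have Re: "Re s > 1 - real (nat \<lceil>2 - Re s\<rceil>)" for s by linarith
  have H: "H s = h N s" if "Re s > 1 - real N" for N s
    unfolding H_def using eq[of N "nat \<lceil>2 - Re s\<rceil>" s] eq[of "nat \<lceil>2 - Re s\<rceil>" N s] that Re[of s]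
    by (metis nat_le_linear)
  have "H holomorphic_on (\<Union>N. {s. Re s > 1 - real N})"
  proof (rule holomorphic_on_UN_open)
    show "H holomorphic_on {s. Re s > 1 - real N}" for N
      using h(1)[of N] H by (subst holomorphic_cong[OF refl, of _ _ "h N"]) auto
  qed (rule open_halfspace_Re_gt)
  also have "(\<Union>N. {s. Re s > 1 - real N}) = UNIV" using Re by blast
  finally show ?thesis using h(2) unfolding H_def by blast
qed

lemma zeta_ex1:
  "\<exists>!f. f holomorphic_on - {1} \<and> f 1 = 0 \<and> (\<forall>s. Re s > 1 \<longrightarrow> f s = zeta_series s)"
proof (rule ex_ex1I)
  obtain h where h: "h holomorphic_on UNIV" "\<And>s. Re s > 1 \<Longrightarrow> h s = (s - 1) * zeta_series s"
    using zeta_entire_continuation by blast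
  have "(\<lambda>s. h s / (s - 1)) holomorphic_on - {1}"
    using holomorphic_on_subset[OF h(1)] by (auto intro!: holomorphic_intros)
  then show "\<exists>f. f holomorphic_on - {1} \<and> f 1 = 0 \<and> (\<forall>s. Re s > 1 \<longrightarrow> f s = zeta_series s)"
    using h(2) by (intro exI[of _ "\<lambda>s. h s / (s - 1)"]) auto
next
  fix f g :: "complex \<Rightarrow> complex"
  assume f: "f holomorphic_on - {1} \<and> f 1 = 0 \<and> (\<forall>s. Re s > 1 \<longrightarrow> f s = zeta_series s)"
    and g: "g holomorphic_on - {1} \<and> g 1 = 0 \<and> (\<forall>s. Re s > 1 \<longrightarrow> g s = zeta_series s)"
  show "f = g"
  proof
    fix z show "f z = g z"
    proof (cases "z = 1")
      case False
      have "f z - g z = 0"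
      proof (rule analytic_continuation[of "\<lambda>z. f z - g z" "- {1}" "{s. Re s > 1}" 2])
        show "2 islimpt {s. Re s > 1}"
          by (rule interior_limit_point) (simp add: interior_open open_halfspace_Re_gt)
        show "connected (- {1::complex})" by (rule connected_punctured_universe) simp
      qed (use f g False in \<open>auto intro!: holomorphic_intros\<close>)
      then show ?thesis by simp
    qed (use f g in simp)
  qed
qed

lemma zeta_characterization:
  "zeta holomorphic_on - {1} \<and> zeta 1 = 0 \<and> (\<forall>s. Re s > 1 \<longrightarrow> zeta s = zeta_series s)"
  unfolding zeta_def by (rule theI'[OF zeta_ex1])

end

(*
  The substitution y = 1/x turns g_1 into g: the Mellin transform of g_1 at s is
  1 / (s zeta(s + 1)). It converges absolutely for Re s > 1/p - 1 once ||g_1||_p is finite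
  (p > 1), so finiteness for all p < 2 excludes zeros with Re s > 1/2, and the functional
  equation gives the Riemann hypothesis.

  For p = 2, Cauchy-Schwarz in addition bounds the Mellin transform by O(e^(-1/2)) at distance e
  from the critical line, which is incompatible with the simple blow-up of 1/zeta at a zero. Hence
  ||g_1||_2 < oo would leave zeta without any nontrivial zero. Then xi is zero-free and, having
  order 1, is the exponential of an affine function; by symmetry xi(1) = xi(16), which is absurd.

  Conversely, under the Riemann hypothesis 1/zeta grows slower than every power on Re s > 1/2
  (Littlewood), and Newman's contour argument on rectangles of height N, applied to 1/zeta and its
  partial sums at s = 1, gives g(N) = O(N^(-1/2 + eps)).
*)
theory Submission
  imports Defs "HOL-Number_Theory.Prime_Powers"
begin

section \<open>The entire function \<open>(s - 1) \<zeta>(s)\<close> and Dirichlet series\<close>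

text \<open>\<open>zeta\<close> takes the conventional value 0 at its pole, so zeros are tracked
  through the entire function \<open>zeta_reg\<close>, whose value at 1 is the residue. Identities
  are kept in product form, such as \<open>zeta_reg (s + 1) * mellin mertens_g1 s = 1\<close>:
  convergence of the integral then exhibits an inverse, and non-vanishing is read off without any
  division. Analytic identities are checked for real arguments in an interval, where the integrals
  have nonnegative integrands, and carried to complex arguments by the identity theorem.

  The Riemann hypothesis as defined speaks of the open critical strip only. To obtain a zero-free
  half-plane \<open>Re s > 1/2\<close> from it, the line \<open>Re s = 1\<close> has to be treated
  separately; this is why the von Mangoldt function enters. For p = 2 any zero with
  \<open>Re s \<ge> 1/2\<close> will do: one to the right of the critical line already contradicts
  the criterion for p < 2, extended to p = 2.

  The obstacle in Littlewood's bound is that the Borel-Caratheodory inequality alone yields some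
  fixed power of the height. An arbitrarily small factor in front of the estimate on the outer
  circle turns it into an arbitrarily small power.\<close>

definition zeta_reg :: "complex \<Rightarrow> complex" where
  "zeta_reg s = (if s = 1 then 1 else (s - 1) * zeta s)"

lemma zeta_holomorphic: "zeta holomorphic_on - {1}"
  and zeta_eq_series: "Re s > 1 \<Longrightarrow> zeta s = zeta_series s"
  using zeta_characterization by blast+

text \<open>At s = 1 both powers equal 1 and the linear coefficient 1 - s vanishes. The series for
  \<open>zeta_reg\<close> therefore collapses to its constant term at 1, which identifies the
  residue of zeta.\<close>

lemma powr_remainder_at_1: "powr_remainder (Suc 0) n 1 = 0"
proof -
  have "of_nat (Suc n) \<noteq> (0::complex)" "of_nat (Suc (Suc n)) \<noteq> (0::complex)"
    using of_nat_neq_0 by blast+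
  then show ?thesis by (simp add: powr_remainder_def powr_coeff_def)
qed

text \<open>Two continuations from \<open>Re s > 1\<close> are compared with the entire function h:
  on the punctured plane it must be (s - 1) zeta(s), on \<open>Re s > 0\<close> it must be the
  explicit remainder series. The latter covers the point 1 that the former misses.\<close>

lemma zeta_reg_continuation:
  "zeta_reg holomorphic_on UNIV \<and>
   (\<forall>s. Re s > 0 \<longrightarrow> zeta_reg s = 1 + (\<Sum>n. powr_remainder (Suc 0) n s))"
proof -
  obtain h where h: "h holomorphic_on UNIV" "\<And>s. Re s > 1 \<Longrightarrow> h s = (s - 1) * zeta_series s"
    using zeta_entire_continuation by blast
  let ?r = "\<lambda>s. 1 + (\<Sum>n. powr_remainder (Suc 0) n s)"
  have hr: "h s = ?r s" if "Re s > 0" for s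
  proof (rule holomorphic_halfplane_unique[of h 0])
    show "?r holomorphic_on {s. Re s > 0}"
      using powr_remainder_suminf_holomorphic[of 0] by (auto intro!: holomorphic_intros)
    show "h t = ?r t" if "Re t > 1" for t
      using h(2)[OF that] zeta_series_recursion[OF that, of 0] by simp
  qed (use that h in \<open>auto intro: holomorphic_on_subset\<close>)
  have h1: "h s = (s - 1) * zeta s" if "s \<noteq> 1" for s
  proof -
    have "h s - (s - 1) * zeta s = 0"
    proof (rule analytic_continuation[of "\<lambda>s. h s - (s - 1) * zeta s" "- {1}" "{s. Re s > 1}" 2])
      show "2 islimpt {s. Re s > 1}"
        by (rule interior_limit_point) (simp add: interior_open open_halfspace_Re_gt)
      show "connected (- {1::complex})" by (rule connected_punctured_universe) simp
      show "(\<lambda>s. h s - (s - 1) * zeta s) holomorphic_on - {1}"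
        using h(1) zeta_holomorphic by (auto intro!: holomorphic_intros intro: holomorphic_on_subset)
    qed (use that h zeta_eq_series in auto)
    then show ?thesis by simp
  qed
  have "h 1 = 1" using hr[of 1] by (simp add: powr_remainder_at_1)
  then have "zeta_reg = h" by (auto simp: zeta_reg_def h1 fun_eq_iff)
  with h hr show ?thesis by auto
qed

lemma zeta_reg_holomorphic [holomorphic_intros]: "zeta_reg holomorphic_on A"
  using zeta_reg_continuation holomorphic_on_subset by blast

text \<open>For \<open>Re s \<ge> 1/2\<close> the n-th remainder is at most |s (1 - s)| (n +
  1)^(-3/2), and the series of these majorants converges. The degree 2 is harmless, because the
  bound is only used through its logarithm.\<close>

lemma zeta_reg_bound:
  obtains C where "C > 0" "\<And>s. Re s \<ge> 1/2 \<Longrightarrow> norm (zeta_reg s) \<le> C * (1 + norm s)\<^sup>2"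
proof -
  define B where "B = (\<Sum>n. real (Suc n) powr (-(3/2)))"
  have sB: "summable (\<lambda>n. real (Suc n) powr (-(3/2)))"
    by (rule summable_real_Suc_powr) simp
  have B: "B \<ge> 0" unfolding B_def by (intro suminf_nonneg sB) auto
  have "norm (zeta_reg s) \<le> (1 + B) * (1 + norm s)\<^sup>2" if s: "Re s \<ge> 1/2" for s
  proof -
    have le: "norm (powr_remainder (Suc 0) n s) \<le> norm (powr_coeff 2 s) * real (Suc n) powr (-(3/2))" for n
    proof -
      have "norm (powr_remainder (Suc 0) n s) \<le> norm (powr_coeff (Suc (Suc 0)) s) * real (Suc n) powr (- Re s - real (Suc 0))"
        by (rule powr_remainder_bound) (use s in simp)
      also have "\<dots> \<le> norm (powr_coeff 2 s) * real (Suc n) powr (-(3/2))"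
        unfolding numeral_2_eq_2 by (intro mult_left_mono powr_mono) (use s in auto)
      finally show ?thesis .
    qed
    have "norm (\<Sum>n. powr_remainder (Suc 0) n s) \<le> (\<Sum>n. norm (powr_coeff 2 s) * real (Suc n) powr (-(3/2)))"
      by (rule norm_suminf_le[OF le]) (intro summable_mult sB)
    also have "\<dots> = norm (powr_coeff 2 s) * B"
      unfolding B_def by (rule suminf_mult[OF sB])
    also have "norm (powr_coeff 2 s) = norm (1 - s) * norm s"
      by (simp add: powr_coeff_def numeral_2_eq_2 norm_mult norm_minus_commute)
    also have "norm (1 - s) * norm s * B \<le> (1 + norm s) * (1 + norm s) * B"
      using norm_triangle_ineq4[of 1 s] B by (intro mult_right_mono mult_mono) auto
    finally have 1: "norm (\<Sum>n. powr_remainder (Suc 0) n s) \<le> B * (1 + norm s)\<^sup>2"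
      by (simp add: power2_eq_square mult_ac)
    have "zeta_reg s = 1 + (\<Sum>n. powr_remainder (Suc 0) n s)"
      using zeta_reg_continuation s by auto
    then have "norm (zeta_reg s) \<le> 1 + B * (1 + norm s)\<^sup>2"
      using norm_triangle_ineq[of 1 "\<Sum>n. powr_remainder (Suc 0) n s"] 1 by simp
    moreover have "1 \<le> (1 + norm s)\<^sup>2" by (simp add: one_le_power)
    ultimately show ?thesis unfolding distrib_right by linarith
  qed
  then show thesis using B by (intro that[of "1 + B"]) auto
qed

section \<open>Dirichlet series as unordered sums over the positive integers\<close>

lemma has_sum_Suc_iff:
  "((\<lambda>n. f (Suc n)) has_sum S) UNIV \<longleftrightarrow> (f has_sum S) {0<..}"
  by (rule has_sum_reindex_bij_betw, rule bij_betwI[of _ _ _ "\<lambda>n. n - 1"]) auto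

lemma summable_on_Suc_iff:
  "(\<lambda>n. f (Suc n)) summable_on UNIV \<longleftrightarrow> f summable_on {0<..}"
  by (simp add: summable_on_def has_sum_Suc_iff)

lemma summable_on_nat_powr:
  assumes "\<sigma> > (1::real)"
  shows "(\<lambda>n. real n powr (-\<sigma>)) summable_on {0<..}"
  unfolding summable_on_Suc_iff[symmetric]
  using summable_real_Suc_powr[OF assms] by (intro norm_summable_imp_summable_on) auto

lemma zeta_has_sum:
  assumes s: "Re s > 1"
  shows "((\<lambda>n. of_nat n powr (-s)) has_sum zeta s) {0<..}"
  unfolding has_sum_Suc_iff[symmetric] zeta_eq_series[OF s]
  using summable_real_Suc_powr[OF s] zeta_series_sums[OF s]
  by (intro norm_summable_imp_has_sum) (auto simp: norm_powr_real_powr simp del: of_nat_Suc)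

text \<open>The surplus Re s - \<sigma> is spent on the growth of the coefficients, so that one
  criterion serves bounded coefficients as well as logarithms and the von Mangoldt function.\<close>

lemma abs_summable_powr_bounded:
  fixes a :: "nat \<Rightarrow> complex"
  assumes "Re s > \<sigma>" "\<sigma> > 1" "\<And>n. n > 0 \<Longrightarrow> norm (a n) \<le> C * real n powr (Re s - \<sigma>)"
  shows "(\<lambda>n. norm (a n * of_nat n powr (-s))) summable_on {0<..}"
proof (rule summable_on_comparison_test)
  show "(\<lambda>n. C * real n powr (-\<sigma>)) summable_on {0<..}"
    by (intro summable_on_cmult_right summable_on_nat_powr assms)
  show "norm (a n * of_nat n powr (-s)) \<le> C * real n powr (-\<sigma>)" if "n \<in> {0<..}" for n
  proof -
    have "norm (a n * of_nat n powr (-s)) = norm (a n) * real n powr (- Re s)"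
      using that by (simp add: norm_mult norm_powr_real_powr)
    also have "\<dots> \<le> (C * real n powr (Re s - \<sigma>)) * real n powr (- Re s)"
      using that assms(3)[of n] by (intro mult_right_mono) auto
    also have "\<dots> = C * (real n powr (Re s - \<sigma>) * real n powr (- Re s))" by simp
    also have "\<dots> = C * real n powr (-\<sigma>)"
      by (subst powr_add[symmetric]) simp
    finally show ?thesis .
  qed
qed auto

text \<open>The double sum over (m, n) converges absolutely and may be regrouped by the value k = m
  n. Complete multiplicativity of w makes it constant on each group.\<close>

lemma has_sum_dirichlet_product:
  fixes a b w :: "nat \<Rightarrow> complex"
  assumes w: "\<And>m n. w (m * n) = w m * w n"
    and abs: "(\<lambda>n. norm (a n * w n)) summable_on {0<..}" "(\<lambda>n. norm (b n * w n)) summable_on {0<..}"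
    and A: "((\<lambda>n. a n * w n) has_sum A) {0<..}" and B: "((\<lambda>n. b n * w n) has_sum B) {0<..}"
  shows "((\<lambda>k. (\<Sum>d | d dvd k. a d * b (k div d)) * w k) has_sum (A * B)) {0<..}"
proof -
  define f where "f = (\<lambda>(m,n). (a m * w m) * (b n * w n))"
  have abs': "(\<lambda>x. norm (f x)) summable_on {0<..} \<times> {0<..}"
  proof (rule iffD2[OF Infinite_Sum.abs_summable_on_Sigma_iff], intro conjI ballI)
    show "(\<lambda>y. norm (f (x, y))) summable_on {0<..}" for x
      using summable_on_cmult_right[OF abs(2), of "norm (a x * w x)"]
      by (simp add: f_def norm_mult)
    have "(\<lambda>x. \<Sum>\<^sub>\<infinity>y\<in>{0<..}. norm (f (x, y))) = (\<lambda>x. norm (a x * w x) * (\<Sum>\<^sub>\<infinity>y\<in>{0<..}. norm (b y * w y)))"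
      unfolding f_def by (simp add: norm_mult infsum_cmult_right' mult.assoc)
    moreover have "(\<lambda>x. norm (norm (a x * w x) * (\<Sum>\<^sub>\<infinity>y\<in>{0<..}. norm (b y * w y)))) summable_on {0<..}"
      using summable_on_cmult_left[OF abs(1), of "\<bar>\<Sum>\<^sub>\<infinity>y\<in>{0<..}. norm (b y * w y)\<bar>"]
      by (simp add: norm_mult abs_mult)
    ultimately show "(\<lambda>x. norm (\<Sum>\<^sub>\<infinity>y\<in>{0<..}. norm (f (x, y)))) summable_on {0<..}"
      by metis
  qed
  have f: "f summable_on {0<..} \<times> {0<..}" by (rule abs_summable_summable[OF abs'])
  have "(f has_sum (A * B)) ({0<..} \<times> {0<..})"
  proof -
    from f obtain S where S: "(f has_sum S) ({0<..} \<times> {0<..})" by (auto simp: summable_on_def)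
    have "((\<lambda>m. (a m * w m) * B) has_sum S) {0<..}"
      by (rule has_sum_SigmaD[OF S]) (use has_sum_cmult_right[OF B] in \<open>simp add: f_def\<close>)
    moreover have "((\<lambda>m. (a m * w m) * B) has_sum (A * B)) {0<..}"
      by (rule has_sum_cmult_left[OF A])
    ultimately show ?thesis using S has_sum_unique by blast
  qed
  \<comment> \<open>A pair of factors corresponds to its product together with the first factor as a
    divisor.\<close>
  moreover have "bij_betw (\<lambda>(k::nat,d). (d, k div d)) (SIGMA k:{0<..}. {d. d dvd k}) ({0<..} \<times> {0<..})"
    by (rule bij_betwI[of _ _ _ "\<lambda>(m,n). (m * n, m)"]) (auto simp: dvd_pos_nat div_greater_zero_iff dvd_imp_le)
  ultimately have "((\<lambda>x. f ((\<lambda>(k,d). (d, k div d)) x)) has_sum (A * B)) (SIGMA k:{0<..}. {d. d dvd k})"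
    by (subst has_sum_reindex_bij_betw)
  then show ?thesis
  proof (rule has_sum_SigmaD)
    fix k :: nat assume k: "k \<in> {0<..}"
    have "(\<Sum>d | d dvd k. a d * b (k div d)) * w k = (\<Sum>d | d dvd k. f (d, k div d))"
      unfolding sum_distrib_right
    proof (rule sum.cong[OF refl])
      fix d assume "d \<in> {d. d dvd k}"
      then have "w k = w d * w (k div d)" using w[of d "k div d"] by simp
      then show "a d * b (k div d) * w k = f (d, k div d)" by (simp add: f_def)
    qed
    moreover have "finite {d. d dvd k}" using k by (simp add: finite_divisors_nat)
    ultimately show "((\<lambda>y. f ((\<lambda>(k,d). (d, k div d)) (k, y))) has_sum (\<Sum>d | d dvd k. a d * b (k div d)) * w k) {d. d dvd k}"
      by (simp add: has_sum_finite)
  qed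
qed

section \<open>The Moebius function and the series for 1/zeta\<close>

lemma moebius_mult_prime:
  assumes "prime p" "\<not> p dvd d"
  shows "moebius (p * d) = - moebius d"
proof -
  have "coprime p d" using assms by (simp add: prime_imp_coprime)
  then have sq: "squarefree (p * d) \<longleftrightarrow> squarefree d"
    using assms(1) squarefree_mult_coprime squarefree_multD(2) squarefree_prime by blast
  show ?thesis
  proof (cases "squarefree d")
    case True
    have "d > 0" using assms(2) by (cases d) auto
    then have "prime_factors (p * d) = insert p (prime_factors d)"
      using assms by (auto simp: prime_factors_product prime_prime_factors)
    moreover have "p \<notin> prime_factors d" using assms by auto
    ultimately show ?thesis using True sq by (simp add: moebius_def)
  qed (use sq in \<open>simp add: moebius_def\<close>)
qed

text \<open>Fix a prime p dividing n. Among the squarefree divisors, d without the factor p is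
  paired with p d, and the two contributions cancel.\<close>

lemma sum_moebius_divisors:
  assumes "n > 0"
  shows "(\<Sum>d | d dvd n. moebius d) = (if n = 1 then 1 else 0)"
proof (cases "n = 1")
  case True
  then show ?thesis by (simp add: moebius_def)
next
  case False
  then obtain p where p: "prime p" "p dvd n" using prime_factor_nat by blast
  have fin: "finite {d. d dvd n}" using assms by (simp add: finite_divisors_nat)
  let ?S = "{d. d dvd n \<and> squarefree d}"
  let ?A = "{d. d dvd n \<and> squarefree d \<and> \<not> p dvd d}" and ?B = "{d. d dvd n \<and> squarefree d \<and> p dvd d}"
  have "(\<Sum>d | d dvd n. moebius d) = (\<Sum>d\<in>?S. moebius d)"
    by (rule sum.mono_neutral_right) (use fin in \<open>auto simp: moebius_def\<close>)
  also have "?S = ?A \<union> ?B" by auto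
  also have "(\<Sum>d\<in>?A \<union> ?B. moebius d) = (\<Sum>d\<in>?A. moebius d) + (\<Sum>d\<in>?B. moebius d)"
    by (rule sum.union_disjoint) (use fin in auto)
  also have "(\<Sum>d\<in>?B. moebius d) = (\<Sum>d\<in>?A. moebius (p * d))"
  proof (rule sum.reindex_bij_witness[of _ "\<lambda>d. p * d" "\<lambda>d. d div p"])
    fix d assume d: "d \<in> ?B"
    then obtain e where e: "d = p * e" by auto
    have "p \<noteq> 0" using p by auto
    have "\<not> p dvd e"
    proof
      assume "p dvd e"
      then have "p ^ 2 dvd d" using e by (auto simp: power2_eq_square)
      then show False using d p by (auto simp: squarefree_def)
    qed
    moreover have "squarefree e" using d e squarefree_multD(2)[of p e] by simp
    moreover have "e dvd n" using d e by (auto intro: dvd_mult_right)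
    ultimately show "d div p \<in> ?A" using e \<open>p \<noteq> 0\<close> by simp
  next
    fix d assume d: "d \<in> ?A"
    then have "coprime p d" using p by (simp add: prime_imp_coprime)
    then show "p * d \<in> ?B" using d p
      by (auto simp: squarefree_mult_coprime squarefree_prime divides_mult)
  next
    show "p * (d div p) = d" if "d \<in> ?B" for d using that by simp
    show "moebius (p * (d div p)) = moebius d" if "d \<in> ?B" for d
      using that by (metis (mono_tags, lifting) dvd_mult_div_cancel mem_Collect_eq)
    show "p * d div p = d" for d using p(1) prime_gt_0_nat[of p] by simp
  qed
  also have "\<dots> = (\<Sum>d\<in>?A. - moebius d)"
    by (rule sum.cong) (use p moebius_mult_prime in auto)
  finally show ?thesis using False by (simp add: sum_negf)
qed

lemma norm_moebius_le: "norm (of_int (moebius n) :: 'a :: real_normed_algebra_1) \<le> 1"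
  by (simp add: moebius_def norm_power)

lemma of_nat_powr_mult: "(of_nat (m * n) :: complex) powr s = of_nat m powr s * of_nat n powr s"
  by (simp add: powr_times_real)

lemma moebius_abs_summable:
  assumes s: "Re s > 1"
  shows "(\<lambda>n. norm (of_int (moebius n) * of_nat n powr (-s) :: complex)) summable_on {0<..}"
proof (rule abs_summable_powr_bounded[of "(1 + Re s) / 2" _ _ 1])
  show "norm (of_int (moebius n) :: complex) \<le> 1 * real n powr (Re s - (1 + Re s) / 2)" if "n > 0" for n
  proof -
    have "1 \<le> real n powr (Re s - (1 + Re s) / 2)" using that s by (intro ge_one_powr_ge_zero) auto
    then show ?thesis using norm_moebius_le[of n, where ?'a = complex] by linarith
  qed
qed (use s in auto)

text \<open>The Dirichlet convolution of the Moebius function with 1 is the indicator of k = 1, so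
  the product series has the single term 1. Non-vanishing of zeta for \<open>Re s > 1\<close> is a
  by-product.\<close>

lemma infsum_moebius_times_zeta:
  assumes s: "Re s > 1"
  shows "(\<Sum>\<^sub>\<infinity>n\<in>{0<..}. of_int (moebius n) * of_nat n powr (-s)) * zeta s = 1"
proof -
  let ?M = "\<Sum>\<^sub>\<infinity>n\<in>{0<..}. of_int (moebius n) * of_nat n powr (-s) :: complex"
  have M: "((\<lambda>n. of_int (moebius n) * of_nat n powr (-s)) has_sum ?M) {0<..}"
    using abs_summable_summable[OF moebius_abs_summable[OF s]] by simp
  have Z: "((\<lambda>n. 1 * of_nat n powr (-s)) has_sum zeta s) {0<..}"
    using zeta_has_sum[OF s] by simp
  have Z': "(\<lambda>n. norm (1 * of_nat n powr (-s) :: complex)) summable_on {0<..}"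
    by (rule abs_summable_powr_bounded[of "(1 + Re s) / 2" _ _ 1])
       (use s in \<open>auto intro!: ge_one_powr_ge_zero\<close>)
  have "((\<lambda>k. (\<Sum>d | d dvd k. of_int (moebius d) * 1) * of_nat k powr (-s)) has_sum (?M * zeta s)) {0<..}"
    by (rule has_sum_dirichlet_product[where a = "\<lambda>d. of_int (moebius d)" and b = "\<lambda>_. 1",
          OF of_nat_powr_mult moebius_abs_summable[OF s] Z' M Z])
  also have "?this \<longleftrightarrow> ((\<lambda>k::nat. if k = 1 then 1 else 0) has_sum (?M * zeta s)) {0<..}"
  proof (rule Infinite_Sum.has_sum_cong)
    fix k :: nat assume "k \<in> {0<..}"
    then have "(\<Sum>d | d dvd k. of_int (moebius d) * 1 :: complex) = (if k = 1 then 1 else 0)"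
      using sum_moebius_divisors[of k] by (simp flip: of_int_sum)
    then show "(\<Sum>d | d dvd k. of_int (moebius d) * 1) * of_nat k powr (-s) = (if k = 1 then 1 else 0 :: complex)"
      by simp
  qed
  also have "\<dots> \<longleftrightarrow> ((\<lambda>k. 1) has_sum (?M * zeta s)) {1::nat}"
    by (rule has_sum_cong_neutral) auto
  finally have "((\<lambda>k. 1) has_sum (?M * zeta s)) {1::nat}" .
  moreover have "((\<lambda>k. 1) has_sum (1::complex)) {1::nat}" by (simp add: has_sum_finite_iff)
  ultimately show ?thesis using has_sum_unique by blast
qed

lemma zeta_nonzero_Re_gt_1: "Re s > 1 \<Longrightarrow> zeta s \<noteq> 0"
  using infsum_moebius_times_zeta[of s] by auto

lemma moebius_has_sum:
  assumes s: "Re s > 1"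
  shows "((\<lambda>n. of_int (moebius n) * of_nat n powr (-s)) has_sum (1 / zeta s)) {0<..}"
  using abs_summable_summable[OF moebius_abs_summable[OF s]] infsum_moebius_times_zeta[OF s] zeta_nonzero_Re_gt_1[OF s]
  by (simp add: has_sum_infsum eq_divide_eq has_sum_iff)

section \<open>Non-vanishing on the line \<open>Re s = 1\<close>\<close>

text \<open>Locally uniform convergence of holomorphic terms passes to the derivatives, so only
  n^(-s) needs a local majorant. Absolute convergence of the differentiated series follows from ln n
  \<le> n^e / e, with e half the distance of \<open>Re s\<close> from 1.\<close>

lemma deriv_zeta_has_sum:
  assumes s: "Re s > 1"
  shows "((\<lambda>n. of_real (ln (real n)) * of_nat n powr (-s)) has_sum (- deriv zeta s)) {0<..}"
proof -
  let ?S = "{s::complex. Re s > 1}"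
  have "\<exists>g g'. \<forall>x\<in>?S. (\<lambda>n. of_nat (Suc n) powr (-x)) sums g x \<and>
      (\<lambda>n. - (of_real (ln (real (Suc n))) * of_nat (Suc n) powr (-x))) sums g' x \<and> (g has_field_derivative g' x) (at x)"
  proof (rule series_and_derivative_comparison_local)
    show "open ?S" by (rule open_halfspace_Re_gt)
    show "((\<lambda>x. of_nat (Suc n) powr (-x)) has_field_derivative
        - (of_real (ln (real (Suc n))) * of_nat (Suc n) powr (-x))) (at x)" for n and x :: complex
    proof -
      have "Ln (of_nat (Suc n)) = of_real (ln (real (Suc n)))"
        using Ln_of_real[of "real (Suc n)"] by (simp del: of_nat_Suc)
      moreover have "((\<lambda>x. of_nat (Suc n) powr (-x)) has_field_derivative
          (Ln (of_nat (Suc n)) * of_nat (Suc n) powr (-x)) * (-1)) (at x)"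
        by (rule DERIV_chain2[OF has_field_derivative_powr_right[OF of_nat_neq_0]])
           (auto intro!: derivative_eq_intros)
      ultimately show ?thesis by simp
    qed
    fix x assume "x \<in> ?S"
    then have x: "Re x > 1" by simp
    define d where "d = (Re x - 1) / 2"
    have d: "d > 0" "1 + d > 1" using x by (auto simp: d_def)
    have "norm (of_nat (Suc n) powr (-y) :: complex) \<le> real (Suc n) powr (-(1 + d))" if "y \<in> ball x d" for n y
    proof -
      have "Re y \<ge> 1 + d"
        using that abs_Re_le_cmod[of "x - y"] by (auto simp: dist_norm d_def field_simps)
      then have "real (Suc n) powr (- Re y) \<le> real (Suc n) powr (-(1 + d))"
        by (intro powr_mono) auto
      then show ?thesis by (simp add: norm_powr_real_powr del: of_nat_Suc)
    qed
    then show "\<exists>d h. 0 < d \<and> summable h \<and> (\<forall>\<^sub>F n in sequentially. \<forall>y\<in>ball x d \<inter> ?S. norm (of_nat (Suc n) powr (-y) :: complex) \<le> h n)"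
      using d summable_real_Suc_powr[OF d(2)]
      by (intro exI[of _ d] exI[of _ "\<lambda>n. real (Suc n) powr (-(1 + d))"]) (auto intro!: always_eventually)
  qed
  then obtain g g' where g: "\<And>x. x \<in> ?S \<Longrightarrow> (\<lambda>n. of_nat (Suc n) powr (-x)) sums g x"
    "\<And>x. x \<in> ?S \<Longrightarrow> (\<lambda>n. - (of_real (ln (real (Suc n))) * of_nat (Suc n) powr (-x))) sums g' x"
    "\<And>x. x \<in> ?S \<Longrightarrow> (g has_field_derivative g' x) (at x)" by blast
  have gz: "g x = zeta x" if "x \<in> ?S" for x
    using g(1)[OF that] zeta_series_sums[of x] zeta_eq_series[of x] that sums_unique2 by auto
  have "(zeta has_field_derivative g' s) (at s)"
  proof (rule has_field_derivative_transform_within_open[OF g(3)])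
    show "open ?S" by (rule open_halfspace_Re_gt)
  qed (use s gz in auto)
  then have "deriv zeta s = g' s" by (rule DERIV_imp_deriv)
  then have sums: "(\<lambda>n. of_real (ln (real (Suc n))) * of_nat (Suc n) powr (-s)) sums (- deriv zeta s)"
    using sums_minus[OF g(2)[of s]] s by simp
  define e where "e = (Re s - 1) / 2"
  have e: "e > 0" using s by (simp add: e_def)
  have "(\<lambda>n. norm (of_real (ln (real n)) * of_nat n powr (-s) :: complex)) summable_on {0<..}"
  proof (rule abs_summable_powr_bounded[of "1 + e" _ _ "1 / e"])
    show "norm (of_real (ln (real n)) :: complex) \<le> 1 / e * real n powr (Re s - (1 + e))" if "n > 0" for n
      using ln_powr_bound[of "real n" e] that e by (simp add: e_def field_simps)
  qed (use s e in \<open>auto simp: e_def field_simps\<close>)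
  then have "summable (\<lambda>n. norm (of_real (ln (real (Suc n))) * of_nat (Suc n) powr (-s) :: complex))"
    unfolding summable_on_Suc_iff[symmetric] by (rule summable_on_imp_summable)
  then show ?thesis
    unfolding has_sum_Suc_iff[symmetric] using sums by (rule norm_summable_imp_has_sum)
qed

text \<open>Summing the von Mangoldt function over the divisors of n gives ln n. Hence its series
  times zeta is the series of -zeta', and zeta may be divided out.\<close>

lemma mangoldt_has_sum:
  assumes s: "Re s > 1"
  shows "((\<lambda>n. mangoldt n * of_nat n powr (-s)) has_sum (- deriv zeta s / zeta s)) {0<..}"
proof -
  define e where "e = (Re s - 1) / 2"
  have e: "e > 0" using s by (simp add: e_def)
  have abs: "(\<lambda>n. norm (mangoldt n * of_nat n powr (-s) :: complex)) summable_on {0<..}"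
  proof (rule abs_summable_powr_bounded[of "1 + e" _ _ "1 / e"])
    show "norm (mangoldt n :: complex) \<le> 1 / e * real n powr (Re s - (1 + e))" if "n > 0" for n
    proof -
      have ee: "Re s - (1 + e) = e" by (simp add: e_def field_simps)
      have "norm (mangoldt n :: complex) \<le> ln (real n)" using mangoldt_le[of n] that by simp
      also have "\<dots> \<le> real n powr e / e" using ln_powr_bound[of "real n" e] that e by simp
      finally show ?thesis unfolding ee by simp
    qed
  qed (use s e in \<open>auto simp: e_def field_simps\<close>)
  let ?L = "\<Sum>\<^sub>\<infinity>n\<in>{0<..}. mangoldt n * of_nat n powr (-s) :: complex"
  have L: "((\<lambda>n. mangoldt n * of_nat n powr (-s)) has_sum ?L) {0<..}"
    using abs_summable_summable[OF abs] by simp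
  have Z: "((\<lambda>n. 1 * of_nat n powr (-s)) has_sum zeta s) {0<..}"
    using zeta_has_sum[OF s] by simp
  have Z': "(\<lambda>n. norm (1 * of_nat n powr (-s) :: complex)) summable_on {0<..}"
    by (rule abs_summable_powr_bounded[of "(1 + Re s) / 2" _ _ 1])
       (use s in \<open>auto intro!: ge_one_powr_ge_zero\<close>)
  have "((\<lambda>k. (\<Sum>d | d dvd k. mangoldt d * 1) * of_nat k powr (-s)) has_sum (?L * zeta s)) {0<..}"
    by (rule has_sum_dirichlet_product[where a = mangoldt and b = "\<lambda>_. 1", OF of_nat_powr_mult abs Z' L Z])
  also have "?this \<longleftrightarrow> ((\<lambda>n. of_real (ln (real n)) * of_nat n powr (-s)) has_sum (?L * zeta s)) {0<..}"
    by (rule Infinite_Sum.has_sum_cong) (simp add: mangoldt_sum)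
  finally have "?L * zeta s = - deriv zeta s"
    using deriv_zeta_has_sum[OF s] has_sum_unique by blast
  then have "?L = - deriv zeta s / zeta s"
    using zeta_nonzero_Re_gt_1[OF s] by (simp add: field_simps)
  then show ?thesis using L by simp
qed

lemma Re_of_nat_powr:
  assumes "n > 0"
  shows "Re (of_nat n powr (- Complex \<sigma> t)) = real n powr (-\<sigma>) * cos (t * ln (real n))"
proof -
  have "of_nat n powr (- Complex \<sigma> t) = exp (- Complex \<sigma> t * of_real (ln (real n)))"
    using assms Ln_of_real[of "real n"] by (simp add: powr_def)
  also have "Re \<dots> = exp (- \<sigma> * ln (real n)) * cos (t * ln (real n))"
    by (simp add: Re_exp)
  finally show ?thesis using assms by (simp add: powr_def)
qed

text \<open>With \<theta> = t ln n, the combination 3 + 4 cos \<theta> + cos 2\<theta> equals 2 (1 +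
  cos \<theta>)^2, so every term of the combined series is nonnegative.\<close>

lemma mertens_3_4_1:
  assumes "\<sigma> > 1"
  defines "L \<equiv> \<lambda>s. - deriv zeta s / zeta s"
  shows "3 * Re (L (Complex \<sigma> 0)) + 4 * Re (L (Complex \<sigma> t)) + Re (L (Complex \<sigma> (2 * t))) \<ge> 0"
proof -
  have h: "((\<lambda>n. Re (mangoldt n * of_nat n powr (- Complex \<sigma> u))) has_sum Re (L (Complex \<sigma> u))) {0<..}" for u
    unfolding L_def by (rule has_sum_Re[OF mangoldt_has_sum]) (use assms in simp)
  have "((\<lambda>n. 3 * Re (mangoldt n * of_nat n powr (- Complex \<sigma> 0)) + 4 * Re (mangoldt n * of_nat n powr (- Complex \<sigma> t))
      + Re (mangoldt n * of_nat n powr (- Complex \<sigma> (2 * t)))) has_sum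
      (3 * Re (L (Complex \<sigma> 0)) + 4 * Re (L (Complex \<sigma> t)) + Re (L (Complex \<sigma> (2 * t))))) {0<..}"
    by (intro has_sum_add has_sum_cmult_right h)
  then show ?thesis
  proof (rule has_sum_nonneg)
    fix n :: nat assume n: "n \<in> {0<..}"
    have R: "Re (mangoldt n * z) = mangoldt n * Re z" for z :: complex
      by (metis Re_complex_of_real Im_complex_of_real diff_zero mult_zero_left of_real_mangoldt times_complex.sel(1))
    define c where "c = cos (t * ln (real n))"
    have c: "cos (t * (2 * ln (real n))) = 2 * c\<^sup>2 - 1"
      using cos_double_cos[of "t * ln (real n)"] by (simp add: c_def mult_ac)
    have "3 * Re (mangoldt n * of_nat n powr (- Complex \<sigma> 0)) + 4 * Re (mangoldt n * of_nat n powr (- Complex \<sigma> t))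
      + Re (mangoldt n * of_nat n powr (- Complex \<sigma> (2 * t))) = mangoldt n * real n powr (-\<sigma>) * (2 * (1 + c)\<^sup>2)"
      using n by (simp add: R Re_of_nat_powr c c_def[symmetric] power2_eq_square algebra_simps)
    also have "\<dots> \<ge> 0" by (intro mult_nonneg_nonneg mangoldt_nonneg) auto
    finally show "0 \<le> 3 * Re (mangoldt n * of_nat n powr (- Complex \<sigma> 0)) + 4 * Re (mangoldt n * of_nat n powr (- Complex \<sigma> t))
      + Re (mangoldt n * of_nat n powr (- Complex \<sigma> (2 * t)))" .
  qed
qed

text \<open>The number k is the order of vanishing of f at z: writing f = (s - z)^k g with g
  non-zero near z, the logarithmic derivative is k / (s - z) plus a bounded term. The point w
  excludes the zero function.\<close>

lemma tendsto_logderiv_order: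
  assumes f: "f holomorphic_on UNIV" and nz: "f w \<noteq> 0"
  obtains k :: nat where "((\<lambda>s. (s - z) * (deriv f s / f s)) \<longlongrightarrow> of_nat k) (at z)"
    and "k = 0 \<longleftrightarrow> f z \<noteq> 0"
proof (cases "f z = 0")
  case False
  have "isCont f z" "isCont (deriv f) z"
    using holomorphic_on_imp_continuous_on[OF f] holomorphic_on_imp_continuous_on[OF holomorphic_deriv[OF f]]
    by (simp_all add: continuous_on_eq_continuous_at)
  then have "((\<lambda>s. (s - z) * (deriv f s / f s)) \<longlongrightarrow> (z - z) * (deriv f z / f z)) (at z)"
    using False by (intro tendsto_intros) (auto simp: isCont_def)
  then show thesis using that[of 0] False by simp
next
  case True
  have "\<not> f constant_on UNIV" using True nz by (metis UNIV_I constant_on_def)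
  from holomorphic_factor_zero_nonconstant[OF f open_UNIV connected_UNIV UNIV_I True this]
  obtain g r n where n: "0 < n" and r: "0 < r" and g: "g holomorphic_on ball z r"
    and fg: "\<And>w. w \<in> ball z r \<Longrightarrow> f w = (w - z) ^ n * g w" and g0: "\<And>w. w \<in> ball z r \<Longrightarrow> g w \<noteq> 0"
    by metis
  have "isCont g z" "isCont (deriv g) z"
    using g holomorphic_deriv[OF g] r by (auto intro!: continuous_on_interior holomorphic_on_imp_continuous_on)
  then have "((\<lambda>s. of_nat n + (s - z) * (deriv g s / g s)) \<longlongrightarrow> of_nat n + (z - z) * (deriv g z / g z)) (at z)"
    using g0[of z] r by (intro tendsto_intros) (auto simp: isCont_def)
  then have lim: "((\<lambda>s. of_nat n + (s - z) * (deriv g s / g s)) \<longlongrightarrow> of_nat n) (at z)" by simp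
  have "((\<lambda>s. (s - z) * (deriv f s / f s)) \<longlongrightarrow> of_nat n) (at z)"
  proof (rule Lim_transform_within_open[OF lim open_ball[of z r]])
    fix s assume s: "s \<in> ball z r" "s \<noteq> z"
    have "(g has_field_derivative deriv g s) (at s)"
      using g s holomorphic_derivI by blast
    then have "((\<lambda>w. (w - z) ^ n * g w) has_field_derivative
        (of_nat n * (s - z) ^ (n - 1) * g s + (s - z) ^ n * deriv g s)) (at s)"
      by (auto intro!: derivative_eq_intros)
    then have "(f has_field_derivative (of_nat n * (s - z) ^ (n - 1) * g s + (s - z) ^ n * deriv g s)) (at s)"
      by (rule has_field_derivative_transform_within_open[OF _ open_ball[of z r]]) (use s fg in auto)
    then have "deriv f s = of_nat n * (s - z) ^ (n - 1) * g s + (s - z) ^ n * deriv g s"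
      by (rule DERIV_imp_deriv)
    moreover obtain m where "n = Suc m" using n by (cases n) auto
    ultimately show "of_nat n + (s - z) * (deriv g s / g s) = (s - z) * (deriv f s / f s)"
      using s g0[of s] fg[of s] by (simp add: divide_simps) (simp add: algebra_simps)
  qed (use r in auto)
  then show thesis using that[of n] n True by simp
qed

text \<open>On the line, the 3-4-1 inequality at abscissa 1 + e is multiplied by e, and e tends to 0
  from the right. The limits are orders of vanishing, apart from the contribution of the pole at
  1.\<close>

lemma zeta_reg_nonzero_Re_ge_1:
  assumes "Re s \<ge> 1"
  shows "zeta_reg s \<noteq> 0"
proof (cases "Re s > 1")
  case True
  then show ?thesis using zeta_nonzero_Re_gt_1[OF True] by (auto simp: zeta_reg_def)
next
  case False
  define t where "t = Im s"
  have st: "s = Complex 1 t" using False assms by (simp add: t_def complex_eq_iff)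
  show ?thesis
  proof (cases "t = 0")
    case True
    then have "s = 1" using st by (simp add: complex_eq_iff)
    then show ?thesis by (simp add: zeta_reg_def)
  next
    case t: False
    define L where "L = (\<lambda>s. - deriv zeta s / zeta s)"
    let ?G = "\<lambda>e u. Re (of_real e * L (Complex (1 + e) u))"
    let ?D = "\<lambda>w. deriv zeta_reg w / zeta_reg w"
    have nz2: "zeta_reg 1 \<noteq> 0" by (simp add: zeta_reg_def)
    \<comment> \<open>At w = 1 + e + iu, L is 1/(w - 1) minus the logarithmic derivative of
      \<open>zeta_reg\<close>. Multiplied by e, the first part tends to 1 if u = 0 and to 0
      otherwise; the second tends to the order k of \<open>zeta_reg\<close> at 1 + iu.\<close>
    have ex: "\<exists>k::nat. ((\<lambda>e. ?G e u) \<longlongrightarrow> (if u = 0 then 1 else 0) - real k) (at_right 0)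
        \<and> (k = 0 \<longleftrightarrow> zeta_reg (Complex 1 u) \<noteq> 0)" for u
    proof -
      obtain k where k: "((\<lambda>s. (s - Complex 1 u) * (deriv zeta_reg s / zeta_reg s)) \<longlongrightarrow> of_nat k) (at (Complex 1 u))"
        "k = 0 \<longleftrightarrow> zeta_reg (Complex 1 u) \<noteq> 0"
        using tendsto_logderiv_order[OF zeta_reg_holomorphic nz2] by metis
      have Ce: "Complex (1 + e) u - Complex 1 u = of_real e" for e
        by (simp add: complex_eq_iff)
      have "filterlim (\<lambda>e. Complex (1 + e) u) (at (Complex 1 u)) (at_right 0)"
      proof (rule filterlim_atI)
        have "((\<lambda>e. Complex (1 + e) u) \<longlongrightarrow> Complex (1 + 0) u) (at_right 0)" by (intro tendsto_intros)
        then show "((\<lambda>e. Complex (1 + e) u) \<longlongrightarrow> Complex 1 u) (at_right 0)" by simp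
        show "\<forall>\<^sub>F x in at_right 0. Complex (1 + x) u \<noteq> Complex 1 u"
          by (auto simp: eventually_at_right_field intro!: exI[of _ 1])
      qed
      from filterlim_compose[OF k(1) this]
      have 1: "((\<lambda>e. of_real e * ?D (Complex (1 + e) u)) \<longlongrightarrow> of_nat k) (at_right 0)"
        by (simp add: Ce)
      have 2: "((\<lambda>e. of_real e / (Complex (1 + e) u - 1)) \<longlongrightarrow> (if u = 0 then 1 else 0)) (at_right 0)"
      proof (cases "u = 0")
        case True
        have "\<forall>\<^sub>F e in at_right 0. of_real e / (Complex (1 + e) u - 1) = 1"
          using eventually_at_right_less[of 0]
        proof eventually_elim
          case (elim e)
          have "Complex (1 + e) u - 1 = of_real e" using True by (simp add: complex_eq_iff)
          then show ?case using elim by simp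
        qed
        then show ?thesis using True by (simp add: tendsto_eventually)
      next
        case False
        have "((\<lambda>e. of_real e / (Complex (1 + e) u - 1)) \<longlongrightarrow> of_real 0 / (Complex (1 + 0) u - 1)) (at_right 0)"
          using False by (intro tendsto_intros) (auto simp: complex_eq_iff)
        then show ?thesis using False by simp
      qed
      have "\<forall>\<^sub>F e in at_right (0::real). of_real e / (Complex (1 + e) u - 1) - of_real e * ?D (Complex (1 + e) u)
          = of_real e * L (Complex (1 + e) u)"
        unfolding eventually_at_right_field
      proof (intro exI[of _ 1] conjI allI impI)
        fix e :: real assume e: "0 < e"
        define w where "w = Complex (1 + e) u"
        have w: "Re w > 1" using e by (simp add: w_def)
        then have w1: "w \<noteq> 1" by auto
        have "(zeta has_field_derivative deriv zeta w) (at w)"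
          using zeta_holomorphic w1 by (intro holomorphic_derivI[of _ "- {1}"]) auto
        then have "((\<lambda>s. (s - 1) * zeta s) has_field_derivative (zeta w + (w - 1) * deriv zeta w)) (at w)"
          by (auto intro!: derivative_eq_intros)
        then have "(zeta_reg has_field_derivative (zeta w + (w - 1) * deriv zeta w)) (at w)"
          by (rule has_field_derivative_transform_within_open[of _ _ _ "- {1}"]) (use w1 in \<open>auto simp: zeta_reg_def\<close>)
        then have "deriv zeta_reg w = zeta w + (w - 1) * deriv zeta w" by (rule DERIV_imp_deriv)
        then show "of_real e / (Complex (1 + e) u - 1) - of_real e * ?D (Complex (1 + e) u)
          = of_real e * L (Complex (1 + e) u)"
          unfolding w_def[symmetric] L_def using w1 zeta_nonzero_Re_gt_1[OF w]
          by (simp add: zeta_reg_def divide_simps) (simp add: algebra_simps)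
      qed auto
      from tendsto_Re[OF Lim_transform_eventually[OF tendsto_diff[OF 2 1] this]]
      have "((\<lambda>e. ?G e u) \<longlongrightarrow> Re ((if u = 0 then 1 else 0) - of_nat k)) (at_right 0)" .
      then show ?thesis using k(2) by (intro exI[of _ k]) (auto split: if_splits)
    qed
    obtain k0 k1 k2 :: nat where
      k0: "((\<lambda>e. ?G e 0) \<longlongrightarrow> 1 - real k0) (at_right 0)"
      and k1: "((\<lambda>e. ?G e t) \<longlongrightarrow> 0 - real k1) (at_right 0)" "k1 = 0 \<longleftrightarrow> zeta_reg s \<noteq> 0"
      and k2: "((\<lambda>e. ?G e (2 * t)) \<longlongrightarrow> 0 - real k2) (at_right 0)"
      using ex[of 0] ex[of t] ex[of "2 * t"] t st by auto
    \<comment> \<open>A zero at 1 + it would mean k1 \<ge> 1, and the left side would be at most 3 -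
      4 < 0.\<close>
    have "3 * (1 - real k0) + 4 * (0 - real k1) + (0 - real k2) \<ge> 0"
    proof (rule tendsto_lowerbound)
      show "((\<lambda>e. 3 * ?G e 0 + 4 * ?G e t
        + ?G e (2 * t)) \<longlongrightarrow> 3 * (1 - real k0) + 4 * (0 - real k1) + (0 - real k2)) (at_right 0)"
        by (intro tendsto_intros k0 k1 k2)
      show "\<forall>\<^sub>F e in at_right 0. 0 \<le> 3 * ?G e 0 + 4 * ?G e t
        + ?G e (2 * t)"
        unfolding eventually_at_right_field
      proof (intro exI[of _ 1] conjI allI impI)
        fix e :: real assume e: "0 < e"
        have "0 \<le> e * (3 * Re (L (Complex (1 + e) 0)) + 4 * Re (L (Complex (1 + e) t)) + Re (L (Complex (1 + e) (2 * t))))"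
          using e mertens_3_4_1[of "1 + e" t] unfolding L_def by (intro mult_nonneg_nonneg) auto
        then show "0 \<le> 3 * ?G e 0 + 4 * ?G e t
        + ?G e (2 * t)" by (simp add: algebra_simps)
      qed auto
    qed auto
    then have "k1 = 0" by (cases k1) auto
    then show ?thesis using k1(2) by simp
  qed
qed

section \<open>Mellin transforms\<close>

text \<open>Holomorphy in s makes a majorant of f itself sufficient. Cauchy's inequality on circles
  of radius r/2 turns G into the majorant 2 G / r for the derivative, hence for the difference
  quotients, and dominated convergence applies along every null sequence.\<close>

lemma field_differentiable_integral:
  fixes f :: "complex \<Rightarrow> 'a \<Rightarrow> complex"
  assumes r: "r > 0"
    and hol: "\<And>x. x \<in> space M \<Longrightarrow> (\<lambda>s. f s x) holomorphic_on ball s0 (2 * r)"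
    and meas: "\<And>s. s \<in> ball s0 (2 * r) \<Longrightarrow> f s \<in> borel_measurable M"
    and bd: "\<And>s x. x \<in> space M \<Longrightarrow> s \<in> ball s0 (2 * r) \<Longrightarrow> norm (f s x) \<le> G x"
    and G: "integrable M G"
  shows "(\<lambda>s. \<integral>x. f s x \<partial>M) field_differentiable (at s0)"
proof -
  define f' where "f' = (\<lambda>x. deriv (\<lambda>s. f s x) s0)"
  let ?F = "\<lambda>s. \<integral>x. f s x \<partial>M"
  have int: "integrable M (f s)" if "s \<in> ball s0 (2 * r)" for s
    by (rule Bochner_Integration.integrable_bound[OF G meas[OF that]])
       (use bd[OF _ that] in \<open>auto intro!: AE_I2 order_trans[OF _ abs_ge_self]\<close>)
  have G0: "G x \<ge> 0" if "x \<in> space M" for x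
    using bd[OF that, of s0] r by (auto intro: order_trans[OF norm_ge_zero])
  have dbound: "norm (deriv (\<lambda>s. f s x) w) \<le> 2 * G x / r" if x: "x \<in> space M" and w: "w \<in> cball s0 r" for x w
  proof -
    have sub: "cball w (r / 2) \<subseteq> ball s0 (2 * r)"
    proof
      fix y assume "y \<in> cball w (r / 2)"
      then show "y \<in> ball s0 (2 * r)" using w r dist_triangle[of s0 y w] by simp
    qed
    have "norm ((deriv ^^ 1) (\<lambda>s. f s x) w) \<le> fact 1 * G x / (r / 2) ^ 1"
    proof (rule Cauchy_inequality)
      show "(\<lambda>s. f s x) holomorphic_on ball w (r / 2)"
        using hol[OF x] by (rule holomorphic_on_subset) (use sub in auto)
      show "continuous_on (cball w (r / 2)) (\<lambda>s. f s x)"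
        using holomorphic_on_imp_continuous_on[OF hol[OF x]] sub by (rule continuous_on_subset)
      show "norm (f y x) \<le> G x" if "norm (w - y) = r / 2" for y
        using sub that by (intro bd x) (auto simp: dist_norm subset_iff)
    qed (use r in auto)
    then show ?thesis by (simp add: field_simps)
  qed
  have lip: "norm (f (s0 + h) x - f s0 x) \<le> 2 * G x / r * norm h" if x: "x \<in> space M" and h: "norm h \<le> r" for x h
  proof -
    have "norm (f (s0 + h) x - f s0 x) \<le> 2 * G x / r * norm (s0 + h - s0)"
    proof (rule field_differentiable_bound[where S = "cball s0 r" and f' = "deriv (\<lambda>s. f s x)"])
      fix z assume "z \<in> cball s0 r"
      then have "z \<in> ball s0 (2 * r)" using r by simp
      then show "((\<lambda>s. f s x) has_field_derivative deriv (\<lambda>s. f s x) z) (at z within cball s0 r)"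
        using holomorphic_derivI[OF hol[OF x] open_ball] by blast
    qed (use dbound[OF x] h r in \<open>auto simp: dist_norm\<close>)
    then show ?thesis by simp
  qed
  have lim: "((\<lambda>h. (f (s0 + h) x - f s0 x) / h) \<longlongrightarrow> f' x) (at 0)" if x: "x \<in> space M" for x
  proof -
    have "((\<lambda>s. f s x) has_field_derivative f' x) (at s0)"
      unfolding f'_def using hol[OF x] r by (intro holomorphic_derivI[of _ "ball s0 (2 * r)"]) auto
    then show ?thesis by (simp add: DERIV_def)
  qed
  have "((\<lambda>h. (?F (s0 + h) - ?F s0) / h) \<longlongrightarrow> (\<integral>x. f' x \<partial>M)) (at 0)"
    unfolding tendsto_at_iff_sequentially
  proof (intro allI impI)
    fix X :: "nat \<Rightarrow> complex" assume X: "\<forall>i. X i \<in> UNIV - {0}" "X \<longlonglongrightarrow> 0"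
    then have "\<forall>\<^sub>F n in sequentially. norm (X n) < r"
      using r by (simp add: tendsto_iff)
    then obtain N where N: "\<And>n. n \<ge> N \<Longrightarrow> norm (X n) < r"
      by (auto simp: eventually_sequentially)
    \<comment> \<open>Dropping the first N terms brings all increments below r, as
      \<open>lip\<close> demands.\<close>
    define Y where "Y = (\<lambda>n. X (n + N))"
    have Y: "norm (Y n) \<le> r" "Y n \<noteq> 0" "s0 + Y n \<in> ball s0 (2 * r)" for n
      using N[of "n + N"] X(1) r by (auto simp: Y_def dist_norm)
    have Y0: "Y \<longlonglongrightarrow> 0" unfolding Y_def using X(2) by (rule LIMSEQ_ignore_initial_segment)
    have YF: "filterlim Y (at 0) sequentially"
      using Y0 Y(2) by (intro filterlim_atI) auto
    have s0: "s0 \<in> ball s0 (2 * r)" using r by simp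
    have q: "(\<lambda>x. (f (s0 + Y n) x - f s0 x) / Y n) \<in> borel_measurable M" for n
      using meas[OF Y(3)] meas[OF s0] by measurable
    have L: "(\<lambda>n. (f (s0 + Y n) x - f s0 x) / Y n) \<longlonglongrightarrow> f' x" if "x \<in> space M" for x
      by (rule filterlim_compose[OF lim[OF that] YF])
    have "(\<lambda>n. \<integral>x. (f (s0 + Y n) x - f s0 x) / Y n \<partial>M) \<longlonglongrightarrow> (\<integral>x. f' x \<partial>M)"
    proof (rule integral_dominated_convergence)
      show "f' \<in> borel_measurable M" by (rule borel_measurable_LIMSEQ_metric[OF q L])
      show "integrable M (\<lambda>x. 2 * G x / r)" using G by simp
      show "AE x in M. (\<lambda>n. (f (s0 + Y n) x - f s0 x) / Y n) \<longlonglongrightarrow> f' x" using L by (rule AE_I2)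
      show "AE x in M. norm ((f (s0 + Y n) x - f s0 x) / Y n) \<le> 2 * G x / r" for n
      proof (rule AE_I2)
        fix x assume "x \<in> space M"
        from lip[OF this Y(1)[of n]] Y(2)[of n]
        show "norm ((f (s0 + Y n) x - f s0 x) / Y n) \<le> 2 * G x / r"
          by (simp add: norm_divide pos_divide_le_eq)
      qed
    qed (use q in auto)
    moreover have "(\<integral>x. (f (s0 + Y n) x - f s0 x) / Y n \<partial>M) = (?F (s0 + Y n) - ?F s0) / Y n" for n
      using int[OF Y(3)] int[OF s0] by simp
    ultimately have "(\<lambda>n. (?F (s0 + Y n) - ?F s0) / Y n) \<longlonglongrightarrow> (\<integral>x. f' x \<partial>M)"
      by (simp only:)
    then show "((\<lambda>h. (?F (s0 + h) - ?F s0) / h) \<circ> X) \<longlonglongrightarrow> (\<integral>x. f' x \<partial>M)"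
      unfolding o_def Y_def by (rule LIMSEQ_offset)
  qed
  then show ?thesis unfolding field_differentiable_def by (auto simp: DERIV_def)
qed

lemma open_strip: "open {s. a < Re s \<and> Re s < b}"
  and convex_strip: "convex {s. a < Re s \<and> Re s < b}"
  using open_halfspace_Re_gt[of a] open_halfspace_Re_lt[of b] convex_halfspace_Re_gt[of a] convex_halfspace_Re_lt[of b]
  by (simp_all add: Collect_conj_eq open_Int convex_Int)

lemma islimpt_of_real_interval:
  assumes "a < c" "c < (b::real)"
  shows "complex_of_real c islimpt of_real ` {a<..<b}"
proof -
  have "c islimpt {a<..<b}" using assms by (intro interior_limit_point) simp
  then show ?thesis
    by (rule islimpt_isCont_image) (auto simp: eventually_at_filter)
qed

text \<open>The identity theorem in the shape used below: a real interval inside the strip has limit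
  points there, so vanishing on it propagates to the strip.\<close>

lemma holomorphic_strip_eq_0:
  assumes f: "f holomorphic_on {s. a < Re s \<and> Re s < b}" and cd: "a \<le> c" "c < d" "d \<le> b"
    and 0: "\<And>t. c < t \<Longrightarrow> t < d \<Longrightarrow> f (of_real t) = 0" and s: "a < Re s" "Re s < b"
  shows "f s = 0"
proof (rule analytic_continuation[OF f])
  show "complex_of_real ((c + d) / 2) islimpt of_real ` {c<..<d}"
    by (rule islimpt_of_real_interval) (use cd in auto)
qed (use assms open_strip convex_strip in \<open>auto simp: convex_connected\<close>)

text \<open>The exponent is s, not the customary s - 1, so classical formulas appear with a shifted
  argument. With this normalization the critical line of zeta corresponds to
  \<open>Re s = -1/2\<close> for \<open>mertens_g1\<close>.\<close>

definition mellin :: "(real \<Rightarrow> real) \<Rightarrow> complex \<Rightarrow> complex" where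
  "mellin \<phi> s = (\<integral>x. of_real (indicator {0<..} x * \<phi> x) * of_real x powr s \<partial>lborel)"

definition mellin_integrable :: "(real \<Rightarrow> real) \<Rightarrow> real \<Rightarrow> bool" where
  "mellin_integrable \<phi> \<sigma> \<longleftrightarrow> \<phi> \<in> borel_measurable borel \<and> integrable lborel (\<lambda>x. indicator {0<..} x * \<bar>\<phi> x\<bar> * x powr \<sigma>)"

lemma norm_mellin_kernel:
  "norm (of_real (indicator {0<..} x * \<phi> x) * of_real x powr s) = indicator {0<..} x * \<bar>\<phi> x\<bar> * x powr (Re s)"
  for x :: real
  by (auto simp: indicator_def norm_mult norm_powr_real_powr)

lemma mellin_bound:
  assumes "mellin_integrable \<phi> (Re s)"
  shows "norm (mellin \<phi> s) \<le> (\<integral>x. indicator {0<..} x * \<bar>\<phi> x\<bar> * x powr (Re s) \<partial>lborel)"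
  unfolding mellin_def norm_mellin_kernel[symmetric] by (rule integral_norm_bound)

lemma powr_le_add_powr: "(x::real) > 0 \<Longrightarrow> a \<le> c \<Longrightarrow> c \<le> b \<Longrightarrow> x powr c \<le> x powr a + x powr b"
  using powr_mono[of c b x] powr_mono'[of a c x] by (cases "x \<ge> 1") (auto intro: order_trans add_increasing add_increasing2)

lemma mellin_holomorphic:
  assumes "\<And>\<sigma>. a < \<sigma> \<Longrightarrow> \<sigma> < b \<Longrightarrow> mellin_integrable \<phi> \<sigma>"
  shows "mellin \<phi> holomorphic_on {s. a < Re s \<and> Re s < b}"
proof -
  have "mellin \<phi> field_differentiable (at s)" if s: "a < Re s" "Re s < b" for s
  proof -
    define r where "r = min (Re s - a) (b - Re s) / 4"
    have r: "r > 0" "a < Re s - 2 * r" "Re s + 2 * r < b" using s by (auto simp: r_def min_def field_simps)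
    have i: "mellin_integrable \<phi> (Re s - 2 * r)" "mellin_integrable \<phi> (Re s + 2 * r)"
      using r by (auto intro!: assms)
    then have m [measurable]: "\<phi> \<in> borel_measurable borel" by (simp add: mellin_integrable_def)
    show ?thesis unfolding mellin_def[abs_def]
    proof (rule field_differentiable_integral[OF r(1)])
      \<comment> \<open>Majorant for all t in the ball at once: x^c lies below the sum of the powers
        with the two extreme exponents.\<close>
      let ?G = "\<lambda>x. indicator {0<..} x * \<bar>\<phi> x\<bar> * x powr (Re s - 2 * r) + indicator {0<..} x * \<bar>\<phi> x\<bar> * x powr (Re s + 2 * r)"
      show "integrable lborel ?G" using i by (auto simp: mellin_integrable_def)
      show "(\<lambda>s. of_real (indicator {0<..} x * \<phi> x) * of_real x powr s) holomorphic_on ball s (2 * r)" for x :: real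
        by (cases "x = 0") (auto intro!: holomorphic_intros)
      show "(\<lambda>x. of_real (indicator {0<..} x * \<phi> x) * of_real x powr t) \<in> borel_measurable lborel" for t :: complex
      proof -
        have "(\<lambda>x. of_real (indicator {0<..} x * \<phi> x) * of_real x powr t) =
            (\<lambda>x. of_real (indicator {0<..} x * \<phi> x) * exp (t * of_real (ln x)))"
          by (auto simp: fun_eq_iff indicator_def powr_def Ln_of_real)
        moreover have "(\<lambda>x. of_real (indicator {0<..} x * \<phi> x) * exp (t * of_real (ln x))) \<in> borel_measurable borel"
          by measurable
        ultimately show ?thesis by simp
      qed
      fix t x assume t: "t \<in> ball s (2 * r)"
      then have "Re s - 2 * r \<le> Re t" "Re t \<le> Re s + 2 * r"
        using abs_Re_le_cmod[of "s - t"] by (auto simp: dist_norm)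
      then show "norm (of_real (indicator {0<..} x * \<phi> x) * of_real x powr t) \<le> ?G x"
        unfolding norm_mellin_kernel using powr_le_add_powr[of x "Re s - 2 * r" "Re t" "Re s + 2 * r"]
        by (auto simp: indicator_def simp flip: distrib_left intro!: mult_left_mono)
    qed
  qed
  then show ?thesis by (auto simp: holomorphic_on_def intro: field_differentiable_at_within)
qed

lemma has_bochner_integral_powr_from_0:
  fixes \<sigma> c :: real
  assumes "\<sigma> > 0" "c > 0"
  shows "has_bochner_integral lborel (\<lambda>x. indicator {0<..c} x * x powr (\<sigma> - 1)) (c powr \<sigma> / \<sigma>)"
proof (rule has_bochner_integral_nn_integral)
  have "((\<lambda>x. x powr (\<sigma> - 1)) has_integral (c powr (\<sigma> - 1 + 1) / (\<sigma> - 1 + 1))) {0..c}"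
    by (rule has_integral_powr_from_0) (use assms in auto)
  then have "(\<integral>\<^sup>+x. ennreal (indicator {0..c} x * x powr (\<sigma> - 1)) \<partial>lborel) = ennreal (c powr \<sigma> / \<sigma>)"
    using nn_integral_has_integral_lebesgue[of "{0..c}" "\<lambda>x. x powr (\<sigma> - 1)"] by simp
  also have "(\<lambda>x. indicator {0..c} x * x powr (\<sigma> - 1)) = (\<lambda>x. indicator {0<..c} x * x powr (\<sigma> - 1))"
    by (auto simp: fun_eq_iff indicator_def)
  finally show "(\<integral>\<^sup>+x. ennreal (indicator {0<..c} x * x powr (\<sigma> - 1)) \<partial>lborel) = ennreal (c powr \<sigma> / \<sigma>)" .
qed (use assms in auto)

lemma mellin_of_real:
  "mellin \<phi> (of_real \<sigma>) = of_real (\<integral>x. indicator {0<..} x * \<phi> x * x powr \<sigma> \<partial>lborel)"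
proof -
  have "mellin \<phi> (of_real \<sigma>) = (\<integral>x. complex_of_real (indicator {0<..} x * \<phi> x * x powr \<sigma>) \<partial>lborel)"
    unfolding mellin_def by (rule Bochner_Integration.integral_cong) (auto simp: indicator_def powr_of_real)
  also have "\<dots> = of_real (\<integral>x. indicator {0<..} x * \<phi> x * x powr \<sigma> \<partial>lborel)" by (rule integral_complex_of_real)
  finally show ?thesis .
qed

section \<open>The Mellin transform of g_1\<close>

lemma mertens_g_floor: "mertens_g x = (\<Sum>n=1..nat \<lfloor>x\<rfloor>. of_int (moebius n) / real n)"
  unfolding mertens_g_def
  by (rule sum.cong) (auto simp: le_nat_floor le_floor_iff intro: order_trans[OF _ of_nat_floor] nat_floor_neg, linarith)

lemma mertens_g1_measurable [measurable]: "mertens_g1 \<in> borel_measurable borel"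
proof -
  have "(\<lambda>x::real. (\<Sum>n=1..nat \<lfloor>inverse x\<rfloor>. of_int (moebius n) / real n)) \<in> borel_measurable borel"
    by (rule measurable_compose[where N = "count_space UNIV" and g = "\<lambda>k. \<Sum>n=1..nat k. of_int (moebius n) / real n"]) auto
  then show ?thesis
    unfolding mertens_g1_def[abs_def] mertens_g_floor by measurable
qed

lemma mertens_g1_eq_0: "x > 1 \<Longrightarrow> mertens_g1 x = 0"
  using inverse_less_1_iff[of x]
  by (auto simp: mertens_g1_def mertens_g_def intro!: sum.neutral)

text \<open>Reading n \<le> 1/x as x \<le> 1/n turns g_1 into a superposition of the truncations of
  1/x to (0, 1/n], which can be integrated one by one. For each x only finitely many terms are
  non-zero.\<close>

lemma mertens_g1_sums:
  assumes "x > 0"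
  shows "(\<lambda>n. of_int (moebius (Suc n)) / real (Suc n) * (indicator {0<..1 / real (Suc n)} x * (1 / x))) sums mertens_g1 x"
proof -
  have iff: "real m \<le> inverse x \<longleftrightarrow> x \<le> 1 / real m" if "m > 0" for m
    using assms that by (simp add: field_simps)
  have iffS: "real (Suc n) \<le> inverse x \<longleftrightarrow> x \<le> 1 / real (Suc n)" for n
    by (rule iff) simp
  have fin: "finite {n. real (Suc n) \<le> inverse x}"
    by (rule finite_subset[of _ "{..nat \<lfloor>inverse x\<rfloor>}"]) (auto simp del: of_nat_Suc dest!: le_nat_floor)
  have "(\<lambda>n. of_int (moebius (Suc n)) / real (Suc n) * (indicator {0<..1 / real (Suc n)} x * (1 / x))) sums
    (\<Sum>n | real (Suc n) \<le> inverse x. of_int (moebius (Suc n)) / real (Suc n) * (indicator {0<..1 / real (Suc n)} x * (1 / x)))"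
    by (rule sums_finite[OF fin]) (use iffS assms in \<open>auto simp: indicator_def simp del: of_nat_Suc\<close>)
  also have "(\<Sum>n | real (Suc n) \<le> inverse x. of_int (moebius (Suc n)) / real (Suc n) * (indicator {0<..1 / real (Suc n)} x * (1 / x)))
     = (\<Sum>n | n \<ge> 1 \<and> real n \<le> inverse x. of_int (moebius n) / real n * (1 / x))"
    by (rule sum.reindex_bij_witness[of _ "\<lambda>n. n - 1" Suc]) (use iff iffS assms in \<open>auto simp: indicator_def simp del: of_nat_Suc\<close>)
  also have "\<dots> = mertens_g1 x"
    unfolding mertens_g1_def mertens_g_def by (simp add: sum_distrib_left divide_inverse mult_ac)
  finally show ?thesis .
qed

text \<open>The integral of x^(\<sigma> - 1) over (0, 1/n] is n^(-\<sigma>) / \<sigma>. Summing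
  against \<mu>(n)/n gives 1 / (\<sigma> zeta(1 + \<sigma>)); the interchange is justified because
  the integrals of the absolute values are dominated by the convergent series of
  \<open>c n\<close>.\<close>

lemma mertens_g1_mellin_real:
  assumes \<sigma>: "\<sigma> > 0"
  shows "mellin_integrable mertens_g1 \<sigma>"
    and "zeta_reg (of_real \<sigma> + 1) * mellin mertens_g1 (of_real \<sigma>) = 1"
proof -
  define f where "f = (\<lambda>n x. of_int (moebius (Suc n)) / real (Suc n) * (indicator {0<..1 / real (Suc n)} x * x powr (\<sigma> - 1)))"
  define c where "c = (\<lambda>n. real (Suc n) powr (-(1 + \<sigma>)) / \<sigma>)"
  have hb: "has_bochner_integral lborel (\<lambda>x. indicator {0<..1 / real (Suc n)} x * x powr (\<sigma> - 1)) ((1 / real (Suc n)) powr \<sigma> / \<sigma>)" for n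
    by (rule has_bochner_integral_powr_from_0) (use \<sigma> in auto)
  have c: "(1 / real (Suc n)) powr \<sigma> / \<sigma> / real (Suc n) = c n" for n
  proof -
    have "-(1 + \<sigma>) = -\<sigma> - 1" by simp
    then have "c n = real (Suc n) powr (-\<sigma> - 1) / \<sigma>" unfolding c_def by (simp only:)
    also have "\<dots> = real (Suc n) powr (-\<sigma>) / real (Suc n) / \<sigma>"
      unfolding powr_diff by simp
    finally show ?thesis by (simp add: powr_divide powr_minus_divide del: of_nat_Suc)
  qed
  have f: "has_bochner_integral lborel (f n) (of_int (moebius (Suc n)) * c n)" for n
    using has_bochner_integral_mult_right[OF hb[of n], of "of_int (moebius (Suc n)) / real (Suc n)"]
    unfolding f_def c[symmetric] by (simp add: field_simps)
  have nf: "(\<integral>x. norm (f n x) \<partial>lborel) = \<bar>of_int (moebius (Suc n))\<bar> * c n" for n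
  proof -
    have "norm (f n x) = \<bar>of_int (moebius (Suc n))\<bar> / real (Suc n) * (indicator {0<..1 / real (Suc n)} x * x powr (\<sigma> - 1))" for x
      by (simp add: f_def abs_mult)
    then have "(\<integral>x. norm (f n x) \<partial>lborel) = (\<integral>x. \<bar>of_int (moebius (Suc n))\<bar> / real (Suc n) * (indicator {0<..1 / real (Suc n)} x * x powr (\<sigma> - 1)) \<partial>lborel)"
      by (simp only:)
    also have "\<dots> = \<bar>of_int (moebius (Suc n))\<bar> / real (Suc n) * ((1 / real (Suc n)) powr \<sigma> / \<sigma>)"
      by (rule has_bochner_integral_integral_eq[OF has_bochner_integral_mult_right[OF hb]])
    finally show ?thesis unfolding c[symmetric] by simp
  qed
  have sc: "summable c" unfolding c_def by (intro summable_divide summable_real_Suc_powr) (use \<sigma> in auto)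
  have m1: "\<bar>of_int (moebius n) :: real\<bar> \<le> 1" for n using norm_moebius_le[of n, where ?'a = real] by simp
  have s2: "summable (\<lambda>n. \<integral>x. norm (f n x) \<partial>lborel)"
  proof (rule summable_comparison_test'[OF sc])
    show "norm (\<integral>x. norm (f n x) \<partial>lborel) \<le> c n" for n
      unfolding nf using m1[of "Suc n"] \<sigma> mult_right_mono[OF m1[of "Suc n"], of "c n"] by (simp add: c_def abs_mult)
  qed
  have sx: "(\<lambda>n. f n x) sums (indicator {0<..} x * mertens_g1 x * x powr \<sigma>)" for x
  proof (cases "x > 0")
    case True
    have "(\<lambda>n. of_int (moebius (Suc n)) / real (Suc n) * (indicator {0<..1 / real (Suc n)} x * (1 / x)) * x powr \<sigma>) sums (mertens_g1 x * x powr \<sigma>)"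
      by (rule sums_mult2[OF mertens_g1_sums[OF True]])
    then show ?thesis using True by (simp add: f_def powr_diff field_simps)
  next
    case False
    then have "f n x = 0" for n by (auto simp: f_def indicator_def)
    then show ?thesis using False by simp
  qed
  have s1: "summable (\<lambda>n. norm (f n x))" for x
  proof (cases "x > 0")
    case True
    have "finite {n. real (Suc n) \<le> inverse x}"
      by (rule finite_subset[of _ "{..nat \<lfloor>inverse x\<rfloor>}"]) (auto simp del: of_nat_Suc dest!: le_nat_floor)
    moreover have "norm (f n x) = 0" if "n \<notin> {n. real (Suc n) \<le> inverse x}" for n
      using that True by (auto simp: f_def indicator_def field_simps)
    ultimately show ?thesis by (rule summable_finite)
  next
    case False
    then have "f n x = 0" for n by (auto simp: f_def indicator_def)
    then show ?thesis by simp
  qed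
  have int: "integrable lborel (f n)" for n using f by (simp add: has_bochner_integral_iff)
  have AE: "AE x in lborel. summable (\<lambda>n. norm (f n x))" using s1 by simp
  have eq: "(\<lambda>x. \<Sum>n. f n x) = (\<lambda>x. indicator {0<..} x * mertens_g1 x * x powr \<sigma>)"
    using sx by (auto simp: fun_eq_iff sums_iff)
  have I: "integrable lborel (\<lambda>x. indicator {0<..} x * mertens_g1 x * x powr \<sigma>)"
    using integrable_suminf[OF int AE s2] unfolding eq .
  have S: "(\<lambda>n. of_int (moebius (Suc n)) * c n) sums (\<integral>x. indicator {0<..} x * mertens_g1 x * x powr \<sigma> \<partial>lborel)"
    using sums_integral[OF int AE s2] unfolding eq has_bochner_integral_integral_eq[OF f] .
  have "integrable lborel (\<lambda>x. \<bar>indicator {0<..} x * mertens_g1 x * x powr \<sigma>\<bar>)" using I by simp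
  then show mi: "mellin_integrable mertens_g1 \<sigma>"
    by (simp add: mellin_integrable_def abs_mult)
  define s where "s = complex_of_real (1 + \<sigma>)"
  have s: "Re s > 1" using \<sigma> by (simp add: s_def)
  have "(\<lambda>n. of_real (of_int (moebius (Suc n)) * c n)) sums mellin mertens_g1 (of_real \<sigma>)"
    unfolding mellin_of_real by (rule sums_of_real[OF S])
  moreover have "of_real (of_int (moebius (Suc n)) * c n) = of_int (moebius (Suc n)) * of_nat (Suc n) powr (-s) / of_real \<sigma>" for n
    unfolding c_def s_def using powr_of_real[of "real (Suc n)" "-(1 + \<sigma>)"] by (simp del: of_nat_Suc)
  ultimately have A: "(\<lambda>n. of_int (moebius (Suc n)) * of_nat (Suc n) powr (-s) / of_real \<sigma>) sums mellin mertens_g1 (of_real \<sigma>)"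
    by simp
  have "((\<lambda>n. of_int (moebius (Suc n)) * of_nat (Suc n) powr (-s)) has_sum (1 / zeta s)) UNIV"
    using moebius_has_sum[OF s] by (rule has_sum_Suc_iff[THEN iffD2])
  then have "(\<lambda>n. of_int (moebius (Suc n)) * of_nat (Suc n) powr (-s) / of_real \<sigma>) sums (1 / zeta s / of_real \<sigma>)"
    by (intro sums_divide has_sum_imp_sums)
  then have "mellin mertens_g1 (of_real \<sigma>) = 1 / zeta s / of_real \<sigma>" using A sums_unique2 by blast
  moreover have "zeta_reg (of_real \<sigma> + 1) = of_real \<sigma> * zeta s"
    using \<sigma> by (simp add: zeta_reg_def s_def add_ac)
  ultimately show "zeta_reg (of_real \<sigma> + 1) * mellin mertens_g1 (of_real \<sigma>) = 1"
    using zeta_nonzero_Re_gt_1[OF s] \<sigma> by simp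
qed

text \<open>Known for real arguments in (0, 1), the identity extends as far to the left as the
  integral converges absolutely. This is the bridge from integrability to zero-freeness: a zero of
  \<open>zeta_reg\<close> at s + 1 would turn the identity into 0 = 1.\<close>

lemma mertens_g1_mellin:
  assumes a: "\<And>\<sigma>. a < \<sigma> \<Longrightarrow> mellin_integrable mertens_g1 \<sigma>" "a \<le> 0" and s: "Re s > a"
  shows "zeta_reg (s + 1) * mellin mertens_g1 s = 1"
proof -
  define b where "b = max 1 (Re s + 1)"
  have "zeta_reg (s + 1) * mellin mertens_g1 s - 1 = 0"
  proof (rule holomorphic_strip_eq_0[of "\<lambda>s. zeta_reg (s + 1) * mellin mertens_g1 s - 1" a b 0 1])
    have "(\<lambda>s. zeta_reg (s + 1)) holomorphic_on A" for A
      by (rule holomorphic_on_compose[of "\<lambda>s. s + 1" _ zeta_reg, unfolded o_def]) (intro holomorphic_intros)+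
    then show "(\<lambda>s. zeta_reg (s + 1) * mellin mertens_g1 s - 1) holomorphic_on {s. a < Re s \<and> Re s < b}"
      by (intro holomorphic_intros mellin_holomorphic a)
  qed (use a s in \<open>auto simp: b_def mertens_g1_mellin_real\<close>)
  then show ?thesis by simp
qed

lemma integrable_powr_unit_interval:
  assumes "\<sigma> > -1"
  shows "integrable lborel (\<lambda>x. indicator {0<..1} x * x powr \<sigma> :: real)"
    and "(\<integral>x. indicator {0<..1} x * x powr \<sigma> \<partial>lborel) = 1 / (\<sigma> + 1)"
  using has_bochner_integral_powr_from_0[of "\<sigma> + 1" 1] assms by (simp_all add: has_bochner_integral_iff)

section \<open>From finite norms to zero-free half-planes\<close>

lemma Lp_norm_finite_iff:
  assumes [measurable]: "f \<in> borel_measurable borel"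
  shows "Lp_norm p f < \<infinity> \<longleftrightarrow> integrable lborel (\<lambda>x. indicator {0<..} x * \<bar>f x\<bar> powr p)"
proof -
  let ?I = "\<integral>\<^sup>+x\<in>{0<..}. ennreal (\<bar>f x\<bar> powr p) \<partial>lborel"
  have "Lp_norm p f < \<infinity> \<longleftrightarrow> ?I < \<infinity>"
    unfolding Lp_norm_def Let_def by (simp add: less_top)
  also have "?I = (\<integral>\<^sup>+x. ennreal (norm (indicator {0<..} x * \<bar>f x\<bar> powr p)) \<partial>lborel)"
    by (rule nn_integral_cong) (auto simp: indicator_def)
  finally show ?thesis by (simp add: integrable_iff_bounded)
qed

text \<open>A crude form of Young's inequality, sufficient for integrability: according to whether b
  is below or above a^(p - 1), one of the two powers alone dominates the product.\<close>

lemma mult_le_powr_add_powr: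
  fixes a b p q :: real
  assumes "a \<ge> 0" "b > 0" "p > 1" "q = p / (p - 1)"
  shows "a * b \<le> a powr p + b powr q"
proof (cases "a = 0")
  case False
  then have a: "a > 0" using assms by simp
  show ?thesis
  proof (cases "b \<le> a powr (p - 1)")
    case True
    then have "a * b \<le> a powr 1 * a powr (p - 1)" using a by simp
    also have "\<dots> = a powr p" unfolding powr_add[symmetric] by simp
    finally show ?thesis by (simp add: add_increasing2)
  next
    case False
    then have "(a powr (p - 1)) powr (1 / (p - 1)) \<le> b powr (1 / (p - 1))"
      using assms by (intro powr_mono2) auto
    then have "a \<le> b powr (1 / (p - 1))" using a assms by (simp add: powr_powr)
    then have "a * b \<le> b powr (1 / (p - 1)) * b powr 1" using assms by simp
    also have "\<dots> = b powr (1 / (p - 1) + 1)" unfolding powr_add ..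
    also have "1 / (p - 1) + 1 = q" unfolding assms(4) using assms(3) by (simp add: divide_simps)
    finally show ?thesis by (simp add: add_increasing)
  qed
qed (use assms in auto)

text \<open>Young's inequality splits the integrand into |g_1|^p and x^(\<sigma> q). As g_1 lives on
  (0, 1], the second part requires \<sigma> q > -1, which is exactly \<sigma> > 1/p - 1.\<close>

lemma mellin_integrable_mertens_g1_Lp:
  assumes Lp: "Lp_norm p mertens_g1 < \<infinity>" and p: "p > 1" and \<sigma>: "\<sigma> > 1 / p - 1"
  shows "mellin_integrable mertens_g1 \<sigma>"
proof -
  define q where "q = p / (p - 1)"
  let ?f = "\<lambda>x. indicator {0<..} x * \<bar>mertens_g1 x\<bar> * x powr \<sigma>"
  let ?h = "\<lambda>x. indicator {0<..} x * \<bar>mertens_g1 x\<bar> powr p + indicator {0<..1} x * x powr (\<sigma> * q)"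
  have "\<sigma> * q > -1"
  proof -
    have "(1 / p - 1) * q = -1" using p by (simp add: q_def field_simps)
    moreover have "(1 / p - 1) * q < \<sigma> * q" using \<sigma> p by (intro mult_strict_right_mono) (auto simp: q_def)
    ultimately show ?thesis by simp
  qed
  then have "integrable lborel (\<lambda>x. ?h x)"
    by (intro Bochner_Integration.integrable_add integrable_powr_unit_interval
          iffD1[OF Lp_norm_finite_iff[OF mertens_g1_measurable] Lp])
  then have "integrable lborel (\<lambda>x. ?f x)"
  proof (rule Bochner_Integration.integrable_bound)
    show "AE x in lborel. norm (?f x)
        \<le> norm (?h x)"
    proof (rule AE_I2)
      fix x :: real
      consider "x \<le> 0" | "x > 1" | "0 < x" "x \<le> 1" by linarith
      then show "norm (?f x)
        \<le> norm (?h x)"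
      proof cases
        case 3
        then show ?thesis
          using mult_le_powr_add_powr[of "\<bar>mertens_g1 x\<bar>" "x powr \<sigma>" p q] p by (simp add: q_def powr_powr)
      qed (auto simp: mertens_g1_eq_0)
    qed
  qed measurable
  then show ?thesis by (simp add: mellin_integrable_def)
qed

lemma zeta_nonzero_of_Lp:
  assumes Lp: "Lp_norm p mertens_g1 < \<infinity>" and p: "p > 1" and s: "Re s > 1 / p"
  shows "zeta_reg s \<noteq> 0"
proof -
  have "zeta_reg (s - 1 + 1) * mellin mertens_g1 (s - 1) = 1"
    by (rule mertens_g1_mellin[of "1 / p - 1"])
       (use mellin_integrable_mertens_g1_Lp[OF Lp p] p s in \<open>auto simp: field_simps\<close>)
  then show ?thesis by auto
qed

text \<open>A zero on the critical line makes \<open>zeta_reg (s + e)\<close> of order e, so the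
  Mellin transform would have to grow at least like 1/e. Square integrability permits only e^(-1/2),
  expressed here by a bound with a free weight l.\<close>

lemma zeta_nonzero_of_L2:
  assumes L2: "Lp_norm 2 mertens_g1 < \<infinity>" and s: "Re s \<ge> 1 / 2"
  shows "zeta_reg s \<noteq> 0"
proof
  assume z: "zeta_reg s = 0"
  let ?g = "\<lambda>x. indicator {0<..} x * \<bar>mertens_g1 x\<bar> powr 2"
  let ?h = "\<lambda>e x::real. indicator {0<..1} x * x powr (2 * e - 1)"
  let ?k = "\<lambda>e x. indicator {0<..} x * \<bar>mertens_g1 x\<bar> * x powr (e - 1/2)"
  from z have s12: "Re s = 1 / 2" using zeta_nonzero_of_Lp[OF L2, of s] s by fastforce
  define N where "N = (\<integral>x. ?g x \<partial>lborel)"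
  have iN: "integrable lborel (\<lambda>x. ?g x)"
    by (rule iffD1[OF Lp_norm_finite_iff[OF mertens_g1_measurable] L2])
  \<comment> \<open>From a b \<le> l a^2 + b^2 / l with a = |g_1(x)| and b = x^(e - 1/2), whose
    square integrates to 1/(2e) over (0, 1]. Choosing l later replaces the optimization in
    Cauchy-Schwarz.\<close>
  have F: "norm (mellin mertens_g1 (s - 1 + of_real e)) \<le> l * N + 1 / (2 * l * e)" if e: "e > 0" and l: "l > 0" for e l
  proof -
    have mi: "mellin_integrable mertens_g1 (e - 1/2)"
      by (rule mellin_integrable_mertens_g1_Lp[OF L2]) (use e in auto)
    have i1: "integrable lborel (\<lambda>x::real. ?h e x)"
      "(\<integral>x. ?h e x \<partial>lborel) = 1 / (2 * e)"
      using integrable_powr_unit_interval[of "2 * e - 1"] e by auto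
    have "norm (mellin mertens_g1 (s - 1 + of_real e)) \<le> (\<integral>x. ?k e x \<partial>lborel)"
      using mellin_bound[of mertens_g1 "s - 1 + of_real e"] mi s12 by (simp add: algebra_simps)
    also have "\<dots> \<le> (\<integral>x. l * (?g x) + 1 / l * (?h e x) \<partial>lborel)"
    proof (rule integral_mono)
      show "integrable lborel (\<lambda>x. ?k e x)"
        using mi by (simp add: mellin_integrable_def)
      show "integrable lborel (\<lambda>x. l * (?g x) + 1 / l * (?h e x))"
        by (intro Bochner_Integration.integrable_add integrable_mult_right iN i1)
      fix x :: real
      consider "x \<le> 0" | "x > 1" | "0 < x" "x \<le> 1" by linarith
      then show "?k e x \<le>
          l * (?g x) + 1 / l * (?h e x)"
      proof cases
        case 3
        define a b where "a = \<bar>mertens_g1 x\<bar>" and "b = x powr (e - 1/2)"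
        have b2: "x powr (2 * e - 1) = b\<^sup>2"
          using 3 by (simp add: b_def power2_eq_square flip: powr_add)
        have a2: "a powr 2 = a\<^sup>2" by (simp add: a_def powr_numeral)
        have ab: "0 \<le> a" "0 \<le> b" by (auto simp: a_def b_def)
        have "0 \<le> (l * a - b)\<^sup>2" by simp
        then have "2 * (l * (a * b)) \<le> l * (l * a\<^sup>2) + b\<^sup>2" by (simp add: power2_eq_square algebra_simps)
        moreover have "0 \<le> l * (a * b)" using ab l by simp
        ultimately have "l * (a * b) \<le> l * (l * a\<^sup>2) + b\<^sup>2" by linarith
        then have "a * b \<le> l * a\<^sup>2 + 1 / l * b\<^sup>2" using l by (simp add: field_simps)
        then show ?thesis using 3 by (simp add: b2 a2 flip: a_def b_def)
      qed (use l in \<open>auto simp: mertens_g1_eq_0\<close>)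
    qed
    also have "\<dots> = l * N + 1 / l * (1 / (2 * e))"
      using iN i1 by (simp add: N_def)
    finally show ?thesis by (simp add: field_simps)
  qed
  have one: "zeta_reg (s + of_real e) * mellin mertens_g1 (s - 1 + of_real e) = 1" if "e > 0" for e
    using mertens_g1_mellin[of "-1/2" "s - 1 + of_real e"] mellin_integrable_mertens_g1_Lp[OF L2] that s12
    by (simp add: algebra_simps)
  define D where "D = deriv zeta_reg s"
  have "(zeta_reg has_field_derivative D) (at s)"
    unfolding D_def by (rule holomorphic_derivI[OF zeta_reg_holomorphic open_UNIV UNIV_I])
  then have "((\<lambda>h. zeta_reg (s + h) / h) \<longlongrightarrow> D) (at 0)" by (simp add: DERIV_def z)
  moreover have "filterlim complex_of_real (at 0) (at_right 0)"
  proof (rule filterlim_atI)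
    show "(complex_of_real \<longlongrightarrow> 0) (at_right 0)"
      using tendsto_of_real[OF tendsto_ident_at[of 0 "{0<..}"], where ?'a = complex] by simp
    show "\<forall>\<^sub>F x in at_right 0. complex_of_real x \<noteq> 0"
      using eventually_at_right_less[of 0] by eventually_elim auto
  qed
  ultimately have "((\<lambda>e. zeta_reg (s + of_real e) / of_real e) \<longlongrightarrow> D) (at_right 0)" by (rule filterlim_compose)
  then have lim: "((\<lambda>e. norm (zeta_reg (s + of_real e) / of_real e) * (e * (l * N) + 1 / (2 * l))) \<longlongrightarrow> norm D * (0 * (l * N) + 1 / (2 * l))) (at_right 0)" if "l > 0" for l
    using that by (intro tendsto_intros) auto
  \<comment> \<open>In the limit the term with N disappears and only |D| / (2 l) is left, for every
    l > 0.\<close>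
  have "1 \<le> norm D * (0 * (l * N) + 1 / (2 * l))" if l: "l > 0" for l
  proof (rule tendsto_lowerbound[OF lim[OF l]])
    show "\<forall>\<^sub>F e in at_right 0. 1 \<le> norm (zeta_reg (s + of_real e) / of_real e) * (e * (l * N) + 1 / (2 * l))"
      using eventually_at_right_less[of 0]
    proof eventually_elim
      case (elim e)
      have "1 = norm (zeta_reg (s + of_real e)) * norm (mellin mertens_g1 (s - 1 + of_real e))"
        using one[OF elim] by (metis norm_mult norm_one)
      also have "\<dots> \<le> norm (zeta_reg (s + of_real e)) * (l * N + 1 / (2 * l * e))"
        by (intro mult_left_mono F elim l) auto
      also have "\<dots> = norm (zeta_reg (s + of_real e) / of_real e) * (e * (l * N) + 1 / (2 * l))"
        using elim l by (simp add: norm_divide field_simps)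
      finally show ?case .
    qed
  qed simp
  \<comment> \<open>This weight makes |D| / (2 l) smaller than 1, also when D = 0.\<close>
  from this[of "norm D + 1"] have "1 \<le> norm D / (2 * (norm D + 1))" by (simp add: add_nonneg_pos)
  moreover have "norm D / (2 * (norm D + 1)) < 1"
  proof -
    have "d / (2 * (d + 1)) < 1" if "0 \<le> d" for d :: real
      using that by (simp add: divide_simps)
    from this[OF norm_ge_zero[of D]] show ?thesis .
  qed
  ultimately show False by linarith
qed

section \<open>The integrals behind the functional equation\<close>

text \<open>Euler's product for the sine at the imaginary argument i y: the factors become real, the
  imaginary part gives sinh, and the logarithm turns the product into a sum.\<close>

lemma sinh_prod_sums:
  fixes y :: real
  assumes "y > 0"
  shows "(\<lambda>k. ln (1 + y\<^sup>2 / (real (Suc k))\<^sup>2)) sums ln (sinh (pi * y) / (pi * y))"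
proof -
  let ?p = "\<lambda>n. \<Prod>k=1..n. 1 + y\<^sup>2 / (real k)\<^sup>2"
  let ?q = "\<lambda>n. \<Prod>k=1..n. 1 - (\<i> * complex_of_real y)^2 / of_nat k^2"
  have "(\<lambda>n. of_real pi * (\<i> * of_real y) * ?q n) \<longlonglongrightarrow> sin (of_real pi * (\<i> * of_real y))"
    by (rule sin_product_formula_complex)
  then have "(\<lambda>n. Im (of_real pi * (\<i> * of_real y) * ?q n)) \<longlonglongrightarrow> Im (sin (of_real pi * (\<i> * of_real y)))"
    by (rule tendsto_Im)
  also have "(\<lambda>n. Im (of_real pi * (\<i> * of_real y) * ?q n)) =
      (\<lambda>n. pi * y * ?p n)"
  proof
    fix n
    have "?q n = complex_of_real (?p n)"
      unfolding of_real_prod by (rule prod.cong) (auto simp: power_mult_distrib)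
    then show "Im (of_real pi * (\<i> * of_real y) * ?q n) = pi * y * ?p n"
      by (simp del: of_real_prod)
  qed
  also have "Im (sin (of_real pi * (\<i> * of_real y))) = sinh (pi * y)"
    by (simp add: Im_sin sinh_field_def exp_minus mult_ac)
  finally have "(\<lambda>n. pi * y * ?p n / (pi * y)) \<longlonglongrightarrow> sinh (pi * y) / (pi * y)"
    by (rule tendsto_divide[OF _ tendsto_const]) (use assms in auto)
  then have "(\<lambda>n. ?p n) \<longlonglongrightarrow> sinh (pi * y) / (pi * y)"
    using assms by simp
  then have "(\<lambda>n. ln (?p n)) \<longlonglongrightarrow> ln (sinh (pi * y) / (pi * y))"
    by (rule tendsto_ln) (use assms in auto)
  moreover have "ln (?p n) = (\<Sum>k<n. ln (1 + y\<^sup>2 / (real (Suc k))\<^sup>2))" for n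
  proof -
    have "ln (?p n) = (\<Sum>k=1..n. ln (1 + y\<^sup>2 / (real k)\<^sup>2))"
      by (rule ln_prod) (auto simp: add_nonneg_eq_0_iff)
    also have "\<dots> = (\<Sum>k<n. ln (1 + y\<^sup>2 / (real (Suc k))\<^sup>2))"
      by (rule sum.reindex_bij_witness[of _ Suc "\<lambda>k. k - 1"]) auto
    finally show ?thesis .
  qed
  ultimately show ?thesis unfolding sums_def by simp
qed

text \<open>Logarithmic derivative of the product for sinh, that is, the partial fraction expansion
  of coth.\<close>

lemma coth_sums:
  fixes y :: real
  assumes "y > 0"
  shows "(\<lambda>k. 2 * y / ((real (Suc k))\<^sup>2 + y\<^sup>2)) sums (pi * cosh (pi * y) / sinh (pi * y) - 1 / y)"
proof -
  \<comment> \<open>A convex neighbourhood of y on which the differentiated terms have the summable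
    majorant 4 y / (k + 1)^2.\<close>
  define S where "S = {0<..<2 * y}"
  let ?N = "\<lambda>k. (real (Suc k))\<^sup>2"
  have S: "y \<in> S" "open S" "convex S" using assms by (auto simp: S_def)
  have d: "((\<lambda>y. ln (1 + y\<^sup>2 / ?N k)) has_field_derivative 2 * x / (?N k + x\<^sup>2)) (at x within S)" if "x \<in> S" for k x
  proof -
    have p: "1 + x\<^sup>2 / ?N k > 0" by (intro add_pos_nonneg) auto
    have n: "real (Suc k) \<noteq> 0" by simp
    have "((\<lambda>y. ln (1 + y\<^sup>2 / ?N k)) has_field_derivative 1 / (1 + x\<^sup>2 / ?N k) * (2 * x / ?N k)) (at x within S)"
    proof (rule DERIV_chain2[where f = ln and g = "\<lambda>y. 1 + y\<^sup>2 / ?N k"])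
      show "(ln has_field_derivative 1 / (1 + x\<^sup>2 / ?N k)) (at (1 + x\<^sup>2 / ?N k))"
        by (rule DERIV_ln_divide[OF p])
      have "((\<lambda>y. y\<^sup>2 / ?N k) has_field_derivative 2 * x / ?N k) (at x within S)"
        by (rule DERIV_cdivide) (auto intro!: derivative_eq_intros)
      then show "((\<lambda>y. 1 + y\<^sup>2 / ?N k) has_field_derivative 2 * x / ?N k) (at x within S)"
        using DERIV_add[OF DERIV_const[of 1]] by fastforce
    qed
    also have "1 / (1 + x\<^sup>2 / ?N k) * (2 * x / ?N k) = 2 * x / (?N k + x\<^sup>2)"
      using p n by (simp add: divide_simps del: of_nat_Suc)
    finally show ?thesis .
  qed
  have "uniformly_convergent_on S (\<lambda>n x. \<Sum>i<n. 2 * x / (?N i + x\<^sup>2))"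
  proof (rule Weierstrass_m_test'_ev)
    show "\<forall>\<^sub>F n in sequentially. \<forall>x\<in>S. norm (2 * x / (?N n + x\<^sup>2)) \<le> 4 * y * (1 / ?N n)"
    proof (intro always_eventually allI ballI)
      fix n x assume "x \<in> S"
      then have "2 * x / (?N n + x\<^sup>2) \<le> 4 * y / ?N n"
        by (intro frac_le) (auto simp: S_def)
      then show "norm (2 * x / (?N n + x\<^sup>2)) \<le> 4 * y * (1 / ?N n)"
        using \<open>x \<in> S\<close> by (simp add: S_def)
    qed
    show "summable (\<lambda>n. 4 * y * (1 / ?N n))"
      using inverse_squares_sums by (intro summable_mult) (simp add: sums_iff add_ac)
  qed
  from has_field_derivative_series'[OF S(3) d this S(1) sums_summable[OF sinh_prod_sums[OF assms]]] S
  have D: "((\<lambda>x. \<Sum>k. ln (1 + x\<^sup>2 / ?N k)) has_field_derivative (\<Sum>k. 2 * y / (?N k + y\<^sup>2))) (at y)"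
    by (simp add: interior_open)
  have "((\<lambda>x. ln (sinh (pi * x) / (pi * x))) has_field_derivative (\<Sum>k. 2 * y / (?N k + y\<^sup>2))) (at y)"
    by (rule has_field_derivative_transform_within_open[OF D S(2,1)])
       (use sums_unique[OF sinh_prod_sums] in \<open>auto simp: S_def\<close>)
  moreover have "((\<lambda>x. ln (sinh (pi * x) / (pi * x))) has_field_derivative (pi * cosh (pi * y) / sinh (pi * y) - 1 / y)) (at y)"
  proof -
    have p: "sinh (pi * y) > 0" "pi * y > 0" using assms by auto
    show ?thesis
      using p assms by (auto intro!: derivative_eq_intros) (simp add: field_simps)
  qed
  ultimately have "(\<Sum>k. 2 * y / (?N k + y\<^sup>2)) = pi * cosh (pi * y) / sinh (pi * y) - 1 / y"
    by (rule DERIV_unique)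
  moreover have "summable (\<lambda>k. 2 * y / (?N k + y\<^sup>2))"
  proof (rule summable_comparison_test')
    show "summable (\<lambda>n. 2 * y * (1 / ?N n))"
      using inverse_squares_sums by (intro summable_mult) (simp add: sums_iff add_ac)
    show "norm (2 * y / (?N n + y\<^sup>2)) \<le> 2 * y * (1 / ?N n)" for n
      using assms frac_le[of "2 * y" "2 * y" "?N n" "?N n + y\<^sup>2"] by simp
  qed
  ultimately show ?thesis by (simp add: sums_iff)
qed

text \<open>1/(exp x - 1) without the first two terms 1/x - 1/2 of its expansion at 0, equivalently
  coth(x/2)/2 - 1/x. It is O(x) at 0 and bounded at infinity, so its integral against x^(s - 1)
  converges for -1 < s < 0.\<close>

definition bose :: "real \<Rightarrow> real" where
  "bose x = 1 / (exp x - 1) - 1 / x + 1 / 2"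

lemma bose_sums:
  assumes "x > 0"
  shows "(\<lambda>k. 2 * x / (x\<^sup>2 + (2 * pi * real (Suc k))\<^sup>2)) sums bose x"
proof -
  define y where "y = x / (2 * pi)"
  have y: "y > 0" "x = 2 * pi * y" using assms by (auto simp: y_def)
  have "(\<lambda>k. 2 * y / ((real (Suc k))\<^sup>2 + y\<^sup>2) / (2 * pi)) sums ((pi * cosh (pi * y) / sinh (pi * y) - 1 / y) / (2 * pi))"
    by (intro sums_divide coth_sums y)
  also have "(\<lambda>k. 2 * y / ((real (Suc k))\<^sup>2 + y\<^sup>2) / (2 * pi)) = (\<lambda>k. 2 * x / (x\<^sup>2 + (2 * pi * real (Suc k))\<^sup>2))"
  proof
    fix k
    have "x\<^sup>2 + (2 * pi * real (Suc k))\<^sup>2 = (2 * pi)\<^sup>2 * ((real (Suc k))\<^sup>2 + y\<^sup>2)"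
      unfolding y(2) by (simp add: power_mult_distrib algebra_simps del: of_nat_Suc)
    then show "2 * y / ((real (Suc k))\<^sup>2 + y\<^sup>2) / (2 * pi) = 2 * x / (x\<^sup>2 + (2 * pi * real (Suc k))\<^sup>2)"
      unfolding y(2) by (simp add: power2_eq_square del: of_nat_Suc)
  qed
  also have "(pi * cosh (pi * y) / sinh (pi * y) - 1 / y) / (2 * pi) = bose x"
  proof -
    define E where "E = exp (pi * y)"
    have E: "E > 1" using y by (simp add: E_def)
    then have E2: "E * E > 1" by (rule less_1_mult[OF _ E])
    have ex: "exp x = E * E" by (simp add: E_def y(2) flip: exp_add)
    have "cosh (pi * y) = (E + 1 / E) / 2" "sinh (pi * y) = (E - 1 / E) / 2"
      by (simp_all add: cosh_field_def sinh_field_def E_def exp_minus inverse_eq_divide)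
    moreover have "u / 2 / (v / 2) = u / v" for u v :: real by simp
    ultimately have "cosh (pi * y) / sinh (pi * y) = (E + 1 / E) / (E - 1 / E)" by (simp only:)
    also have "E + 1 / E = (E * E + 1) / E" using E by (simp add: field_simps)
    also have "E - 1 / E = (E * E - 1) / E" using E by (simp add: field_simps)
    also have "(E * E + 1) / E / ((E * E - 1) / E) = (E * E + 1) / (E * E - 1)" using E by simp
    finally have c: "cosh (pi * y) / sinh (pi * y) = (E * E + 1) / (E * E - 1)" .
    have "(pi * cosh (pi * y) / sinh (pi * y) - 1 / y) / (2 * pi) = (cosh (pi * y) / sinh (pi * y)) / 2 - 1 / x"
      using y by (simp add: field_simps)
    also have "\<dots> = (E * E + 1) / (E * E - 1) / 2 - 1 / x" by (simp only: c)
    also have "(E * E + 1) / (E * E - 1) / 2 = 1 / (E * E - 1) + 1 / 2"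
      using E2 by (simp add: field_simps)
    finally show ?thesis by (simp add: bose_def ex)
  qed
  finally show ?thesis .
qed

section \<open>Evaluation of nonnegative integrals by Gamma values\<close>

lemma nn_integral_scale:
  fixes f :: "real \<Rightarrow> ennreal"
  assumes "f \<in> borel_measurable borel" "c > 0"
  shows "(\<integral>\<^sup>+x. f x \<partial>lborel) = ennreal c * (\<integral>\<^sup>+x. f (c * x) \<partial>lborel)"
  using nn_integral_real_affine[of f c 0] assms by simp

lemma nn_integral_Gamma_scaled:
  assumes "s > (0::real)" "k > 0"
  shows "(\<integral>\<^sup>+x. ennreal (indicator {0<..} x * (x powr (s - 1) * exp (- k * x))) \<partial>lborel) = ennreal (Gamma s * k powr (-s))"
proof -
  let ?w = "\<lambda>x::real. ennreal (indicator {0<..} x * (x powr (s - 1) * exp (- k * x)))"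
  have "ennreal (Gamma s) = (\<integral>\<^sup>+x. ennreal (indicator {0..} x * x powr (s - 1) / exp x) \<partial>lborel)"
    by (rule Gamma_conv_nn_integral_real[OF assms(1)])
  also have "\<dots> = ennreal k * (\<integral>\<^sup>+x. ennreal (indicator {0..} (k * x) * (k * x) powr (s - 1) / exp (k * x)) \<partial>lborel)"
    by (rule nn_integral_scale) (use assms in auto)
  also have "(\<integral>\<^sup>+x. ennreal (indicator {0..} (k * x) * (k * x) powr (s - 1) / exp (k * x)) \<partial>lborel) = (\<integral>\<^sup>+x. ennreal (k powr (s - 1)) * ?w x \<partial>lborel)"
  proof (rule nn_integral_cong)
    fix x :: real
    show "ennreal (indicator {0..} (k * x) * (k * x) powr (s - 1) / exp (k * x)) = ennreal (k powr (s - 1)) * ?w x"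
      using assms by (cases "x > 0") (auto simp: indicator_def powr_mult exp_minus divide_inverse zero_le_mult_iff mult_ac simp flip: ennreal_mult')
  qed
  also have "\<dots> = ennreal (k powr (s - 1)) * (\<integral>\<^sup>+x. ?w x \<partial>lborel)"
    by (rule nn_integral_cmult) simp
  finally have "ennreal (Gamma s) = ennreal k * (ennreal (k powr (s - 1)) * (\<integral>\<^sup>+x. ?w x \<partial>lborel))" .
  then have "ennreal (k powr (-s)) * ennreal (Gamma s) = ennreal (k powr (-s) * (k * k powr (s - 1))) * (\<integral>\<^sup>+x. ?w x \<partial>lborel)"
    using assms by (simp add: ennreal_mult' mult.assoc)
  also have "k powr (-s) * (k * k powr (s - 1)) = k powr (-s) * (k powr 1 * k powr (s - 1))" using assms by simp
  also have "\<dots> = 1" unfolding powr_add[symmetric] using assms by simp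
  finally show ?thesis using assms by (simp add: mult.commute flip: ennreal_mult')
qed

lemma nn_integral_Ioi_SUP:
  fixes h :: "real \<Rightarrow> ennreal" and c :: "nat \<Rightarrow> real"
  assumes [measurable]: "h \<in> borel_measurable borel" and c: "incseq c" "\<And>x. \<exists>n. x \<le> c n"
  shows "(\<integral>\<^sup>+x. h x * indicator {0<..} x \<partial>lborel) = (SUP n. \<integral>\<^sup>+x. h x * indicator {0..c n} x \<partial>lborel)"
proof -
  have "(\<integral>\<^sup>+x. h x * indicator {0<..} x \<partial>lborel) = (\<integral>\<^sup>+x. (SUP n. h x * indicator {0..c n} x) \<partial>lborel)"
  proof (rule nn_integral_cong_AE)
    show "AE x in lborel. h x * indicator {0<..} x = (SUP n. h x * indicator {0..c n} x)"
      using AE_lborel_singleton[of 0]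
    proof eventually_elim
      case (elim x)
      show ?case
      proof (cases "x > 0")
        case True
        obtain N where "x \<le> c N" using c(2) by blast
        then have "h x * indicator {0..c N} x = h x" using True by simp
        then show ?thesis using True
          by (intro SUP_eqI[symmetric]) (auto simp: indicator_def, metis)
      qed (use elim in \<open>auto simp: indicator_def\<close>)
    qed
  qed
  also have "\<dots> = (SUP n. \<integral>\<^sup>+x. h x * indicator {0..c n} x \<partial>lborel)"
  proof (rule nn_integral_monotone_convergence_SUP)
    show "incseq (\<lambda>n x. h x * indicator {0..c n} x)"
      using c(1) by (auto simp: incseq_def le_fun_def indicator_def intro: order_trans)
  qed measurable
  finally show ?thesis .
qed

text \<open>Substitution x = y^2 on the compact intervals [0, n], followed by monotone convergence
  in n.\<close>

lemma nn_integral_square_substitution: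
  fixes f :: "real \<Rightarrow> real"
  assumes [measurable]: "f \<in> borel_measurable borel"
  shows "(\<integral>\<^sup>+x. ennreal (f x) * indicator {0<..} x \<partial>lborel) = (\<integral>\<^sup>+y. ennreal (f (y\<^sup>2) * (2 * y)) * indicator {0<..} y \<partial>lborel)"
proof -
  have ex: "\<exists>n. x \<le> (real n)\<^sup>2" "\<exists>n. x \<le> real n" for x
  proof -
    obtain n where n: "x \<le> real n" using real_arch_simple by blast
    then show "\<exists>n. x \<le> real n" by blast
    have "real n \<le> (real n)\<^sup>2" by (cases n) (auto simp: power2_eq_square)
    then show "\<exists>n. x \<le> (real n)\<^sup>2" using n by (intro exI[of _ n]) linarith
  qed
  have sub: "(\<integral>\<^sup>+x. ennreal (f x) * indicator {0..(real n)\<^sup>2} x \<partial>lborel) =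
      (\<integral>\<^sup>+y. ennreal (f (y\<^sup>2) * (2 * y)) * indicator {0..real n} y \<partial>lborel)" for n
  proof -
    have "(\<integral>\<^sup>+x. ennreal (f x * indicator {0\<^sup>2..(real n)\<^sup>2} x) \<partial>lborel) =
        (\<integral>\<^sup>+y. ennreal (f (y\<^sup>2) * (2 * y) * indicator {0..real n} y) \<partial>lborel)"
      by (rule nn_integral_substitution)
         (auto intro!: derivative_eq_intros continuous_intros simp: set_borel_measurable_def)
    moreover have "ennreal (f x * indicator {0\<^sup>2..(real n)\<^sup>2} x) = ennreal (f x) * indicator {0..(real n)\<^sup>2} x"
      "ennreal (f (x\<^sup>2) * (2 * x) * indicator {0..real n} x) = ennreal (f (x\<^sup>2) * (2 * x)) * indicator {0..real n} x" for x
      by (auto simp: indicator_def)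
    ultimately show ?thesis by (simp only:)
  qed
  have "(\<integral>\<^sup>+x. ennreal (f x) * indicator {0<..} x \<partial>lborel) = (SUP n. \<integral>\<^sup>+x. ennreal (f x) * indicator {0..(real n)\<^sup>2} x \<partial>lborel)"
    by (rule nn_integral_Ioi_SUP) (use ex in \<open>auto simp: incseq_def intro!: power_mono\<close>)
  also have "\<dots> = (SUP n. \<integral>\<^sup>+y. ennreal (f (y\<^sup>2) * (2 * y)) * indicator {0..real n} y \<partial>lborel)"
    by (simp only: sub)
  also have "\<dots> = (\<integral>\<^sup>+y. ennreal (f (y\<^sup>2) * (2 * y)) * indicator {0<..} y \<partial>lborel)"
    by (rule nn_integral_Ioi_SUP[symmetric]) (use ex in \<open>auto simp: incseq_def\<close>)
  finally show ?thesis .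
qed

text \<open>Writing 1/(1 + y^2) as the integral of exp(-(1 + y^2) u) over u > 0 and exchanging the
  order, the integration in y yields one Gamma value and the remaining one in u the other.\<close>

lemma nn_integral_powr_over_1_plus_square:
  assumes "\<bar>s\<bar> < (1::real)"
  shows "(\<integral>\<^sup>+y. ennreal (indicator {0<..} y * (y powr s / (1 + y\<^sup>2))) \<partial>lborel) = ennreal (Gamma ((1 + s) / 2) * Gamma ((1 - s) / 2) / 2)"
proof -
  let ?r = "\<lambda>y. ennreal (indicator {0<..} y * (y powr s / (1 + y\<^sup>2)))"
  let ?K = "\<lambda>y u. ennreal (indicator {0<..} y * indicator {0<..} u * (y powr s * exp (- (1 + y\<^sup>2) * u)))"
  \<comment> \<open>After x = y^2 the differential y^s dy becomes x^(a - 1) dx / 2.\<close>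
  define a where "a = (1 + s) / 2"
  have a: "0 < a" "0 < 1 - a" "2 * a - 1 = s" "(1 - s) / 2 = 1 - a" using assms by (auto simp: a_def field_simps abs_less_iff)
  have inner1: "(\<integral>\<^sup>+u. ?K y u \<partial>lborel) =
      ?r y" for y :: real
  proof -
    have "(\<integral>\<^sup>+u. ?K y u \<partial>lborel)
        = (\<integral>\<^sup>+u. ennreal (indicator {0<..} y * y powr s) * ennreal (indicator {0<..} u * (u powr (1 - 1) * exp (- (1 + y\<^sup>2) * u))) \<partial>lborel)"
      by (rule nn_integral_cong) (auto simp: indicator_def simp flip: ennreal_mult')
    also have "\<dots> = ennreal (indicator {0<..} y * y powr s) * ennreal (Gamma 1 * (1 + y\<^sup>2) powr (-1))"
      by (subst nn_integral_cmult, simp, subst nn_integral_Gamma_scaled) (auto intro: add_pos_nonneg)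
    also have "\<dots> = ?r y"
      by (simp add: powr_minus divide_inverse add_nonneg_nonneg mult.assoc flip: ennreal_mult')
    finally show ?thesis .
  qed
  have inner2: "(\<integral>\<^sup>+y. ?K y u \<partial>lborel) =
      ennreal (Gamma a / 2) * ennreal (indicator {0<..} u * (u powr ((1 - a) - 1) * exp (- 1 * u)))" for u :: real
  proof (cases "u > 0")
    case True
    have "ennreal (Gamma a * u powr (-a)) = (\<integral>\<^sup>+x. ennreal (x powr (a - 1) * exp (- u * x)) * indicator {0<..} x \<partial>lborel)"
      unfolding nn_integral_Gamma_scaled[OF a(1) True, symmetric] by (rule nn_integral_cong) (auto simp: indicator_def)
    also have "\<dots> = (\<integral>\<^sup>+y. ennreal ((y\<^sup>2) powr (a - 1) * exp (- u * y\<^sup>2) * (2 * y)) * indicator {0<..} y \<partial>lborel)"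
      by (rule nn_integral_square_substitution) auto
    also have "\<dots> = (\<integral>\<^sup>+y. ennreal (2 * exp u) * ?K y u \<partial>lborel)"
    proof (rule nn_integral_cong)
      fix y :: real
      show "ennreal ((y\<^sup>2) powr (a - 1) * exp (- u * y\<^sup>2) * (2 * y)) * indicator {0<..} y =
          ennreal (2 * exp u) * ?K y u"
      proof (cases "y > 0")
        case y: True
        have "(y\<^sup>2) powr (a - 1) * y = y powr (2 * (a - 1)) * y powr 1"
          using y by (simp add: powr_powr flip: powr_numeral)
        also have "\<dots> = y powr s" unfolding powr_add[symmetric] using a(3) by (simp add: algebra_simps)
        finally have 1: "(y\<^sup>2) powr (a - 1) * y = y powr s" .
        have 2: "exp (- u * y\<^sup>2) = exp u * exp (- (1 + y\<^sup>2) * u)"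
          by (simp add: algebra_simps flip: exp_add)
        have "(y\<^sup>2) powr (a - 1) * exp (- u * y\<^sup>2) * (2 * y) = 2 * exp u * (y powr s * exp (- (1 + y\<^sup>2) * u))"
          unfolding 2 1[symmetric] by (simp add: mult_ac)
        then show ?thesis using y True by (simp flip: ennreal_mult')
      qed auto
    qed
    also have "\<dots> = ennreal (2 * exp u) * (\<integral>\<^sup>+y. ?K y u \<partial>lborel)"
      (is "_ = _ * ?I") by (rule nn_integral_cmult) auto
    finally have e: "ennreal (Gamma a * u powr (-a)) = ennreal (2 * exp u) * ?I" .
    have "?I = ennreal (exp (-u) / 2 * (2 * exp u)) * ?I" by (simp add: exp_minus)
    also have "\<dots> = ennreal (exp (-u) / 2) * (ennreal (2 * exp u) * ?I)"
      by (subst ennreal_mult) (auto simp: mult.assoc)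
    also have "\<dots> = ennreal (exp (-u) / 2) * ennreal (Gamma a * u powr (-a))" by (simp only: e)
    also have "\<dots> = ennreal (exp (-u) / 2 * (Gamma a * u powr (-a)))"
      by (rule ennreal_mult[symmetric]) (use a(1) in \<open>auto intro: Gamma_real_nonneg\<close>)
    also have "exp (-u) / 2 * (Gamma a * u powr (-a)) = Gamma a / 2 * (indicator {0<..} u * (u powr ((1 - a) - 1) * exp (- 1 * u)))"
      using True by simp
    also have "ennreal \<dots> = ennreal (Gamma a / 2) * ennreal (indicator {0<..} u * (u powr ((1 - a) - 1) * exp (- 1 * u)))"
      by (rule ennreal_mult) (use a(1) in \<open>auto intro: Gamma_real_nonneg\<close>)
    finally show ?thesis .
  qed auto
  have "(\<integral>\<^sup>+y. ?r y \<partial>lborel) =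
     (\<integral>\<^sup>+y. (\<integral>\<^sup>+u. ?K y u \<partial>lborel) \<partial>lborel)"
    by (simp only: inner1)
  also have "\<dots> = (\<integral>\<^sup>+u. (\<integral>\<^sup>+y. ?K y u \<partial>lborel) \<partial>lborel)"
    by (rule lborel_pair.Fubini') measurable
  also have "\<dots> = ennreal (Gamma a / 2) * ennreal (Gamma (1 - a) * 1 powr (- (1 - a)))"
    unfolding inner2 by (subst nn_integral_cmult, simp, subst nn_integral_Gamma_scaled) (use a in auto)
  also have "\<dots> = ennreal (Gamma ((1 + s) / 2) * Gamma ((1 - s) / 2) / 2)"
    using a by (simp add: a(4) a_def[symmetric] flip: ennreal_mult')
  finally show ?thesis .
qed

lemma bose_nonneg: "x > 0 \<Longrightarrow> bose x \<ge> 0"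
  using bose_sums[of x] sums_le[of "\<lambda>_. 0" "\<lambda>k. 2 * x / (x\<^sup>2 + (2 * pi * real (Suc k))\<^sup>2)" 0] sums_zero
  by (auto intro!: sums_le[OF _ sums_zero] divide_nonneg_nonneg)

text \<open>Dropping x^2 from the denominators leaves 2 x times the sum of (2 pi k)^(-2) over k
  \<ge> 1, and that sum is 1/24. The linear bound is what makes the integral near 0 converge beyond
  the pole at s = 0.\<close>

lemma bose_le:
  assumes "x > 0" shows "bose x \<le> x"
proof -
  have "bose x \<le> 2 * x * (\<Sum>k. 1 / (2 * pi)\<^sup>2 * (1 / (real (Suc k))\<^sup>2))"
  proof (rule sums_le[OF _ bose_sums[OF assms]])
    have s: "summable (\<lambda>n. 1 / (real (Suc n))\<^sup>2)"
      using inverse_squares_sums by (simp add: sums_iff add_ac)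
    show "(\<lambda>k. 2 * x * (1 / (2 * pi)\<^sup>2 * (1 / (real (Suc k))\<^sup>2))) sums (2 * x * (\<Sum>k. 1 / (2 * pi)\<^sup>2 * (1 / (real (Suc k))\<^sup>2)))"
      by (intro sums_mult summable_sums summable_mult s)
    show "2 * x / (x\<^sup>2 + (2 * pi * real (Suc k))\<^sup>2) \<le> 2 * x * (1 / (2 * pi)\<^sup>2 * (1 / (real (Suc k))\<^sup>2))" for k
    proof -
      have "2 * x / (x\<^sup>2 + (2 * pi * real (Suc k))\<^sup>2) \<le> 2 * x / (2 * pi * real (Suc k))\<^sup>2"
        using assms by (intro frac_le) auto
      then show ?thesis by (simp add: power_mult_distrib del: of_nat_Suc)
    qed
  qed
  also have "(\<Sum>k. 1 / (2 * pi)\<^sup>2 * (1 / (real (Suc k))\<^sup>2)) = 1 / (2 * pi)\<^sup>2 * (pi\<^sup>2 / 6)"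
    using sums_mult[OF inverse_squares_sums, of "1 / (2 * pi)\<^sup>2"] by (simp add: sums_iff add_ac)
  also have "\<dots> = 1 / 24" by (simp add: power2_eq_square)
  finally show ?thesis using assms by simp
qed

lemma bose_measurable [measurable]: "bose \<in> borel_measurable borel"
  unfolding bose_def[abs_def] by measurable

lemma zeta_real_sums:
  assumes "s > (1::real)"
  shows "\<exists>z>0. zeta (of_real s) = of_real z \<and> (\<lambda>n. real (Suc n) powr (-s)) sums z"
proof -
  have sm: "summable (\<lambda>n. real (Suc n) powr (-s))" by (rule summable_real_Suc_powr[OF assms])
  let ?z = "\<Sum>n. real (Suc n) powr (-s)"
  have "(\<lambda>n. complex_of_real (real (Suc n) powr (-s))) sums of_real ?z"
    by (intro sums_of_real summable_sums sm)
  moreover have "complex_of_real (real (Suc n) powr (-s)) = of_nat (Suc n) powr (- of_real s)" for n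
    using powr_of_real[of "real (Suc n)" "-s"] by simp
  moreover have "(\<lambda>n. of_nat (Suc n) powr (- complex_of_real s)) sums zeta (of_real s)"
    using zeta_series_sums[of "of_real s"] zeta_eq_series[of "of_real s"] assms by simp
  ultimately have "zeta (of_real s) = of_real ?z" using sums_unique2 by fastforce
  moreover have "?z > 0" by (rule suminf_pos[OF sm]) simp
  ultimately show ?thesis using sm by (intro exI[of _ ?z]) (auto simp: summable_sums)
qed

lemma nn_integral_suminf_ennreal:
  fixes f :: "nat \<Rightarrow> real \<Rightarrow> real"
  assumes "\<And>n. f n \<in> borel_measurable borel" "\<And>n x. f n x \<ge> 0" "\<And>x. (\<lambda>n. f n x) sums F x"
    and "\<And>n. (\<integral>\<^sup>+x. ennreal (f n x) \<partial>lborel) = ennreal (c n)" "\<And>n. c n \<ge> 0" "c sums S"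
  shows "(\<integral>\<^sup>+x. ennreal (F x) \<partial>lborel) = ennreal S"
proof -
  have "(\<integral>\<^sup>+x. ennreal (F x) \<partial>lborel) = (\<integral>\<^sup>+x. (\<Sum>n. ennreal (f n x)) \<partial>lborel)"
    by (simp only: suminf_ennreal2[OF assms(2) sums_summable[OF assms(3)]] sums_unique[OF assms(3), symmetric])
  also have "\<dots> = (\<Sum>n. \<integral>\<^sup>+x. ennreal (f n x) \<partial>lborel)"
    by (rule nn_integral_suminf) (use assms in auto)
  also have "\<dots> = ennreal S"
    by (simp only: assms(4) suminf_ennreal2[OF assms(5) sums_summable[OF assms(6)]] sums_unique[OF assms(6), symmetric])
  finally show ?thesis .
qed

text \<open>Expanding 1/(exp x - 1) as a geometric series in exp(-x) gives a Gamma integral scaled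
  by n for each n \<ge> 1.\<close>

lemma nn_integral_zeta:
  assumes "s > (1::real)"
  shows "(\<integral>\<^sup>+x. ennreal (indicator {0<..} x * (x powr (s - 1) / (exp x - 1))) \<partial>lborel) = ennreal (Gamma s * Re (zeta (of_real s)))"
proof (rule nn_integral_suminf_ennreal)
  obtain z where z: "zeta (of_real s) = of_real z" "(\<lambda>n. real (Suc n) powr (-s)) sums z"
    using zeta_real_sums[OF assms] by blast
  show "(\<lambda>n. Gamma s * real (Suc n) powr (-s)) sums (Gamma s * Re (zeta (of_real s)))"
    using sums_mult[OF z(2)] z(1) by simp
  show "(\<integral>\<^sup>+x. ennreal (indicator {0<..} x * (x powr (s - 1) * exp (- real (Suc n) * x))) \<partial>lborel) = ennreal (Gamma s * real (Suc n) powr (-s))" for n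
    by (rule nn_integral_Gamma_scaled) (use assms in auto)
  show "(\<lambda>n. indicator {0<..} x * (x powr (s - 1) * exp (- real (Suc n) * x))) sums (indicator {0<..} x * (x powr (s - 1) / (exp x - 1)))" for x
  proof (cases "x > 0")
    case True
    have "(\<lambda>n. exp (-x) ^ n) sums (1 / (1 - exp (-x)))" by (rule geometric_sums) (use True in simp)
    then have "(\<lambda>n. exp (-x) * exp (-x) ^ n) sums (exp (-x) * (1 / (1 - exp (-x))))" by (rule sums_mult)
    also have "(\<lambda>n. exp (-x) * exp (-x) ^ n) = (\<lambda>n. exp (- real (Suc n) * x))"
    proof
      fix n
      show "exp (-x) * exp (-x) ^ n = exp (- real (Suc n) * x)"
        using exp_of_nat_mult[of "Suc n" "-x"] by (simp only: minus_mult_commute power_Suc)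
    qed
    also have "exp (-x) * (1 / (1 - exp (-x))) = 1 / (exp x - 1)"
      using True by (simp add: exp_minus field_simps)
    finally have "(\<lambda>n. x powr (s - 1) * exp (- real (Suc n) * x)) sums (x powr (s - 1) * (1 / (exp x - 1)))"
      by (rule sums_mult)
    then show ?thesis using True by simp
  qed simp
qed (use assms Gamma_real_nonneg[of s] in auto)

text \<open>Integrating the partial fractions term by term, the scaling x = 2 pi k y extracts (2 pi
  k)^(s - 1) from the k-th term. The resulting sum is zeta(1 - s): this is where s and 1 - s are
  exchanged.\<close>

lemma nn_integral_bose:
  assumes "-1 < s" "s < (0::real)"
  shows "(\<integral>\<^sup>+x. ennreal (indicator {0<..} x * (bose x * x powr (s - 1))) \<partial>lborel) =
     ennreal ((2 * pi) powr (s - 1) * Gamma ((1 + s) / 2) * Gamma ((1 - s) / 2) * Re (zeta (of_real (1 - s))))"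
proof (rule nn_integral_suminf_ennreal)
  define G where "G = Gamma ((1 + s) / 2) * Gamma ((1 - s) / 2) / 2"
  have G: "G \<ge> 0" unfolding G_def using assms by (intro divide_nonneg_nonneg mult_nonneg_nonneg Gamma_real_nonneg) auto
  obtain z where z: "zeta (of_real (1 - s)) = of_real z" "(\<lambda>n. real (Suc n) powr (-(1 - s))) sums z"
    using zeta_real_sums[of "1 - s"] assms by auto
  define a where "a = (\<lambda>n. 2 * pi * real (Suc n))"
  have a: "a n > 0" for n by (simp add: a_def)
  let ?k = "\<lambda>n x. 2 * x / (x\<^sup>2 + (a n)\<^sup>2) * x powr (s - 1)"
  show "(\<lambda>n. 2 * a n powr (s - 1) * G) sums ((2 * pi) powr (s - 1) * Gamma ((1 + s) / 2) * Gamma ((1 - s) / 2) * Re (zeta (of_real (1 - s))))"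
    using sums_mult[OF z(2), of "2 * (2 * pi) powr (s - 1) * G"] unfolding z(1) a_def G_def
    by (simp add: powr_mult mult_ac del: of_nat_Suc)
  show "(\<lambda>n. indicator {0<..} x * ?k n x) sums (indicator {0<..} x * (bose x * x powr (s - 1)))" for x
  proof (cases "x > 0")
    case True
    from sums_mult2[OF bose_sums[OF True], of "x powr (s - 1)"] show ?thesis
      using True unfolding a_def by simp
  qed simp
  show "0 \<le> 2 * a n powr (s - 1) * G" for n using G by simp
  show "(\<integral>\<^sup>+x. ennreal (indicator {0<..} x * ?k n x) \<partial>lborel) = ennreal (2 * a n powr (s - 1) * G)" for n
  proof -
    have "(\<integral>\<^sup>+x. ennreal (indicator {0<..} x * ?k n x) \<partial>lborel)
       = ennreal (a n) * (\<integral>\<^sup>+y. ennreal (indicator {0<..} (a n * y) * ?k n (a n * y)) \<partial>lborel)"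
      by (rule nn_integral_scale) (use a in auto)
    also have "(\<integral>\<^sup>+y. ennreal (indicator {0<..} (a n * y) * ?k n (a n * y)) \<partial>lborel)
       = (\<integral>\<^sup>+y. ennreal (2 * a n powr (s - 2)) * ennreal (indicator {0<..} y * (y powr s / (1 + y\<^sup>2))) \<partial>lborel)"
    proof (rule nn_integral_cong)
      fix y :: real
      show "ennreal (indicator {0<..} (a n * y) * ?k n (a n * y)) =
         ennreal (2 * a n powr (s - 2)) * ennreal (indicator {0<..} y * (y powr s / (1 + y\<^sup>2)))"
      proof (cases "y > 0")
        case True
        have p: "0 < 1 + y\<^sup>2" by (intro add_pos_nonneg) auto
        have 1: "(a n * y) * (a n * y) powr (s - 1) = a n powr s * y powr s"
          using True a[of n] powr_mult_base[of "a n * y" "s - 1"] by (simp add: powr_mult)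
        have 2: "a n powr (s - 2) = a n powr s / (a n)\<^sup>2"
          using a[of n] by (simp add: powr_diff powr_numeral)
        have 3: "(a n * y)\<^sup>2 + (a n)\<^sup>2 = (a n)\<^sup>2 * (1 + y\<^sup>2)" by (simp add: power_mult_distrib algebra_simps)
        have "2 * (a n * y) / ((a n * y)\<^sup>2 + (a n)\<^sup>2) * (a n * y) powr (s - 1) = 2 * ((a n * y) * (a n * y) powr (s - 1)) / ((a n)\<^sup>2 * (1 + y\<^sup>2))"
          unfolding 3 by simp
        also have "\<dots> = 2 * a n powr (s - 2) * (y powr s / (1 + y\<^sup>2))" unfolding 1 2 by simp
        finally show ?thesis using True a[of n] p by (simp flip: ennreal_mult')
      qed (use a[of n] in \<open>auto simp: zero_less_mult_iff indicator_def\<close>)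
    qed
    also have "\<dots> = ennreal (2 * a n powr (s - 2)) * ennreal G"
      unfolding G_def by (subst nn_integral_cmult, simp, subst nn_integral_powr_over_1_plus_square) (use assms in auto)
    also have "ennreal (a n) * \<dots> = ennreal (a n * (2 * a n powr (s - 2) * G))"
      using G a[of n] by (simp add: ennreal_mult)
    also have "a n * (2 * a n powr (s - 2) * G) = 2 * a n powr (s - 1) * G"
      using powr_mult_base[of "a n" "s - 2"] a[of n] by (simp add: mult_ac)
    finally show ?thesis .
  qed
qed (auto intro!: divide_nonneg_nonneg simp: indicator_def)

section \<open>Rules for Mellin integrals\<close>

lemma mellin_integrable_nn:
  assumes [measurable]: "\<phi> \<in> borel_measurable borel"
    and "(\<integral>\<^sup>+x. ennreal (indicator {0<..} x * (\<bar>\<phi> x\<bar> * x powr \<sigma>)) \<partial>lborel) < \<infinity>"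
  shows "mellin_integrable \<phi> \<sigma>"
  unfolding mellin_integrable_def integrable_iff_bounded
  using assms(2) by (simp add: abs_mult mult.assoc)

lemma mellin_integrable_le:
  assumes "mellin_integrable \<phi> \<sigma>" "\<psi> \<in> borel_measurable borel"
    "\<And>x. x > 0 \<Longrightarrow> \<bar>\<psi> x\<bar> * x powr \<tau> \<le> C * (\<bar>\<phi> x\<bar> * x powr \<sigma>)" and C: "C \<ge> 0"
  shows "mellin_integrable \<psi> \<tau>"
proof -
  have [measurable]: "\<psi> \<in> borel_measurable borel" by fact
  have "integrable lborel (\<lambda>x. C * (indicator {0<..} x * \<bar>\<phi> x\<bar> * x powr \<sigma>))"
    using assms(1) by (simp add: mellin_integrable_def)
  then have "integrable lborel (\<lambda>x. indicator {0<..} x * \<bar>\<psi> x\<bar> * x powr \<tau>)"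
  proof (rule Bochner_Integration.integrable_bound)
    show "AE x in lborel. norm (indicator {0<..} x * \<bar>\<psi> x\<bar> * x powr \<tau>) \<le> norm (C * (indicator {0<..} x * \<bar>\<phi> x\<bar> * x powr \<sigma>))"
    proof (rule AE_I2)
      fix x :: real
      show "norm (indicator {0<..} x * \<bar>\<psi> x\<bar> * x powr \<tau>) \<le> norm (C * (indicator {0<..} x * \<bar>\<phi> x\<bar> * x powr \<sigma>))"
        using assms(3)[of x] C by (cases "x > 0") (auto simp: abs_mult)
    qed
  qed measurable
  then show ?thesis using assms(2) by (simp add: mellin_integrable_def)
qed

lemma mellin_add:
  assumes "mellin_integrable \<phi> \<sigma>" "mellin_integrable \<psi> \<sigma>"
  shows "mellin (\<lambda>x. \<phi> x + \<psi> x) (of_real \<sigma>) = mellin \<phi> (of_real \<sigma>) + mellin \<psi> (of_real \<sigma>)"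
proof -
  have "integrable lborel (\<lambda>x. indicator {0<..} x * \<phi> x * x powr \<sigma>)" if "mellin_integrable \<phi> \<sigma>" for \<phi>
  proof -
    have [measurable]: "\<phi> \<in> borel_measurable borel" using that by (simp add: mellin_integrable_def)
    have "integrable lborel (\<lambda>x. indicator {0<..} x * \<bar>\<phi> x\<bar> * x powr \<sigma>)" using that by (simp add: mellin_integrable_def)
    then show ?thesis
      by (rule Bochner_Integration.integrable_bound) (auto simp: abs_mult)
  qed
  from Bochner_Integration.integral_add[OF this[OF assms(1)] this[OF assms(2)]]
  show ?thesis unfolding mellin_of_real by (simp add: algebra_simps flip: of_real_add)
qed

lemma mellin_cong:
  "(\<And>x. x > 0 \<Longrightarrow> \<phi> x = \<psi> x) \<Longrightarrow> mellin \<phi> s = mellin \<psi> s"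
  unfolding mellin_def by (rule Bochner_Integration.integral_cong) (auto simp: indicator_def)

lemma mellin_cmult: "mellin (\<lambda>x. c * \<phi> x) (of_real \<sigma>) = of_real c * mellin \<phi> (of_real \<sigma>)"
  unfolding mellin_of_real by (simp add: mult_ac flip: of_real_mult)

lemma mellin_unit_interval:
  assumes "\<sigma> + a > -1"
  shows "mellin_integrable (\<lambda>x. indicator {0<..1} x * x powr a) \<sigma>"
    and "mellin (\<lambda>x. indicator {0<..1} x * x powr a) (of_real \<sigma>) = 1 / (of_real (\<sigma> + a) + 1)"
proof -
  have e: "indicator {0<..} x * (indicator {0<..1} x * x powr a) * x powr \<sigma> = indicator {0<..1} x * x powr (\<sigma> + a)" for x :: real
    by (auto simp: indicator_def powr_add)
  show "mellin_integrable (\<lambda>x. indicator {0<..1} x * x powr a) \<sigma>"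
    using integrable_powr_unit_interval[OF assms] by (simp add: mellin_integrable_def abs_mult e)
  show "mellin (\<lambda>x. indicator {0<..1} x * x powr a) (of_real \<sigma>) = 1 / (of_real (\<sigma> + a) + 1)"
    unfolding mellin_of_real e integrable_powr_unit_interval(2)[OF assms] by simp
qed

lemma mellin_to_inf:
  assumes "\<sigma> + a < -1"
  shows "mellin_integrable (\<lambda>x. indicator {1<..} x * x powr a) \<sigma>"
    and "mellin (\<lambda>x. indicator {1<..} x * x powr a) (of_real \<sigma>) = - 1 / (of_real (\<sigma> + a) + 1)"
proof -
  have e: "indicator {0<..} x * (indicator {1<..} x * x powr a) * x powr \<sigma> = indicator {1<..} x * x powr (\<sigma> + a)" for x :: real
    by (auto simp: indicator_def powr_add)
  have "((\<lambda>x. x powr (\<sigma> + a)) has_integral -(1 powr (\<sigma> + a + 1)) / (\<sigma> + a + 1)) {1..}"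
    by (rule has_integral_powr_to_inf) (use assms in auto)
  then have "(\<integral>\<^sup>+x. ennreal (indicator {1..} x * x powr (\<sigma> + a)) \<partial>lborel) = ennreal (- 1 / (\<sigma> + a + 1))"
    using nn_integral_has_integral_lebesgue[of "{1..}" "\<lambda>x. x powr (\<sigma> + a)"] by simp
  also have "(\<integral>\<^sup>+x. ennreal (indicator {1..} x * x powr (\<sigma> + a)) \<partial>lborel) = (\<integral>\<^sup>+x. ennreal (indicator {1<..} x * x powr (\<sigma> + a)) \<partial>lborel)"
    using AE_lborel_singleton[of 1] by (intro nn_integral_cong_AE) (auto simp: indicator_def)
  finally have "has_bochner_integral lborel (\<lambda>x. indicator {1<..} x * x powr (\<sigma> + a)) (- 1 / (\<sigma> + a + 1))"
    by (intro has_bochner_integral_nn_integral) (use assms in \<open>auto simp: divide_nonpos_neg\<close>)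
  then have i: "integrable lborel (\<lambda>x. indicator {1<..} x * x powr (\<sigma> + a))"
    "(\<integral>x. indicator {1<..} x * x powr (\<sigma> + a) \<partial>lborel) = - 1 / (\<sigma> + a + 1)"
    by (simp_all add: has_bochner_integral_iff)
  show "mellin_integrable (\<lambda>x. indicator {1<..} x * x powr a) \<sigma>"
    using i(1) by (simp add: mellin_integrable_def abs_mult e)
  show "mellin (\<lambda>x. indicator {1<..} x * x powr a) (of_real \<sigma>) = - 1 / (of_real (\<sigma> + a) + 1)"
    unfolding mellin_of_real e i(2) by simp
qed

section \<open>The functional equation\<close>

lemma mellin_integrable_add:
  assumes i: "mellin_integrable \<phi> a" "mellin_integrable \<psi> a"
  shows "mellin_integrable (\<lambda>x. \<phi> x + \<psi> x) a"
proof -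
  have [measurable]: "\<phi> \<in> borel_measurable borel" "\<psi> \<in> borel_measurable borel" using i by (auto simp: mellin_integrable_def)
  have "integrable lborel (\<lambda>x. indicator {0<..} x * \<bar>\<phi> x\<bar> * x powr a + indicator {0<..} x * \<bar>\<psi> x\<bar> * x powr a)"
    using i by (auto simp: mellin_integrable_def)
  then have "integrable lborel (\<lambda>x. indicator {0<..} x * \<bar>\<phi> x + \<psi> x\<bar> * x powr a)"
  proof (rule Bochner_Integration.integrable_bound)
    show "AE x in lborel. norm (indicator {0<..} x * \<bar>\<phi> x + \<psi> x\<bar> * x powr a) \<le> norm (indicator {0<..} x * \<bar>\<phi> x\<bar> * x powr a + indicator {0<..} x * \<bar>\<psi> x\<bar> * x powr a)"
      by (rule AE_I2) (auto simp: indicator_def simp flip: distrib_right intro!: mult_right_mono)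
  qed measurable
  then show ?thesis by (simp add: mellin_integrable_def)
qed

lemma Re_pos_notin_nonpos_Ints: "Re w > 0 \<Longrightarrow> w \<notin> \<int>\<^sub>\<le>\<^sub>0"
  by (auto elim!: nonpos_Ints_cases)

lemma mellin_integrable_cmult:
  "mellin_integrable \<phi> a \<Longrightarrow> mellin_integrable (\<lambda>x. c * \<phi> x) a"
  by (rule mellin_integrable_le[of \<phi> a _ _ "\<bar>c\<bar>"]) (auto simp: mellin_integrable_def abs_mult)

text \<open>The sum of \<open>bose_lo\<close> and \<open>bose_hi\<close> differs from 1/(exp x - 1)
  only on (0, 1], by 1/x - 1/2, and from \<open>bose\<close> only on (1, \<infinity>), by the
  negative of the same expression. The transforms of both corrections are given by one rational
  function, so the two integrals, convergent on disjoint ranges, belong to one analytic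
  function.\<close>

definition bose_lo :: "real \<Rightarrow> real" where "bose_lo x = indicator {0<..1} x * bose x"
definition bose_hi :: "real \<Rightarrow> real" where "bose_hi x = indicator {1<..} x * (1 / (exp x - 1))"

lemma mellin_integrable_bose_lo:
  assumes "\<sigma> > -2"
  shows "mellin_integrable bose_lo \<sigma>"
proof (rule mellin_integrable_le[where C = 1])
  show "mellin_integrable (\<lambda>x. indicator {0<..1} x * x powr 1) \<sigma>"
    by (rule mellin_unit_interval) (use assms in auto)
  show "bose_lo \<in> borel_measurable borel" unfolding bose_lo_def[abs_def] by measurable
  show "\<bar>bose_lo x\<bar> * x powr \<sigma> \<le> 1 * (\<bar>indicator {0<..1} x * x powr 1\<bar> * x powr \<sigma>)" if "x > 0" for x
    using bose_nonneg[OF that] bose_le[OF that] that by (auto simp: bose_lo_def indicator_def intro!: mult_right_mono)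
qed simp

lemma mellin_integrable_planck:
  assumes "\<sigma> > 0"
  shows "mellin_integrable (\<lambda>x. 1 / (exp x - 1)) \<sigma>"
proof (rule mellin_integrable_nn)
  have "(\<integral>\<^sup>+x. ennreal (indicator {0<..} x * (\<bar>1 / (exp x - 1)\<bar> * x powr \<sigma>)) \<partial>lborel) =
    (\<integral>\<^sup>+x. ennreal (indicator {0<..} x * (x powr (\<sigma> + 1 - 1) / (exp x - 1))) \<partial>lborel)"
    by (rule nn_integral_cong) (auto simp: indicator_def)
  also have "\<dots> < \<infinity>" using nn_integral_zeta[of "\<sigma> + 1"] assms by simp
  finally show "(\<integral>\<^sup>+x. ennreal (indicator {0<..} x * (\<bar>1 / (exp x - 1)\<bar> * x powr \<sigma>)) \<partial>lborel) < \<infinity>" .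
qed measurable

lemma mellin_integrable_bose_hi: "mellin_integrable bose_hi \<sigma>"
proof (rule mellin_integrable_le[where C = 1])
  show "mellin_integrable (\<lambda>x. 1 / (exp x - 1)) (max 1 \<sigma>)"
    by (rule mellin_integrable_planck) simp
  show "bose_hi \<in> borel_measurable borel" unfolding bose_hi_def[abs_def] by measurable
  show "\<bar>bose_hi x\<bar> * x powr \<sigma> \<le> 1 * (\<bar>1 / (exp x - 1)\<bar> * x powr (max 1 \<sigma>))" if "x > 0" for x
    using that by (auto simp: bose_hi_def indicator_def intro!: divide_right_mono powr_mono)
qed simp

lemma mellin_planck:
  assumes "s > 1"
  shows "mellin (\<lambda>x. 1 / (exp x - 1)) (of_real (s - 1)) = Gamma (of_real s) * zeta (of_real s)"
proof -
  obtain z where z: "z > 0" "zeta (of_real s) = of_real z" using zeta_real_sums[OF assms] by blast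
  have "(\<integral>x. indicator {0<..} x * (1 / (exp x - 1)) * x powr (s - 1) \<partial>lborel) = Gamma s * z"
  proof (rule has_bochner_integral_integral_eq[OF has_bochner_integral_nn_integral])
    show "(\<integral>\<^sup>+x. ennreal (indicator {0<..} x * (1 / (exp x - 1)) * x powr (s - 1)) \<partial>lborel) = ennreal (Gamma s * z)"
      using nn_integral_zeta[OF assms] z by simp
    show "AE x in lborel. 0 \<le> indicator {0<..} x * (1 / (exp x - 1)) * x powr (s - 1)"
      by (auto simp: indicator_def)
    show "0 \<le> Gamma s * z" using z assms by (intro mult_nonneg_nonneg Gamma_real_nonneg) auto
  qed measurable
  then show ?thesis unfolding mellin_of_real z(2) by (simp add: Gamma_complex_of_real)
qed

lemma zeta_mellin_real:
  assumes "s > 1"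
  shows "Gamma (of_real s) * zeta (of_real s) = mellin bose_lo (of_real s - 1) + mellin bose_hi (of_real s - 1)
    + 1 / (of_real s - 1) - 1 / (2 * of_real s)"
proof -
  define a where "a = s - 1"
  have a: "a > 0" using assms by (simp add: a_def)
  let ?u = "\<lambda>x::real. indicator {0<..1} x * x powr (-1)" and ?v = "\<lambda>x::real. (-1/2) * (indicator {0<..1} x * x powr 0)"
  have iu: "mellin_integrable ?u a" by (rule mellin_unit_interval) (use a in auto)
  have iv: "mellin_integrable ?v a" by (intro mellin_integrable_cmult mellin_unit_interval) (use a in auto)
  have lo: "mellin_integrable bose_lo a" by (rule mellin_integrable_bose_lo) (use a in simp)
  have "mellin (\<lambda>x. 1 / (exp x - 1)) (of_real a) = mellin (\<lambda>x. (bose_lo x + bose_hi x) + (?u x + ?v x)) (of_real a)"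
  proof (rule mellin_cong)
    fix x :: real assume x: "x > 0"
    show "1 / (exp x - 1) = (bose_lo x + bose_hi x) + (?u x + ?v x)"
      using x by (cases "x \<le> 1") (simp_all add: bose_lo_def bose_hi_def bose_def powr_minus inverse_eq_divide)
  qed
  also have "\<dots> = (mellin bose_lo (of_real a) + mellin bose_hi (of_real a)) + (mellin ?u (of_real a) + mellin ?v (of_real a))"
    by (simp only: mellin_add[OF mellin_integrable_add[OF lo mellin_integrable_bose_hi] mellin_integrable_add[OF iu iv]]
        mellin_add[OF lo mellin_integrable_bose_hi] mellin_add[OF iu iv])
  also have "mellin ?u (of_real a) = 1 / of_real a"
    using mellin_unit_interval(2)[of a "-1"] a by simp
  also have "mellin ?v (of_real a) = (-1/2) * (1 / (of_real a + 1))"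
    unfolding mellin_cmult using mellin_unit_interval(2)[of a 0] a by simp
  finally show ?thesis
    using mellin_planck[OF assms] by (simp add: a_def algebra_simps)
qed

text \<open>Multiplying the formula for Gamma(s) zeta(s) by s (s - 1) removes the poles of 1/(s - 1)
  - 1/(2 s), which become (s + 1)/2. Both sides are then holomorphic for \<open>Re s > -1\<close>,
  because \<open>bose_lo\<close> is integrable down to exponent -2.\<close>

lemma Gamma_zeta_reg_mellin:
  assumes s: "Re s > -1"
  shows "Gamma (s + 1) * zeta_reg s = s * (s - 1) * (mellin bose_lo (s - 1) + mellin bose_hi (s - 1)) + (s + 1) / 2"
proof -
  define b where "b = max 3 (Re s + 1)"
  let ?S = "{s. -1 < Re s \<and> Re s < b}"
  have m: "(\<lambda>s. mellin \<phi> (s - 1)) holomorphic_on ?S" if "\<And>\<sigma>. \<sigma> > -2 \<Longrightarrow> mellin_integrable \<phi> \<sigma>" for \<phi>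
  proof -
    have "mellin \<phi> \<circ> (\<lambda>s. s - 1) holomorphic_on ?S"
      by (rule holomorphic_on_compose_gen[OF _ mellin_holomorphic[of "-2" "b - 1"]])
         (use that in \<open>auto intro!: holomorphic_intros\<close>)
    then show ?thesis by (simp add: o_def)
  qed
  have G: "(\<lambda>s. Gamma (s + 1)) holomorphic_on ?S"
    by (intro holomorphic_intros) (auto elim!: nonpos_Ints_cases simp: complex_eq_iff)
  let ?f = "\<lambda>s. Gamma (s + 1) * zeta_reg s - (s * (s - 1) * (mellin bose_lo (s - 1) + mellin bose_hi (s - 1)) + (s + 1) / 2)"
  have "?f s = 0"
  proof (rule holomorphic_strip_eq_0[of ?f "-1" b 1 2])
    show "?f holomorphic_on ?S"
      by (intro holomorphic_intros G m mellin_integrable_bose_lo mellin_integrable_bose_hi) auto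
    fix t :: real assume "1 < t"
    define z where "z = complex_of_real t"
    have t: "z = of_real t" "1 < t" using \<open>1 < t\<close> by (simp_all add: z_def)
    have "Gamma (z + 1) * zeta_reg z = (z * (z - 1)) * (Gamma z * zeta z)"
      using t Gamma_plus1[OF Re_pos_notin_nonpos_Ints, of z] by (simp add: zeta_reg_def)
    also have "\<dots> = (z * (z - 1)) * (mellin bose_lo (z - 1) + mellin bose_hi (z - 1) + 1 / (z - 1) - 1 / (2 * z))"
      using zeta_mellin_real[OF t(2)] t(1) by simp
    also have "\<dots> = z * (z - 1) * (mellin bose_lo (z - 1) + mellin bose_hi (z - 1)) + (z + 1) / 2"
      using t by (simp add: field_simps)
    finally show "?f (of_real t) = 0" unfolding t(1) by simp
  qed (use s in \<open>auto simp: b_def\<close>)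
  then show ?thesis by simp
qed

text \<open>On (-1, 0) the transform of \<open>bose\<close> is evaluated twice: by partial
  fractions, giving zeta(1 - s), and by the split into \<open>bose_lo\<close>,
  \<open>bose_hi\<close> and powers, giving the continued zeta(s).\<close>

lemma zeta_functional_real:
  assumes "-1 < s" "s < (0::real)"
  shows "Gamma (of_real s + 1) * zeta_reg (of_real s) =
    (1 - of_real s) * of_real ((2 * pi) powr (s - 1) * Gamma ((1 + s) / 2) * Gamma ((1 - s) / 2)) * zeta_reg (1 - of_real s)"
proof -
  define a where "a = s - 1"
  have a: "a > -2" "a < -1" using assms by (auto simp: a_def)
  let ?u = "\<lambda>x::real. (-1) * (indicator {1<..} x * x powr (-1))" and ?v = "\<lambda>x::real. (1/2) * (indicator {1<..} x * x powr 0)"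
  have iu: "mellin_integrable ?u a" by (intro mellin_integrable_cmult mellin_to_inf) (use a in auto)
  have iv: "mellin_integrable ?v a" by (intro mellin_integrable_cmult mellin_to_inf) (use a in auto)
  have lo: "mellin_integrable bose_lo a" by (rule mellin_integrable_bose_lo) (use a in simp)
  obtain z where z: "z > 0" "zeta (of_real (1 - s)) = of_real z" using zeta_real_sums[of "1 - s"] assms by auto
  let ?c = "(2 * pi) powr (s - 1) * Gamma ((1 + s) / 2) * Gamma ((1 - s) / 2)"
  have "(\<integral>x. indicator {0<..} x * bose x * x powr a \<partial>lborel) = ?c * z"
  proof (rule has_bochner_integral_integral_eq[OF has_bochner_integral_nn_integral])
    show "(\<integral>\<^sup>+x. ennreal (indicator {0<..} x * bose x * x powr a) \<partial>lborel) = ennreal (?c * z)"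
      using nn_integral_bose[OF assms] z by (simp add: a_def mult.assoc)
    show "AE x in lborel. 0 \<le> indicator {0<..} x * bose x * x powr a"
      by (auto simp: indicator_def bose_nonneg)
    show "0 \<le> ?c * z" using z assms by (intro mult_nonneg_nonneg Gamma_real_nonneg) auto
  qed measurable
  then have "of_real (?c * z) = mellin bose (of_real a)" by (simp only: mellin_of_real)
  also have "\<dots> = mellin (\<lambda>x. (bose_lo x + bose_hi x) + (?u x + ?v x)) (of_real a)"
  proof (rule mellin_cong)
    fix x :: real assume x: "x > 0"
    show "bose x = (bose_lo x + bose_hi x) + (?u x + ?v x)"
      using x by (cases "x \<le> 1") (simp_all add: bose_lo_def bose_hi_def bose_def powr_minus inverse_eq_divide)
  qed
  also have "\<dots> = (mellin bose_lo (of_real a) + mellin bose_hi (of_real a)) + (mellin ?u (of_real a) + mellin ?v (of_real a))"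
    by (simp only: mellin_add[OF mellin_integrable_add[OF lo mellin_integrable_bose_hi] mellin_integrable_add[OF iu iv]]
        mellin_add[OF lo mellin_integrable_bose_hi] mellin_add[OF iu iv])
  also have "mellin ?u (of_real a) = (-1) * (- 1 / of_real a)"
    unfolding mellin_cmult using mellin_to_inf(2)[of a "-1"] a by simp
  also have "mellin ?v (of_real a) = (1/2) * (- 1 / (of_real a + 1))"
    unfolding mellin_cmult using mellin_to_inf(2)[of a 0] a by simp
  finally have M: "mellin bose_lo (of_real s - 1) + mellin bose_hi (of_real s - 1) = of_real (?c * z) - 1 / (of_real s - 1) + 1 / (2 * of_real s)"
    by (simp add: a_def algebra_simps)
  have s0: "complex_of_real s \<noteq> 0" "complex_of_real s - 1 \<noteq> 0" using assms by auto
  have "Gamma (of_real s + 1) * zeta_reg (of_real s) = of_real s * (of_real s - 1) * of_real (?c * z)"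
  proof -
    have "w * (w - 1) * (C - 1 / (w - 1) + 1 / (2 * w)) + (w + 1) / 2 = w * (w - 1) * C" if "w \<noteq> 0" "w - 1 \<noteq> 0" for w C :: complex
      using that by (simp add: divide_simps) (simp add: algebra_simps)
    from this[OF s0, of "of_real (?c * z)"] show ?thesis
      using Gamma_zeta_reg_mellin[of "of_real s"] assms(1) unfolding M by (simp only: Re_complex_of_real)
  qed
  also have "zeta_reg (1 - of_real s) = - of_real s * of_real z"
    using z(2) s0 by (simp add: zeta_reg_def)
  then have "of_real s * (of_real s - 1) * of_real (?c * z) = (1 - of_real s) * of_real ?c * zeta_reg (1 - of_real s)"
    by (simp add: algebra_simps)
  finally show ?thesis .
qed

text \<open>Riemann's xi, usually written s (s - 1)/2 times pi^(-s/2) Gamma(s/2) zeta(s). Absorbing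
  s/2 into the Gamma factor and s - 1 into \<open>zeta_reg\<close> makes the formula holomorphic for
  \<open>Re s > -2\<close> as it stands.\<close>

definition xi :: "complex \<Rightarrow> complex" where
  "xi s = of_real pi powr (- s / 2) * Gamma (s / 2 + 1) * zeta_reg s"

lemma xi_holomorphic: "xi holomorphic_on {s. Re s > -2}"
  unfolding xi_def[abs_def]
  by (intro holomorphic_intros) (auto elim!: nonpos_Ints_cases simp: complex_eq_iff)

text \<open>On the real interval (-1, 0), Legendre duplication at (1 + z)/2 converts Gamma(z + 1)
  into P Gamma(z/2 + 1). The factor P also occurs on the other side and cancels; Q becomes the Gamma
  factor of xi(1 - z).\<close>

lemma xi_functional_equation:
  assumes s: "-1 < Re s" "Re s < 2"
  shows "xi s = xi (1 - s)"
proof -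
  have "xi s - xi (1 - s) = 0"
  proof (rule holomorphic_strip_eq_0[of "\<lambda>s. xi s - xi (1 - s)" "-1" 2 "-1" 0])
    let ?S = "{s. -1 < Re s \<and> Re s < 2}"
    have "xi \<circ> (\<lambda>s. 1 - s) holomorphic_on ?S"
      by (rule holomorphic_on_compose_gen[OF _ xi_holomorphic]) (auto intro!: holomorphic_intros)
    then show "(\<lambda>s. xi s - xi (1 - s)) holomorphic_on ?S"
      by (intro holomorphic_intros holomorphic_on_subset[OF xi_holomorphic]) (auto simp: o_def)
    fix t :: real assume "-1 < t" "t < 0"
    define z where "z = complex_of_real t"
    have t: "z = of_real t" "-1 < t" "t < 0" using \<open>-1 < t\<close> \<open>t < 0\<close> by (simp_all add: z_def)
    define P Q where "P = complex_of_real (Gamma ((1 + t) / 2))" and "Q = complex_of_real (Gamma ((1 - t) / 2))"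
    have P: "P = Gamma ((1 + z) / 2)" "Q = Gamma ((1 - z) / 2)"
      using Gamma_complex_of_real[of "(1 + t) / 2"] Gamma_complex_of_real[of "(1 - t) / 2"] by (simp_all add: P_def Q_def t(1))
    have "Gamma ((1 + t) / 2) > 0" by (rule Gamma_real_pos) (use t in simp)
    then have P0: "P \<noteq> 0" unfolding P_def of_real_eq_0_iff by linarith
    have dup: "P * Gamma (z / 2 + 1) = 2 powr (-z) * of_real (sqrt pi) * Gamma (z + 1)"
    proof -
      have e: "(1 + z) / 2 + 1 / 2 = z / 2 + 1" "1 - 2 * ((1 + z) / 2) = - z" "2 * ((1 + z) / 2) = z + 1"
        by (auto simp: field_simps)
      have "Ln 2 = of_real (ln 2)" using Ln_of_real[of 2] by simp
      then show ?thesis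
        using Gamma_legendre_duplication[OF Re_pos_notin_nonpos_Ints Re_pos_notin_nonpos_Ints, of "(1 + z) / 2"] t unfolding e P by (simp add: powr_def)
    qed
    have G: "Gamma ((1 - z) / 2 + 1) = (1 - z) / 2 * Q"
      unfolding P by (rule Gamma_plus1) (use t in \<open>auto elim!: nonpos_Ints_cases simp: complex_eq_iff\<close>)
    have F: "Gamma (z + 1) * zeta_reg z = (1 - z) * (of_real ((2 * pi) powr (t - 1)) * P * Q) * zeta_reg (1 - z)"
      using zeta_functional_real[OF t(2,3)] by (simp add: t(1) P_def Q_def)
    have c: "of_real ((2 * pi) powr (t - 1)) = 2 powr z * of_real pi powr z / (2 * of_real pi)"
    proof -
      have "complex_of_real ((2 * pi) powr (t - 1)) = (2 powr t * pi powr t / (2 * pi) :: real)"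
        by (simp add: powr_mult powr_diff)
      then show ?thesis using powr_of_real[of 2 t] powr_of_real[of pi t] by (simp add: t(1))
    qed
    have sp: "complex_of_real (sqrt pi) = of_real pi powr (1/2)"
      using powr_of_real[of pi "1/2"] by (simp add: powr_half_sqrt)
    have pp: "complex_of_real pi \<noteq> 0" by simp
    have "P * (Gamma (z / 2 + 1) * zeta_reg z) = 2 powr (-z) * of_real (sqrt pi) * (Gamma (z + 1) * zeta_reg z)"
      using dup by (simp add: mult.assoc[symmetric])
    also have "\<dots> = P * ((2 powr (-z) * 2 powr z) * (of_real pi powr (1/2) * of_real pi powr z / of_real pi) * (Gamma ((1 - z) / 2 + 1) * zeta_reg (1 - z)))"
      unfolding F c sp G by (simp add: field_simps)
    also have "2 powr (-z) * 2 powr z = (1::complex)" by (simp flip: powr_add)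
    finally have "Gamma (z / 2 + 1) * zeta_reg z = (of_real pi powr (1/2) * of_real pi powr z / of_real pi) * (Gamma ((1 - z) / 2 + 1) * zeta_reg (1 - z))"
      by (simp only: mult_left_cancel[OF P0] mult_1_left)
    then have "xi z = (of_real pi powr (-z/2) * of_real pi powr (1/2) * of_real pi powr z / of_real pi) * (Gamma ((1 - z) / 2 + 1) * zeta_reg (1 - z))"
      unfolding xi_def by (simp add: mult.assoc)
    also have "of_real pi powr (-z/2) * of_real pi powr (1/2) * of_real pi powr z / of_real pi = of_real pi powr (-z/2 + 1/2 + z - 1)"
    proof -
      have "complex_of_real pi powr 1 = of_real pi" by simp
      then show ?thesis by (simp only: powr_diff powr_add)
    qed
    also have "-z/2 + 1/2 + z - 1 = - (1 - z) / 2" by (simp add: field_simps)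
    finally show "xi (of_real t) - xi (1 - of_real t) = 0" unfolding xi_def t(1)[symmetric] by (simp add: mult.assoc)
  qed (use s in auto)
  then show ?thesis by simp
qed

lemma zeta_zero_reflect:
  assumes "0 < Re s" "Re s < 1" "zeta s = 0"
  shows "zeta (1 - s) = 0"
proof -
  have "s \<noteq> 1" "1 - s \<noteq> 1" using assms by auto
  have "xi s = 0" using assms \<open>s \<noteq> 1\<close> by (simp add: xi_def zeta_reg_def)
  then have "xi (1 - s) = 0" using xi_functional_equation[of s] assms by simp
  moreover have "Gamma ((1 - s) / 2 + 1) \<noteq> 0"
    unfolding Gamma_eq_zero_iff by (rule Re_pos_notin_nonpos_Ints) (use assms in \<open>simp add: field_simps\<close>)
  ultimately show ?thesis using \<open>1 - s \<noteq> 1\<close> by (simp add: xi_def zeta_reg_def)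
qed

section \<open>Existence of a nontrivial zero\<close>

text \<open>The map f / (2A - f) sends the half-plane of real parts below A into the unit disc and
  fixes 0. Schwarz's lemma applies, and the resulting inequality is solved for |f|.\<close>

lemma borel_caratheodory:
  assumes f: "f holomorphic_on ball 0 R" and f0: "f 0 = 0" and A: "A > 0"
    and Re: "\<And>z. z \<in> ball 0 R \<Longrightarrow> Re (f z) < A" and z: "norm z < R"
  shows "norm (f z) \<le> 2 * A * norm z / (R - norm z)"
proof -
  have R: "R > 0" using z norm_ge_zero[of z] by linarith
  have in_ball: "of_real R * w \<in> ball 0 R" if "norm w < 1" for w :: complex
    using that R by (simp add: norm_mult)
  have nz: "2 * of_real A - f w \<noteq> 0" if "w \<in> ball 0 R" for w
    using Re[OF that] A by (auto simp: complex_eq_iff)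
  have lt: "norm (f w) < norm (2 * of_real A - f w)" if "w \<in> ball 0 R" for w
  proof -
    have "(norm (2 * of_real A - f w))\<^sup>2 - (norm (f w))\<^sup>2 = 4 * A * (A - Re (f w))"
      unfolding cmod_power2 by (simp add: power2_eq_square algebra_simps)
    moreover have "4 * A * (A - Re (f w)) > 0" using Re[OF that] A by simp
    ultimately have "(norm (f w))\<^sup>2 < (norm (2 * of_real A - f w))\<^sup>2" by linarith
    then show ?thesis by (rule power2_less_imp_less) simp
  qed
  define \<phi> where "\<phi> = (\<lambda>w. f (of_real R * w) / (2 * of_real A - f (of_real R * w)))"
  have g: "(\<lambda>w. f (of_real R * w)) holomorphic_on ball 0 1"
  proof (rule holomorphic_on_compose_gen[OF _ f, of "\<lambda>w. of_real R * w" "ball 0 1", unfolded o_def])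
    show "(*) (complex_of_real R) ` ball 0 1 \<subseteq> ball 0 R"
      by (rule image_subsetI) (rule in_ball, simp)
  qed (intro holomorphic_intros)
  have "\<phi> holomorphic_on ball 0 1"
    unfolding \<phi>_def by (intro holomorphic_intros g) (use nz in_ball in auto)
  moreover have "\<phi> 0 = 0" by (simp add: \<phi>_def f0)
  moreover have "norm (\<phi> w) < 1" if "norm w < 1" for w
    using lt[OF in_ball[OF that]] nz[OF in_ball[OF that]] by (simp add: \<phi>_def norm_divide divide_less_eq_1)
  moreover have w: "norm (z / of_real R) < 1" using z R by (simp add: norm_divide)
  ultimately have "norm (\<phi> (z / of_real R)) \<le> norm (z / of_real R)"
    by (rule Schwarz_Lemma(1))
  then have "norm (f z) / norm (2 * of_real A - f z) \<le> norm z / R"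
    using R by (simp add: \<phi>_def norm_divide)
  then have "norm (f z) * R \<le> norm z * norm (2 * of_real A - f z)"
    using R nz[of z] z by (simp add: field_simps)
  also have "\<dots> \<le> norm z * (2 * A + norm (f z))"
    using norm_triangle_ineq4[of "2 * of_real A" "f z"] A by (intro mult_left_mono) (auto simp: norm_mult)
  finally have "norm (f z) * (R - norm z) \<le> 2 * A * norm z" by (simp add: algebra_simps)
  then show ?thesis using z by (simp add: pos_le_divide_eq)
qed

text \<open>The Borel-Caratheodory inequality gives |h - h(0)| = O(R^(3/2)) on radius R/2, so the
  k-th Taylor coefficient is O(R^(3/2 - k)) and vanishes for k \<ge> 2. The exponent 3/2 is below 2
  and leaves room above order 1; the shift by 2 absorbs the reflection of s to 1 - s.\<close>

lemma entire_Re_growth_imp_affine: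
  assumes h: "h holomorphic_on UNIV" and K: "\<And>z. Re (h z) \<le> K * (norm z + 2) powr (3/2)"
  shows "h z = h 0 + deriv h 0 * z"
proof -
  have K': "Re (h z) \<le> \<bar>K\<bar> * (norm z + 2) powr (3/2)" for z
    by (rule order_trans[OF K]) (auto intro!: mult_right_mono)
  define A where "A = (\<lambda>R::real. \<bar>K\<bar> * (R + 2) powr (3/2) + norm (h 0) + 1)"
  have Apos: "A R > 0" for R unfolding A_def by (intro add_nonneg_pos) auto
  have fbound: "norm (h z - h 0) \<le> 2 * A R" if R: "R > 0" and z: "norm z \<le> R / 2" for R z
  proof -
    have "norm (h z - h 0) \<le> 2 * A R * norm z / (R - norm z)"
    proof (rule borel_caratheodory[where f = "\<lambda>z. h z - h 0"])
      show "(\<lambda>z. h z - h 0) holomorphic_on ball 0 R"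
        by (intro holomorphic_intros holomorphic_on_subset[OF h]) auto
      fix w :: complex assume "w \<in> ball 0 R"
      then have "\<bar>K\<bar> * (norm w + 2) powr (3/2) \<le> \<bar>K\<bar> * (R + 2) powr (3/2)"
        by (intro mult_left_mono powr_mono2) auto
      then show "Re (h w - h 0) < A R"
        using K'[of w] abs_Re_le_cmod[of "h 0"] by (simp add: A_def)
    qed (use Apos R z in auto)
    also have "\<dots> \<le> 2 * A R"
    proof -
      have "norm z / (R - norm z) \<le> 1" using R z by (simp add: divide_le_eq_1)
      from mult_left_mono[OF this, of "2 * A R"] Apos[of R] show ?thesis by simp
    qed
    finally show ?thesis .
  qed
  let ?C = "\<bar>K\<bar> * 3 powr (3/2) + norm (h 0) + 1"
  have zero: "(deriv ^^ k) h 0 = 0" if k: "k \<ge> 2" for k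
  proof -
    have bd: "norm ((deriv ^^ k) h 0) \<le> fact k * 2 ^ k * 2 * ?C * R powr (-1/2)" if R: "R \<ge> 1" for R
    proof -
      have "(deriv ^^ k) (\<lambda>z. h z - h 0) 0 = (deriv ^^ k) h 0 - (deriv ^^ k) (\<lambda>z. h 0) 0"
        by (rule higher_deriv_diff[OF h holomorphic_on_const]) auto
      then have e: "(deriv ^^ k) (\<lambda>z. h z - h 0) 0 = (deriv ^^ k) h 0" using k by simp
      have "norm ((deriv ^^ k) (\<lambda>z. h z - h 0) 0) \<le> fact k * (2 * A R) / (R / 2) ^ k"
      proof (rule Cauchy_inequality)
        show "(\<lambda>z. h z - h 0) holomorphic_on ball 0 (R / 2)"
          by (intro holomorphic_intros holomorphic_on_subset[OF h]) auto
        show "continuous_on (cball 0 (R / 2)) (\<lambda>z. h z - h 0)"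
          by (intro continuous_intros continuous_on_subset[OF holomorphic_on_imp_continuous_on[OF h]]) auto
      qed (use fbound R in auto)
      also have "\<dots> = fact k * 2 ^ k * 2 * (A R / R ^ k)" by (simp add: power_divide)
      also have "A R / R ^ k \<le> ?C * R powr (-1/2)"
      proof -
        have "(R + 2) powr (3/2) \<le> (3 * R) powr (3/2)" using R by (intro powr_mono2) auto
        also have "\<dots> = 3 powr (3/2) * R powr (3/2)" using R by (simp add: powr_mult)
        finally have "\<bar>K\<bar> * (R + 2) powr (3/2) \<le> \<bar>K\<bar> * 3 powr (3/2) * R powr (3/2)"
          by (simp add: mult.assoc mult_left_mono)
        moreover have "1 \<le> R powr (3/2)" using R by (intro ge_one_powr_ge_zero) auto
        then have "norm (h 0) + 1 \<le> (norm (h 0) + 1) * R powr (3/2)"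
          using mult_left_mono[of 1 "R powr (3/2)" "norm (h 0) + 1"] by simp
        ultimately have "A R \<le> ?C * R powr (3/2)"
          by (simp add: A_def algebra_simps)
        moreover have "R powr 2 \<le> R ^ k" using R k power_increasing[of 2 k R] by (simp add: powr_numeral)
        ultimately have "A R / R ^ k \<le> ?C * R powr (3/2) / R powr 2"
          using R Apos[of R] by (intro frac_le) auto
        also have "\<dots> = ?C * (R powr (3/2 - 2))"
          unfolding powr_diff by simp
        finally show ?thesis by simp
      qed
      finally have "norm ((deriv ^^ k) (\<lambda>z. h z - h 0) 0) \<le>
          fact k * 2 ^ k * 2 * (?C * R powr (-1/2))"
        by (simp add: mult_left_mono)
      then show ?thesis unfolding e by (simp only: mult.assoc)
    qed
    have "norm ((deriv ^^ k) h 0) \<le> fact k * 2 ^ k * 2 * ?C * 0"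
    proof (rule tendsto_lowerbound)
      show "((\<lambda>R. fact k * 2 ^ k * 2 * ?C * R powr (-1/2)) \<longlongrightarrow>
          fact k * 2 ^ k * 2 * ?C * 0) at_top"
        by (intro tendsto_mult_left tendsto_neg_powr filterlim_ident) auto
      show "\<forall>\<^sub>F R in at_top. norm ((deriv ^^ k) h 0) \<le> fact k * 2 ^ k * 2 * ?C * R powr (-1/2)"
        using eventually_ge_at_top[of 1] by eventually_elim (rule bd)
    qed auto
    then show ?thesis by simp
  qed
  have "(\<lambda>k. (deriv ^^ k) h 0 / fact k * (z - 0) ^ k) sums h z"
    by (rule holomorphic_power_series[of _ _ "norm z + 1"]) (auto intro: holomorphic_on_subset[OF h])
  moreover have "(\<lambda>k. (deriv ^^ k) h 0 / fact k * (z - 0) ^ k) sums (\<Sum>k\<in>{0,1}. (deriv ^^ k) h 0 / fact k * (z - 0) ^ k)"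
  proof (rule sums_finite)
    fix k :: nat assume "k \<notin> {0, 1}"
    then have "k \<ge> 2" by simp
    then show "(deriv ^^ k) h 0 / fact k * (z - 0) ^ k = 0" by (simp add: zero)
  qed simp
  ultimately show ?thesis using sums_unique2 by fastforce
qed

text \<open>In Euler's integral, t^(Re z - 1) \<le> 1 + t^n, and the two parts integrate to 1 and
  n!.\<close>

lemma norm_Gamma_le:
  assumes "Re z \<ge> 1" "Re z \<le> real n + 1"
  shows "norm (Gamma z) \<le> 1 + fact n"
proof -
  have i1: "((\<lambda>t. t powr (1 - 1) / exp t + t powr (real n + 1 - 1) / exp t) has_integral (Gamma 1 + Gamma (real n + 1))) {0..}"
    by (intro has_integral_add Gamma_integral_real) auto
  have i2: "((\<lambda>t. of_real t powr (z - 1) / of_real (exp t)) has_integral Gamma z) {0..}"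
    by (rule Gamma_integral_complex) (use assms in auto)
  have "norm (integral {0..} (\<lambda>t. of_real t powr (z - 1) / of_real (exp t) :: complex)) \<le> integral {0..} (\<lambda>t. t powr (1 - 1) / exp t + t powr (real n + 1 - 1) / exp t)"
  proof (rule integral_norm_bound_integral)
    fix t :: real assume t: "t \<in> {0..}"
    show "norm (of_real t powr (z - 1) / of_real (exp t) :: complex) \<le> t powr (1 - 1) / exp t + t powr (real n + 1 - 1) / exp t"
    proof (cases "t = 0")
      case False
      then have "t powr (Re z - 1) \<le> t powr (1 - 1) + t powr (real n + 1 - 1)"
        using powr_le_add_powr[of t "1 - 1" "Re z - 1" "real n + 1 - 1"] t assms by auto
      moreover have "norm (of_real t powr (z - 1) / of_real (exp t) :: complex) = t powr (Re z - 1) / exp t"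
        using t by (simp add: norm_divide norm_powr_real_powr)
      ultimately show ?thesis by (simp add: divide_right_mono flip: add_divide_distrib)
    qed auto
  qed (use i1 i2 in \<open>auto simp: has_integral_integrable\<close>)
  moreover have "Gamma (real n + 1) = fact n" using Gamma_fact[of n, where ?'a = real] by (simp add: add_ac)
  ultimately show ?thesis using integral_unique[OF i1] integral_unique[OF i2] by simp
qed

text \<open>The Gamma factor dominates: with r = 1 + |s| it is at most about r^r, and r ln r \<le> 2
  r^(3/2). The quadratic growth of \<open>zeta_reg\<close> disappears in the constant.\<close>

lemma norm_xi_le:
  obtains C where "C > 0" "\<And>s. Re s \<ge> 1/2 \<Longrightarrow> norm (xi s) \<le> exp (C * (1 + norm s) powr (3/2))"
proof -
  obtain C where C: "C > 0" "\<And>s. Re s \<ge> 1/2 \<Longrightarrow> norm (zeta_reg s) \<le> C * (1 + norm s)\<^sup>2"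
    using zeta_reg_bound by blast
  have "norm (xi s) \<le> exp ((2 * C + 4) * (1 + norm s) powr (3/2))" if s: "Re s \<ge> 1/2" for s
  proof -
    define r where "r = 1 + norm s"
    define n where "n = nat \<lceil>norm s\<rceil>"
    have r: "r \<ge> 1" by (simp add: r_def)
    have n: "real n \<le> r" "norm s \<le> real n" unfolding n_def r_def using norm_ge_zero[of s] by linarith+
    define L where "L = r powr (3/2)"
    have rL: "r \<le> L" unfolding L_def using powr_mono[of 1 "3/2" r] r by simp
    have lnr: "ln r \<le> 2 * r powr (1/2)" using ln_powr_bound[of r "1/2"] r by simp
    have rln: "r * ln r \<le> 2 * L"
    proof -
      have "r * ln r \<le> r powr 1 * (2 * r powr (1/2))" using lnr r by (simp add: mult_left_mono)
      also have "\<dots> = 2 * (r powr 1 * r powr (1/2))" by simp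
      also have "\<dots> = 2 * r powr (1 + 1/2)" by (simp only: powr_add)
      finally show ?thesis by (simp add: L_def)
    qed
    have "norm (Gamma (s / 2 + 1)) \<le> 1 + fact n"
      by (rule norm_Gamma_le) (use s n complex_Re_le_cmod[of s] in auto)
    also have "fact n \<le> real n ^ n" using fact_le_power[of n, where ?'a = real] by simp
    also have "real n ^ n \<le> r ^ n" using n by (intro power_mono) auto
    also have "r ^ n = exp (real n * ln r)" using r by (simp add: exp_of_nat_mult)
    also have "\<dots> \<le> exp (2 * L)"
      using rln mult_right_mono[OF n(1), of "ln r"] r by simp
    finally have G: "norm (Gamma (s / 2 + 1)) \<le> 1 + exp (2 * L)" by simp
    have "L \<ge> 1" using rL r by simp
    have "1 \<le> exp (2 * L)" using \<open>L \<ge> 1\<close> by simp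
    then have "norm (Gamma (s / 2 + 1)) \<le> 2 * exp (2 * L)" using G by linarith
    moreover have "norm (zeta_reg s) \<le> C * r\<^sup>2" using C(2)[OF s] by (simp add: r_def)
    moreover have "norm (of_real pi powr (- s / 2)) \<le> 1"
    proof -
      have "norm (of_real pi powr (- s / 2)) = pi powr (- Re s / 2)"
        by (subst norm_powr_real_powr) auto
      also have "\<dots> \<le> pi powr 0" using s pi_gt_zero pi_ge_two by (intro powr_mono) auto
      finally show ?thesis by simp
    qed
    ultimately have "norm (xi s) \<le> 1 * (2 * exp (2 * L)) * (C * r\<^sup>2)"
      unfolding xi_def norm_mult by (intro mult_mono) auto
    also have "\<dots> = exp (2 * L) * (2 * C) * r\<^sup>2" by simp
    also have "\<dots> \<le> exp (2 * L) * exp (2 * C * L) * exp (2 * L)"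
    proof (intro mult_mono)
      have "2 * C \<le> 2 * C * L" using \<open>L \<ge> 1\<close> C(1) by simp
      then show "2 * C \<le> exp (2 * C * L)" using exp_ge_add_one_self[of "2 * C * L"] by linarith
      have "r\<^sup>2 = exp (2 * ln r)" using r exp_of_nat_mult[of 2 "ln r"] by simp
      also have "ln r \<le> r - 1" using r by (intro ln_le_minus_one) simp
      then have "exp (2 * ln r) \<le> exp (2 * L)" using rL by simp
      finally show "r\<^sup>2 \<le> exp (2 * L)" .
    qed (use C in auto)
    also have "\<dots> = exp ((2 * C + 4) * L)" by (simp add: algebra_simps flip: exp_add)
    finally show ?thesis by (simp add: L_def r_def)
  qed
  then show thesis using C(1) by (intro that[of "2 * C + 4"]) auto
qed

lemma xi_1: "xi 1 = 1 / 2"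
proof -
  have G: "Gamma (1 / 2 + 1) = (1 / 2 :: complex) * Gamma (1 / 2)"
    by (rule Gamma_plus1) (rule Re_pos_notin_nonpos_Ints, simp)
  have "complex_of_real pi powr (- 1 / 2) = of_real (pi powr (- 1 / 2))"
    using powr_of_real[of pi "-1/2"] by simp
  also have "pi powr (- 1 / 2) = 1 / sqrt pi" by (simp add: powr_minus_divide powr_half_sqrt)
  finally have P: "complex_of_real pi powr (- 1 / 2) * of_real (sqrt pi) = 1" by simp
  have "xi 1 = of_real pi powr (- 1 / 2) * Gamma (1 / 2 + 1)" by (simp add: xi_def zeta_reg_def)
  also have "\<dots> = of_real pi powr (- 1 / 2) * (1 / 2 * of_real (sqrt pi))"
    by (simp only: G Gamma_one_half_complex)
  also have "\<dots> = 1 / 2 * (of_real pi powr (- 1 / 2) * of_real (sqrt pi))"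
    by (rule mult.left_commute)
  finally show ?thesis by (simp only: P mult_1_right)
qed

text \<open>At 16 the Gamma factor is 8!, and the crude bounds pi < 4 and zeta(16) \<ge> 1 suffice:
  15 * 8! = 604800 exceeds 4^8 = 65536.\<close>

lemma norm_xi_16: "norm (xi 16) > 1"
proof -
  obtain z where z: "zeta (of_real 16) = of_real z" "(\<lambda>n. real (Suc n) powr (-16)) sums z"
    using zeta_real_sums[of 16] by auto
  have "(\<Sum>n<1. real (Suc n) powr (-16)) \<le> (\<Sum>n. real (Suc n) powr (-16))"
    by (rule sum_le_suminf) (use z in \<open>auto simp: sums_iff\<close>)
  then have z1: "z \<ge> 1" using z(2) by (simp add: sums_iff)
  have "Gamma (16 / 2 + 1) = (fact 8 :: complex)" using Gamma_fact[of 8, where ?'a = complex] by simp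
  then have "norm (xi 16) = norm (of_real pi powr (- 16 / 2) :: complex) * fact 8 * (15 * z)"
    using z z1 by (simp add: xi_def zeta_reg_def norm_mult)
  also have "norm (of_real pi powr (- 16 / 2) :: complex) = pi powr (-8)"
    by (subst norm_powr_real_powr) auto
  also have "pi powr (-8) = 1 / pi ^ 8" by (simp add: powr_minus_divide powr_numeral)
  finally have e: "norm (xi 16) = 1 / pi ^ 8 * fact 8 * (15 * z)" .
  have "pi ^ 8 \<le> 4 ^ 8" using pi_less_4 by (intro power_mono) auto
  also have "(4::real) ^ 8 < fact 8 * (15 * z)" using z1 by (simp add: fact_numeral)
  finally show ?thesis unfolding e by (simp add: field_simps)
qed

lemma zeta_zero_exists: "\<exists>s. Re s \<ge> 1/2 \<and> zeta_reg s = 0"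
proof (rule ccontr)
  assume "\<not> ?thesis"
  then have nz: "zeta_reg s \<noteq> 0" if "Re s \<ge> 1/2" for s using that by auto
  have xi0: "xi s \<noteq> 0" if "Re s \<ge> 1/2" for s
  proof -
    have "Gamma (s / 2 + 1) \<noteq> 0"
      unfolding Gamma_eq_zero_iff by (rule Re_pos_notin_nonpos_Ints) (use that in simp)
    then show ?thesis using nz[OF that] by (simp add: xi_def)
  qed
  \<comment> \<open>Gluing \<open>xi\<close> to its reflection gives an entire function, although
    the formula for \<open>xi\<close> is only known to be holomorphic for
    \<open>Re s > -2\<close>.\<close>
  define X where "X = (\<lambda>s. if Re s \<ge> 1/2 then xi s else xi (1 - s))"
  have X1: "X s = xi s" if "Re s > -1" for s
    using that xi_functional_equation[of s] by (auto simp: X_def)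
  have X2: "X s = xi (1 - s)" if "Re s < 2" for s
    using that xi_functional_equation[of s] by (auto simp: X_def)
  have "xi \<circ> (\<lambda>s. 1 - s) holomorphic_on {s. Re s < 2}"
    by (rule holomorphic_on_compose_gen[OF _ xi_holomorphic]) (auto intro!: holomorphic_intros)
  then have "X holomorphic_on {s. Re s < 2}"
    by (subst holomorphic_cong[OF refl, of _ X "xi \<circ> (\<lambda>s. 1 - s)"]) (auto simp: X2)
  moreover have "X holomorphic_on {s. Re s > -1}"
    by (subst holomorphic_cong[OF refl, of _ X xi]) (auto simp: X1 intro: holomorphic_on_subset[OF xi_holomorphic])
  ultimately have "X holomorphic_on ({s. Re s < 2} \<union> {s. Re s > -1})"
    by (intro holomorphic_on_Un open_halfspace_Re_gt open_halfspace_Re_lt)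
  also have "{s. Re s < 2} \<union> {s. Re s > -1} = UNIV" by auto
  finally have X: "X holomorphic_on UNIV" .
  have "X s \<noteq> 0" for s using xi0[of s] xi0[of "1 - s"] by (auto simp: X_def)
  then obtain h where h: "h holomorphic_on UNIV" "\<And>s. X s = exp (h s)"
    using contractible_imp_holomorphic_log[OF X contractible_UNIV] by (metis UNIV_I)
  obtain C where C: "C > 0" "\<And>s. Re s \<ge> 1/2 \<Longrightarrow> norm (xi s) \<le> exp (C * (1 + norm s) powr (3/2))"
    using norm_xi_le by blast
  have "Re (h s) \<le> C * (norm s + 2) powr (3/2)" for s
  proof -
    have "norm (X s) \<le> exp (C * (norm s + 2) powr (3/2))"
    proof (cases "Re s \<ge> 1/2")
      case True
      have "(1 + norm s) powr (3/2) \<le> (norm s + 2) powr (3/2)" by (intro powr_mono2) auto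
      then show ?thesis using C(1) C(2)[OF True] True by (auto simp: X_def intro: order_trans)
    next
      case False
      have "(1 + norm (1 - s)) powr (3/2) \<le> (norm s + 2) powr (3/2)"
        using norm_triangle_ineq4[of 1 s] by (intro powr_mono2) auto
      then show ?thesis using C(1) C(2)[of "1 - s"] False by (auto simp: X_def intro: order_trans)
    qed
    then show ?thesis by (simp add: h(2))
  qed
  from entire_Re_growth_imp_affine[OF h(1) this] have aff: "h s = h 0 + deriv h 0 * s" for s .
  have "exp (h 0) = exp (h 1)" using X2[of 0] X1[of 1] by (simp flip: h(2))
  \<comment> \<open>The values h(0) and h(1) are only known to agree modulo 2 pi i, so the slope
    need not vanish; but its exponential is 1, and so are the integer powers of it.\<close>
  then have e1: "exp (deriv h 0) = 1" using aff[of 1] by (simp add: exp_add)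
  have "xi 16 = exp (h 16)" using X1[of 16] by (simp flip: h(2))
  also have "\<dots> = exp (h 0) * exp (deriv h 0) ^ 16"
    using aff[of 16] exp_of_nat_mult[of 16 "deriv h 0"] by (simp add: exp_add mult.commute)
  also have "\<dots> = exp (h 1)" using e1 \<open>exp (h 0) = exp (h 1)\<close> by simp
  also have "\<dots> = xi 1" using X1[of 1] by (simp flip: h(2))
  finally have "xi 16 = 1 / 2" by (simp only: xi_1)
  then have "norm (xi 16) = 1 / 2" by (simp only: norm_divide) simp
  then show False using norm_xi_16 by simp
qed

lemma Lp_norm_2_mertens_g1: "Lp_norm 2 mertens_g1 = \<infinity>"
  using zeta_zero_exists zeta_nonzero_of_L2 by (metis infinity_ennreal_def less_top)

section \<open>The growth of \<open>1/\<zeta>\<close> under the Riemann hypothesis\<close>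

text \<open>A substitute for the three circles theorem: the first Taylor coefficients are estimated on the
  small circle, the others on the large one.\<close>
lemma power_series_split_bound:
  fixes r \<rho> R R' M \<epsilon> :: real
  assumes r: "0 < r" "r < R'" and \<rho>: "0 \<le> \<rho>" "\<rho> < R" "R < R'" and \<epsilon>: "\<epsilon> > 0"
  obtains c where "\<And>f A w. f holomorphic_on ball 0 R' \<Longrightarrow> (\<And>z. norm z = r \<Longrightarrow> norm (f z) \<le> M) \<Longrightarrow>
      (\<And>z. norm z = R \<Longrightarrow> norm (f z) \<le> A) \<Longrightarrow> norm w \<le> \<rho> \<Longrightarrow> norm (f w) \<le> c + \<epsilon> * A"
proof -
  define q where "q = \<rho> / R"
  have q: "0 \<le> q" "q < 1" using \<rho> by (auto simp: q_def)
  \<comment> \<open>The cut K between the two groups of coefficients depends on q and \<epsilon>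
    alone. Hence c is the same for all f and A, which allows f to vary with the height later
    on.\<close>
  have "(\<lambda>K. q ^ K / (1 - q)) \<longlonglongrightarrow> 0 / (1 - q)"
    using q by (intro tendsto_intros LIMSEQ_realpow_zero) auto
  then have "\<forall>\<^sub>F K in sequentially. q ^ K / (1 - q) < \<epsilon>"
    using \<epsilon> by (intro order_tendstoD) auto
  then obtain K where K: "q ^ K / (1 - q) < \<epsilon>" by (auto simp: eventually_sequentially)
  define c where "c = (\<Sum>k<K. M * (\<rho> / r) ^ k)"
  show thesis
  proof (rule that)
    fix f A and w :: complex
    assume f: "f holomorphic_on ball 0 R'" and M: "\<And>z. norm z = r \<Longrightarrow> norm (f z) \<le> M"
      and A: "\<And>z. norm z = R \<Longrightarrow> norm (f z) \<le> A" and w: "norm w \<le> \<rho>"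
    have R0: "R > 0" using \<rho> by linarith
    define a where "a = (\<lambda>k. (deriv ^^ k) f 0 / fact k)"
    have coeff: "norm (a k) \<le> B / s ^ k" if "0 < s" "s < R'" "\<And>z. norm z = s \<Longrightarrow> norm (f z) \<le> B" for s B k
    proof -
      have "norm ((deriv ^^ k) f 0) \<le> fact k * B / s ^ k"
      proof (rule Cauchy_inequality)
        show "f holomorphic_on ball 0 s" using f by (rule holomorphic_on_subset) (use that in auto)
        show "continuous_on (cball 0 s) f"
          using holomorphic_on_imp_continuous_on[OF f] by (rule continuous_on_subset) (use that in auto)
      qed (use that in auto)
      then show ?thesis by (simp add: a_def norm_divide field_simps)
    qed
    have "norm (f (of_real R)) \<le> A" by (rule A) (use R0 in simp)
    then have A0: "A \<ge> 0" using norm_ge_zero order_trans by blast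
    have "norm (f (of_real r)) \<le> M" by (rule M) (use r in simp)
    then have M0: "M \<ge> 0" using norm_ge_zero order_trans by blast
    have b1: "norm (a k * w ^ k) \<le> M * (\<rho> / r) ^ k" for k
    proof -
      have "norm (a k * w ^ k) \<le> M / r ^ k * \<rho> ^ k"
        unfolding norm_mult norm_power using coeff[OF r M] w M0 r by (intro mult_mono power_mono) auto
      then show ?thesis by (simp add: power_divide)
    qed
    have b2: "norm (a k * w ^ k) \<le> A * q ^ k" for k
    proof -
      have "norm (a k * w ^ k) \<le> A / R ^ k * \<rho> ^ k"
        unfolding norm_mult norm_power using coeff[OF R0 \<rho>(3) A] w A0 R0 by (intro mult_mono power_mono) auto
      then show ?thesis by (simp add: power_divide q_def)
    qed
    have "(\<lambda>k. a k * (w - 0) ^ k) sums f w" unfolding a_def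
      by (rule holomorphic_power_series[OF f]) (use w \<rho> in simp)
    then have s: "(\<lambda>k. a k * w ^ k) sums f w" by simp
    have t: "(\<lambda>k. a (k + K) * w ^ (k + K)) sums (f w - (\<Sum>k<K. a k * w ^ k))"
      using sums_split_initial_segment[OF s] .
    have g: "(\<lambda>k. A * q ^ (k + K)) sums (A * (q ^ K * (1 / (1 - q))))"
      using sums_mult[OF sums_mult[OF geometric_sums[of q], of "q ^ K"], of A] q
      by (simp add: power_add mult_ac)
    have "norm (f w - (\<Sum>k<K. a k * w ^ k)) \<le> A * (q ^ K * (1 / (1 - q)))"
      using norm_suminf_le[of "\<lambda>k. a (k + K) * w ^ (k + K)" "\<lambda>k. A * q ^ (k + K)"] b2 t g
      by (simp add: sums_iff)
    also have "\<dots> \<le> A * \<epsilon>" using K A0 by (intro mult_left_mono) auto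
    finally have "norm (f w - (\<Sum>k<K. a k * w ^ k)) \<le> \<epsilon> * A" by (simp add: mult.commute)
    moreover have "norm (\<Sum>k<K. a k * w ^ k) \<le> c" unfolding c_def by (rule sum_norm_le) (rule b1)
    ultimately show "norm (f w) \<le> c + \<epsilon> * A"
      using norm_triangle_ineq[of "f w - (\<Sum>k<K. a k * w ^ k)" "\<Sum>k<K. a k * w ^ k"] by simp
  qed
qed

text \<open>Both series are dominated by the one at 5/4. The abscissa is 2 - 3/4: discs of radius
  3/4 around points 2 + it stay in this region.\<close>

lemma zeta_bounds_Re_ge_5_4:
  obtains B where "B \<ge> 1" "\<And>s. Re s \<ge> 5/4 \<Longrightarrow> norm (zeta s) \<le> B" "\<And>s. Re s \<ge> 5/4 \<Longrightarrow> norm (1 / zeta s) \<le> B"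
proof -
  define B where "B = (\<Sum>\<^sub>\<infinity>n\<in>{0<..}. real n powr (-(5/4)))"
  have sB: "(\<lambda>n. real n powr (-(5/4))) summable_on {0<..}" by (rule summable_on_nat_powr) simp
  have bd: "norm S \<le> B" if a: "\<And>n. norm (a n :: complex) \<le> 1" and s: "Re s \<ge> 5/4"
    and S: "((\<lambda>n. a n * of_nat n powr (-s)) has_sum S) {0<..}" for a :: "nat \<Rightarrow> complex" and s S
  proof -
    have le: "norm (a n * of_nat n powr (-s)) \<le> real n powr (-(5/4))" if "n \<in> {0<..}" for n
    proof -
      have "norm (a n * of_nat n powr (-s)) = norm (a n) * real n powr (- Re s)"
        using that by (simp add: norm_mult norm_powr_real_powr)
      also have "\<dots> \<le> 1 * real n powr (-(5/4))"
        using a s that by (intro mult_mono powr_mono) auto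
      finally show ?thesis by simp
    qed
    have sm: "(\<lambda>n. norm (a n * of_nat n powr (-s))) summable_on {0<..}"
      by (rule summable_on_comparison_test[OF sB le]) auto
    have "norm S \<le> (\<Sum>\<^sub>\<infinity>n\<in>{0<..}. norm (a n * of_nat n powr (-s)))"
      using norm_infsum_bound[OF sm] infsumI[OF S] by simp
    also have "\<dots> \<le> B" unfolding B_def by (rule infsum_mono[OF sm sB le])
    finally show ?thesis .
  qed
  have 1: "norm (zeta s) \<le> B" if "Re s \<ge> 5/4" for s
    using bd[of "\<lambda>_. 1" s "zeta s"] zeta_has_sum[of s] that by simp
  have 2: "norm (1 / zeta s) \<le> B" if "Re s \<ge> 5/4" for s
    using bd[of "\<lambda>n. of_int (moebius n)" s "1 / zeta s"] moebius_has_sum[of s] norm_moebius_le that by simp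
  have "B \<ge> 1"
  proof (rule ccontr)
    assume "\<not> B \<ge> 1"
    moreover have "zeta 2 \<noteq> 0" by (rule zeta_nonzero_Re_gt_1) simp
    then have "norm (zeta 2) * norm (1 / zeta 2) = 1" by (simp add: norm_divide)
    moreover have "norm (zeta 2) * norm (1 / zeta 2) \<le> B * B"
      using 1[of 2] 2[of 2] by (intro mult_mono) (auto intro: order_trans[OF norm_ge_zero])
    moreover have "0 \<le> B" using order_trans[OF norm_ge_zero 1[of 2]] by simp
    ultimately show False using mult_strict_mono[of B 1 B 1] by simp
  qed
  then show thesis using that 1 2 by blast
qed

text \<open>The quotient is 1/zeta, with value 0 at s = 1. Around 2 + it the logarithm of zeta
  exists on a disc of radius 3/2; it is bounded near the centre and O(ln T) further out, and the
  split of its power series lowers this to c + \<epsilon> ln T on the discs that reach s.\<close>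

lemma inverse_zeta_bound:
  assumes nz: "\<And>s. Re s > 1/2 \<Longrightarrow> zeta_reg s \<noteq> 0" and \<delta>: "0 < \<delta>" "\<delta> < 1/2" and \<epsilon>: "\<epsilon> > 0"
  obtains C where "C > 0" "\<And>s. 1/2 + \<delta> \<le> Re s \<Longrightarrow> Re s \<le> 1 \<Longrightarrow> norm ((s - 1) / zeta_reg s) \<le> C * (1 + \<bar>Im s\<bar>) powr \<epsilon>"
proof -
  obtain C0 where C0: "C0 > 0" "\<And>s. Re s \<ge> 1/2 \<Longrightarrow> norm (zeta_reg s) \<le> C0 * (1 + norm s)\<^sup>2"
    using zeta_reg_bound by blast
  obtain B where B: "B \<ge> 1" "\<And>s. Re s \<ge> 5/4 \<Longrightarrow> norm (zeta s) \<le> B" "\<And>s. Re s \<ge> 5/4 \<Longrightarrow> norm (1 / zeta s) \<le> B"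
    using zeta_bounds_Re_ge_5_4 by blast
  \<comment> \<open>Radius \<rho> around 2 + it reaches the line
    \<open>Re s = 1/2 + \<delta>\<close>, radius 3/2 the critical line. R lies midway and leaves the
    gap \<delta>/2 for the Borel-Caratheodory inequality.\<close>
  define \<rho> R where "\<rho> = 3/2 - \<delta>" and "R = 3/2 - \<delta> / 2"
  define m where "m = 2 * ln (B * B) + 2"
  define M where "M = 2 * m"
  \<comment> \<open>Chosen so that the term 2 ln T of A, multiplied by 2 (3/2) / (\<delta>/2) =
    6/\<delta>, contributes exactly \<epsilon> ln T.\<close>
  define \<epsilon>' where "\<epsilon>' = \<epsilon> * \<delta> / 12"
  have \<epsilon>': "\<epsilon>' > 0" using \<epsilon> \<delta> by (simp add: \<epsilon>'_def)
  have m: "m > 0" "ln (B * B) < m" using B(1) by (auto simp: m_def add_nonneg_pos ln_mult)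
  obtain c where c: "\<And>f A w. f holomorphic_on ball 0 (3/2) \<Longrightarrow> (\<And>z. norm z = 1/2 \<Longrightarrow> norm (f z) \<le> 2 * m * (1/2) / (3/4 - 1/2)) \<Longrightarrow>
      (\<And>z. norm z = R \<Longrightarrow> norm (f z) \<le> A) \<Longrightarrow> norm w \<le> \<rho> \<Longrightarrow> norm (f w) \<le> c + \<epsilon>' * A"
    using power_series_split_bound[of "1/2" "3/2" \<rho> R \<epsilon>' "2 * m * (1/2) / (3/4 - 1/2)"] \<epsilon>' \<delta> by (auto simp: \<rho>_def R_def)
  define a0 where "a0 = \<bar>ln (C0 * B)\<bar> + 1"
  define C1 where "C1 = B * exp (c + \<epsilon>' * (2 * a0 * (3/2) / (\<delta> / 2))) * 5 powr \<epsilon>"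
  have large: "norm ((s - 1) / zeta_reg s) \<le> C1 * (1 + \<bar>Im s\<bar>) powr \<epsilon>"
    if s: "1/2 + \<delta> \<le> Re s" "Re s \<le> 1" and t3: "\<bar>Im s\<bar> \<ge> 3" for s
  proof -
    define t where "t = Im s"
    define z0 where "z0 = Complex 2 t"
    \<comment> \<open>Bounds 1 + |z0 + w| \<le> 1 + (2 + |t|) + 3/2 on the whole disc.\<close>
    define T where "T = 5 + \<bar>t\<bar>"
    have T: "T \<ge> 5" by (simp add: T_def)
    have w1: "Re (z0 + w) > 1/2" "z0 + w \<noteq> 1" "norm (z0 + w - 1) \<ge> 1" "1 + norm (z0 + w) \<le> T" if "norm w < 3/2" for w
    proof -
      have "\<bar>Re w\<bar> < 3/2" "\<bar>Im w\<bar> < 3/2" using that abs_Re_le_cmod[of w] abs_Im_le_cmod[of w] by linarith+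
      then show "Re (z0 + w) > 1/2" by (simp add: z0_def)
      have "\<bar>Im (z0 + w - 1)\<bar> \<ge> 1" using \<open>\<bar>Im w\<bar> < 3/2\<close> t3 by (simp add: z0_def t_def)
      then show 1: "norm (z0 + w - 1) \<ge> 1" using abs_Im_le_cmod[of "z0 + w - 1"] by linarith
      then show "z0 + w \<noteq> 1" by auto
      have "norm z0 \<le> 2 + \<bar>t\<bar>" using cmod_le[of z0] by (simp add: z0_def)
      then show "1 + norm (z0 + w) \<le> T" using norm_triangle_ineq[of z0 w] that by (simp add: T_def)
    qed
    define Z where "Z = (\<lambda>w. zeta (z0 + w))"
    have Znz: "Z w \<noteq> 0" if "w \<in> ball 0 (3/2)" for w
      using w1[of w] nz[of "z0 + w"] that by (auto simp: Z_def zeta_reg_def)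
    have "zeta \<circ> (\<lambda>w. z0 + w) holomorphic_on ball 0 (3/2)"
    proof (rule holomorphic_on_compose_gen[OF _ zeta_holomorphic])
      show "(+) z0 ` ball 0 (3/2) \<subseteq> - {1}" using w1(2) by (intro image_subsetI) simp
    qed (intro holomorphic_intros)
    then have Zh: "Z holomorphic_on ball 0 (3/2)" by (simp add: Z_def o_def)
    obtain L where L: "L holomorphic_on ball 0 (3/2)" "\<And>w. w \<in> ball 0 (3/2) \<Longrightarrow> Z w = exp (L w)"
      using contractible_imp_holomorphic_log[OF Zh convex_imp_contractible[OF convex_ball] Znz] by blast
    define f where "f = (\<lambda>w. L w - L 0)"
    have fh: "f holomorphic_on ball 0 (3/2)" unfolding f_def by (intro holomorphic_intros L)
    have f0: "f 0 = 0" by (simp add: f_def)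
    have expf: "exp (f w) = Z w / Z 0" if "w \<in> ball 0 (3/2)" for w
      using L(2)[OF that] L(2)[of 0] by (simp add: f_def exp_diff)
    have Ref: "exp (Re (f w)) = norm (Z w) * norm (1 / Z 0)" if "w \<in> ball 0 (3/2)" for w
      using arg_cong[OF expf[OF that], of norm] by (simp add: norm_divide)
    have Z0: "norm (1 / Z 0) \<le> B" unfolding Z_def by (rule B(3)) (simp add: z0_def)
    \<comment> \<open>On radius 3/4 the argument stays in \<open>Re \<ge> 5/4\<close>, where zeta
      and 1/zeta are bounded uniformly in t.\<close>
    have small: "norm (f z) \<le> 2 * m * (1/2) / (3/4 - 1/2)" if z: "norm z = 1/2" for z
    proof -
      have "norm (f z) \<le> 2 * m * norm z / (3/4 - norm z)"
      proof (rule borel_caratheodory)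
        show "f holomorphic_on ball 0 (3/4)" using fh by (rule holomorphic_on_subset) auto
        fix w :: complex assume w: "w \<in> ball 0 (3/4)"
        then have "Re (z0 + w) \<ge> 5/4" using abs_Re_le_cmod[of w] by (simp add: z0_def)
        then have "exp (Re (f w)) \<le> B * B"
          using w Ref[of w] B(2)[of "z0 + w"] Z0 by (auto simp: Z_def intro!: mult_mono order_trans[OF norm_ge_zero Z0])
        then have "Re (f w) \<le> ln (B * B)" using ln_le_cancel_iff[of "exp (Re (f w))" "B * B"] B(1) by simp
        then show "Re (f w) < m" using m by linarith
      qed (use f0 m z in auto)
      then show ?thesis using z by simp
    qed
    define A where "A = a0 + 2 * ln T"
    have A: "A > 0" using T by (simp add: A_def a0_def add_pos_nonneg)
    have ReA: "Re (f w) < A" if w: "w \<in> ball 0 (3/2)" for w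
    proof -
      have nw: "norm w < 3/2" using w by simp
      have "norm (Z w) = norm (zeta_reg (z0 + w)) / norm (z0 + w - 1)"
        using w1[OF nw] by (simp add: Z_def zeta_reg_def norm_mult)
      also have "\<dots> \<le> norm (zeta_reg (z0 + w)) / 1"
        using w1[OF nw] by (intro divide_left_mono) auto
      also have "\<dots> \<le> C0 * (1 + norm (z0 + w))\<^sup>2" using C0(2)[of "z0 + w"] w1(1)[OF nw] by simp
      also have "\<dots> \<le> C0 * T\<^sup>2" using w1(4)[OF nw] C0(1) by (intro mult_left_mono power_mono) auto
      finally have "exp (Re (f w)) \<le> (C0 * T\<^sup>2) * B"
        unfolding Ref[OF w] using Z0 C0(1) by (intro mult_mono) auto
      then have "Re (f w) \<le> ln ((C0 * T\<^sup>2) * B)"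
        using ln_le_cancel_iff[of "exp (Re (f w))" "(C0 * T\<^sup>2) * B"] B(1) C0(1) T by simp
      also have "\<dots> = ln (C0 * B) + 2 * ln T" using B(1) C0(1) T by (simp add: ln_mult ln_realpow)
      also have "\<dots> < A" by (simp add: A_def a0_def)
      finally show ?thesis .
    qed
    \<comment> \<open>Only the polynomial bound for zeta is available here, so A is of size ln
      T.\<close>
    have big: "norm (f z) \<le> 2 * A * (3/2) / (\<delta> / 2)" if z: "norm z = R" for z
    proof -
      have "norm (f z) \<le> 2 * A * norm z / (3/2 - norm z)"
        by (rule borel_caratheodory) (use fh f0 A ReA z \<delta> in \<open>auto simp: R_def\<close>)
      also have "\<dots> \<le> 2 * A * (3/2) / (\<delta> / 2)"
        using A z \<delta> by (intro frac_le mult_left_mono) (auto simp: R_def)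
      finally show ?thesis .
    qed
    define w where "w = s - z0"
    have w: "w = of_real (Re s - 2)" by (simp add: w_def z0_def t_def complex_eq_iff)
    have nw: "norm w \<le> \<rho>" using s \<delta> unfolding w norm_of_real by (simp add: \<rho>_def)
    have wb: "w \<in> ball 0 (3/2)" using nw \<delta> by (simp add: \<rho>_def)
    have "norm (f w) \<le> c + \<epsilon>' * (2 * A * (3/2) / (\<delta> / 2))"
      by (rule c[OF fh small big nw])
    also have "\<dots> = c + \<epsilon>' * (2 * a0 * (3/2) / (\<delta> / 2)) + \<epsilon> * ln T"
      using \<delta> by (simp add: A_def \<epsilon>'_def field_simps)
    finally have nf: "norm (f w) \<le> c + \<epsilon>' * (2 * a0 * (3/2) / (\<delta> / 2)) + \<epsilon> * ln T" .
    have sw: "z0 + w = s" by (simp add: w_def)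
    have "s \<noteq> 1" using t3 by auto
    then have "norm ((s - 1) / zeta_reg s) = norm (1 / Z w)"
      using sw by (simp add: Z_def zeta_reg_def)
    also have "1 / Z w = 1 / Z 0 * exp (- f w)"
      using expf[OF wb] Znz[OF wb] Znz[of 0] by (simp add: exp_minus field_simps)
    also have "norm \<dots> = norm (1 / Z 0) * exp (- Re (f w))" by (simp only: norm_mult norm_exp_eq_Re) simp
    also have "\<dots> \<le> B * exp (c + \<epsilon>' * (2 * a0 * (3/2) / (\<delta> / 2)) + \<epsilon> * ln T)"
      using Z0 B(1) nf abs_Re_le_cmod[of "f w"] by (intro mult_mono) auto
    also have "\<dots> = B * exp (c + \<epsilon>' * (2 * a0 * (3/2) / (\<delta> / 2))) * T powr \<epsilon>"
      using T by (simp add: exp_add powr_def)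
    also have "T powr \<epsilon> \<le> (5 * (1 + \<bar>t\<bar>)) powr \<epsilon>" using \<epsilon> by (intro powr_mono2) (auto simp: T_def)
    also have "(5 * (1 + \<bar>t\<bar>)) powr \<epsilon> = 5 powr \<epsilon> * (1 + \<bar>t\<bar>) powr \<epsilon>" by (rule powr_mult)
    finally show ?thesis using B(1) by (simp add: C1_def t_def mult_left_mono mult.assoc)
  qed
  \<comment> \<open>The discs avoid the pole only at heights at least 3; the rest of the strip is
    compact.\<close>
  define D where "D = cbox (Complex (1/2 + \<delta>) (-3)) (Complex 1 3)"
  have "continuous_on D (\<lambda>s. (s - 1) / zeta_reg s)"
    using \<delta> by (intro continuous_intros holomorphic_on_imp_continuous_on[OF zeta_reg_holomorphic] ballI nz)
      (auto simp: D_def in_cbox_complex_iff)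
  then have "bounded ((\<lambda>s. (s - 1) / zeta_reg s) ` D)"
    by (intro compact_imp_bounded compact_continuous_image) (auto simp: D_def)
  then obtain C2 where C2: "C2 > 0" "\<And>s. s \<in> D \<Longrightarrow> norm ((s - 1) / zeta_reg s) \<le> C2"
    by (auto simp: bounded_pos)
  have C1: "C1 > 0" unfolding C1_def using B(1) by (intro mult_pos_pos) auto
  show thesis
  proof (rule that[of "C1 + C2"])
    fix s :: complex assume s: "1/2 + \<delta> \<le> Re s" "Re s \<le> 1"
    have p: "1 \<le> (1 + \<bar>Im s\<bar>) powr \<epsilon>" using \<epsilon> by (intro ge_one_powr_ge_zero) auto
    show "norm ((s - 1) / zeta_reg s) \<le> (C1 + C2) * (1 + \<bar>Im s\<bar>) powr \<epsilon>"
    proof (cases "\<bar>Im s\<bar> \<ge> 3")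
      case True
      from large[OF s True] show ?thesis using C2(1) by (simp add: distrib_right add_increasing2)
    next
      case False
      then have "s \<in> D" using s by (auto simp: D_def in_cbox_complex_iff)
      then have "norm ((s - 1) / zeta_reg s) \<le> C2 * 1" using C2(2) by simp
      also have "\<dots> \<le> C2 * (1 + \<bar>Im s\<bar>) powr \<epsilon>" using p C2(1) by (intro mult_left_mono) auto
      finally show ?thesis using C1 by (simp add: distrib_right add_increasing)
    qed
  qed (use C1 C2 in auto)
qed

section \<open>Newman's contour argument\<close>

lemma powr_Suc_diff:
  assumes "n \<ge> 1"
  obtains \<xi> where "real n < \<xi>" "\<xi> < real (Suc n)" "real (Suc n) powr e - real n powr e = e * \<xi> powr (e - 1)"
proof -
  have "((\<lambda>x. x powr e) has_real_derivative e * x powr (e - 1)) (at x)" if "real n \<le> x" for x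
    using that assms by (auto intro!: derivative_eq_intros)
  then have "\<exists>z>real n. z < real (Suc n) \<and> real (Suc n) powr e - real n powr e = (real (Suc n) - real n) * (e * z powr (e - 1))"
    by (intro MVT2) auto
  then show thesis using that by auto
qed

lemma sum_powr_tail_le:
  fixes x :: real
  assumes x: "x > 0" and N: "N \<ge> 1" "N \<le> M"
  shows "(\<Sum>n\<in>{N<..M}. real n powr (-1 - x)) \<le> real N powr (-x) / x"
proof -
  have "(\<Sum>n\<in>{N<..M}. real n powr (-1 - x)) \<le> (real N powr (-x) - real M powr (-x)) / x"
    using N(2)
  proof (induction M rule: dec_induct)
    case (step M)
    obtain \<xi> where \<xi>: "real M < \<xi>" "\<xi> < real (Suc M)" "real (Suc M) powr (-x) - real M powr (-x) = -x * \<xi> powr (-x - 1)"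
      using powr_Suc_diff[of M "-x"] step N by auto
    have e: "-1 - x = -x - 1" by simp
    have "real (Suc M) powr (-1 - x) \<le> \<xi> powr (-x - 1)"
      unfolding e by (rule powr_mono2') (use \<xi> x step N in auto)
    also have "\<dots> = (real M powr (-x) - real (Suc M) powr (-x)) / x" using \<xi>(3) x by (simp add: field_simps)
    finally have "real (Suc M) powr (-1 - x) \<le> (real M powr (-x) - real (Suc M) powr (-x)) / x" .
    moreover have "{N<..Suc M} = insert (Suc M) {N<..M}" using step by auto
    ultimately show ?case using step.IH by (simp add: diff_divide_distrib)
  qed simp
  also have "\<dots> \<le> real N powr (-x) / x" using x by (intro divide_right_mono) auto
  finally show ?thesis .
qed

text \<open>The telescoping differences are controlled by the mean value theorem. For y < 1 the
  summand decreases and N^y / y suffices; for y \<ge> 1 it increases, the comparison shifts by one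
  index and the last term is left over.\<close>

lemma sum_powr_head_le:
  fixes y :: real
  assumes y: "y > 0" and N: "N \<ge> 1"
  shows "(\<Sum>n=1..N. real n powr (y - 1)) \<le> real N powr y / y + real N powr (y - 1)"
proof (cases "y \<ge> 1")
  case True
  show ?thesis using N
  proof (induction N rule: dec_induct)
    case base
    then show ?case using y by simp
  next
    case (step M)
    obtain \<xi> where \<xi>: "real M < \<xi>" "\<xi> < real (Suc M)" "real (Suc M) powr y - real M powr y = y * \<xi> powr (y - 1)"
      using powr_Suc_diff[of M y] step by auto
    have "real M powr (y - 1) \<le> \<xi> powr (y - 1)" using \<xi> True by (intro powr_mono2) auto
    also have "\<dots> = (real (Suc M) powr y - real M powr y) / y" using \<xi>(3) y by simp
    finally show ?case using step.IH by (simp add: diff_divide_distrib)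
  qed
next
  case False
  have "(\<Sum>n=1..N. real n powr (y - 1)) \<le> real N powr y / y" using N
  proof (induction N rule: dec_induct)
    case base
    then show ?case using y False by simp
  next
    case (step M)
    obtain \<xi> where \<xi>: "real M < \<xi>" "\<xi> < real (Suc M)" "real (Suc M) powr y - real M powr y = y * \<xi> powr (y - 1)"
      using powr_Suc_diff[of M y] step by auto
    have "real (Suc M) powr (y - 1) \<le> \<xi> powr (y - 1)" using \<xi> False step by (intro powr_mono2') auto
    also have "\<dots> = (real (Suc M) powr y - real M powr y) / y" using \<xi>(3) y by simp
    finally show ?case using step.IH by (simp add: diff_divide_distrib)
  qed
  then show ?thesis by (simp add: add_increasing2)
qed

definition moebius_sum :: "nat \<Rightarrow> complex \<Rightarrow> complex" where
  "moebius_sum N s = (\<Sum>n=1..N. of_int (moebius n) * of_nat n powr (-s))"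

lemma norm_moebius_powr_le: "n \<ge> 1 \<Longrightarrow> norm (of_int (moebius n) * of_nat n powr (-s) :: complex) \<le> real n powr (- Re s)"
  using norm_moebius_le[of n, where ?'a = complex] mult_right_mono[of "norm (of_int (moebius n) :: complex)" 1 "real n powr (- Re s)"]
  by (simp add: norm_mult norm_powr_real_powr)

lemma moebius_sum_tail:
  assumes "Re s > 1" "N \<ge> 1"
  shows "norm (1 / zeta s - moebius_sum N s) \<le> real N powr (1 - Re s) / (Re s - 1)"
proof -
  have "((\<lambda>n. of_int (moebius (Suc n)) * of_nat (Suc n) powr (-s)) has_sum (1 / zeta s)) UNIV"
    using moebius_has_sum[OF assms(1)] by (rule has_sum_Suc_iff[THEN iffD2])
  then have "(\<lambda>n. of_int (moebius (Suc n)) * of_nat (Suc n) powr (-s)) sums (1 / zeta s)"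
    by (rule has_sum_imp_sums)
  moreover have "(\<Sum>n<M. of_int (moebius (Suc n)) * of_nat (Suc n) powr (-s)) = moebius_sum M s" for M
    unfolding moebius_sum_def by (rule sum.reindex_bij_witness[of _ "\<lambda>n. n - 1" Suc]) auto
  ultimately have lim: "(\<lambda>M. moebius_sum M s) \<longlonglongrightarrow> 1 / zeta s" by (simp add: sums_def)
  have "norm (moebius_sum M s - moebius_sum N s) \<le> real N powr (1 - Re s) / (Re s - 1)" if "M \<ge> N" for M
  proof -
    have e: "{1..M} = {1..N} \<union> {N<..M}" "{1..N} \<inter> {N<..M} = {}" using that assms by auto
    have "moebius_sum M s - moebius_sum N s = (\<Sum>n\<in>{N<..M}. of_int (moebius n) * of_nat n powr (-s))"
      unfolding moebius_sum_def e(1) using e(2) by (subst sum.union_disjoint) auto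
    also have "norm \<dots> \<le> (\<Sum>n\<in>{N<..M}. real n powr (-1 - (Re s - 1)))"
      by (rule sum_norm_le) (use norm_moebius_powr_le[of _ s] in auto)
    also have "\<dots> \<le> real N powr (- (Re s - 1)) / (Re s - 1)"
      by (rule sum_powr_tail_le) (use assms that in auto)
    finally show ?thesis by simp
  qed
  then have "\<forall>\<^sub>F M in sequentially. norm (moebius_sum M s - moebius_sum N s) \<le> real N powr (1 - Re s) / (Re s - 1)"
    by (auto simp: eventually_sequentially)
  then show ?thesis
    by (rule tendsto_upperbound[OF tendsto_norm[OF tendsto_diff[OF lim tendsto_const]]]) simp
qed

text \<open>Partial sums are entire, so to the left of \<open>Re s = 1\<close> the trivial estimate
  replaces the tail estimate. With s = 1 + z, both become about 1/|Re z| after multiplication by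
  N^z.\<close>

lemma moebius_sum_head:
  assumes "Re s < 1" "N \<ge> 1"
  shows "norm (moebius_sum N s) \<le> real N powr (1 - Re s) / (1 - Re s) + real N powr (- Re s)"
proof -
  have "norm (moebius_sum N s) \<le> (\<Sum>n=1..N. real n powr ((1 - Re s) - 1))"
    unfolding moebius_sum_def by (rule sum_norm_le) (use norm_moebius_powr_le[of _ s] in auto)
  also have "\<dots> \<le> real N powr (1 - Re s) / (1 - Re s) + real N powr ((1 - Re s) - 1)"
    by (rule sum_powr_head_le) (use assms in auto)
  finally show ?thesis by simp
qed

text \<open>The horizontal sides are cut at the imaginary axis, so that two rectangles with the same
  right half can be compared piece by piece.\<close>

lemma rectangle_cauchy:
  fixes \<phi> :: "complex \<Rightarrow> complex" and b X T :: real
  assumes S: "convex S" "open S" and \<phi>: "\<phi> holomorphic_on S" and pos: "b > 0" "X > 0" "T > 0"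
    and sub: "cbox (Complex (-b) (-T)) (Complex X T) \<subseteq> S"
  defines "I \<equiv> \<lambda>A B. contour_integral (linepath A B) (\<lambda>z. \<phi> z / z)"
  shows "I (Complex 0 (-T)) (Complex X (-T)) + I (Complex X (-T)) (Complex X T) + I (Complex X T) (Complex 0 T)
     + (I (Complex 0 T) (Complex (-b) T) + I (Complex (-b) T) (Complex (-b) (-T)) + I (Complex (-b) (-T)) (Complex 0 (-T)))
     = 2 * pi * \<i> * \<phi> 0"
proof -
  let ?P = "Complex 0 (-T)" and ?Q = "Complex X (-T)" and ?U = "Complex X T" and ?V = "Complex 0 T"
    and ?W = "Complex (-b) T" and ?Y = "Complex (-b) (-T)"
  have box: "0 \<in> box ?Y ?U" using pos by (simp add: in_box_complex_iff)
  have cont: "continuous_on (closed_segment A B) (\<lambda>z. \<phi> z / z)"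
    if "A \<in> cbox ?Y ?U" "B \<in> cbox ?Y ?U" "0 \<notin> closed_segment A B" for A B
  proof -
    have "closed_segment A B \<subseteq> cbox ?Y ?U" using that by (intro closed_segment_subset) auto
    then show ?thesis using that sub
      by (intro continuous_intros continuous_on_subset[OF holomorphic_on_imp_continuous_on[OF \<phi>]]) auto
  qed
  have c: "continuous_on (closed_segment ?Y ?Q) (\<lambda>z. \<phi> z / z)" "continuous_on (closed_segment ?Q ?U) (\<lambda>z. \<phi> z / z)"
    "continuous_on (closed_segment ?U ?W) (\<lambda>z. \<phi> z / z)" "continuous_on (closed_segment ?W ?Y) (\<lambda>z. \<phi> z / z)"
    by (rule cont; use pos in \<open>simp add: in_cbox_complex_iff closed_segment_same_Re closed_segment_same_Im\<close>)+
  note i = c[THEN contour_integrable_continuous_linepath]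
  have "((\<lambda>w. \<phi> w / (w - 0)) has_contour_integral (2 * pi * \<i> * winding_number (rectpath ?Y ?U) 0 * \<phi> 0)) (rectpath ?Y ?U)"
  proof (rule Cauchy_integral_formula_convex_simple[OF S(1) \<phi>])
    show "0 \<in> interior S" using box_subset_cbox[of ?Y ?U] box sub S(2) by (auto simp: interior_open)
    show "path_image (rectpath ?Y ?U) \<subseteq> S - {0}"
      using path_image_rectpath_cbox_minus_box[of ?Y ?U] box sub pos by auto
  qed auto
  then have "contour_integral (rectpath ?Y ?U) (\<lambda>z. \<phi> z / z) = 2 * pi * \<i> * \<phi> 0"
    using winding_number_rectpath[OF box] by (simp add: contour_integral_unique)
  also have "contour_integral (rectpath ?Y ?U) (\<lambda>z. \<phi> z / z) = I ?Y ?Q + (I ?Q ?U + (I ?U ?W + I ?W ?Y))"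
    unfolding rectpath_def I_def Let_def using i by simp
  also have "I ?Y ?Q = I ?Y ?P + I ?P ?Q" unfolding I_def
    by (rule contour_integral_split_linepath[OF c(1)]) (use pos in \<open>auto simp: closed_segment_same_Im closed_segment_eq_real_ivl\<close>)
  also have "I ?U ?W = I ?U ?V + I ?V ?W" unfolding I_def
    by (rule contour_integral_split_linepath[OF c(3)]) (use pos in \<open>auto simp: closed_segment_same_Im closed_segment_eq_real_ivl\<close>)
  finally show ?thesis by (simp add: algebra_simps)
qed

text \<open>For an integrand decaying like (1 + height)^(\<epsilon> - 1), integration along the
  segment costs (1 + T)^\<epsilon> / \<epsilon> instead of the factor T that a supremum bound would
  give.\<close>

lemma norm_contour_integral_linepath_powr_le:
  assumes h: "continuous_on (closed_segment p (p + v)) h" and T: "norm v = T" "T > 0" and \<epsilon>: "\<epsilon> > 0"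
    and bd: "\<And>x. 0 \<le> x \<Longrightarrow> x \<le> 1 \<Longrightarrow> norm (h (p + of_real x * v)) \<le> K * (1 + T * x) powr (\<epsilon> - 1)"
  shows "norm (contour_integral (linepath p (p + v)) h) \<le> K * (1 + T) powr \<epsilon> / \<epsilon>"
proof -
  have K: "K \<ge> 0" using order_trans[OF norm_ge_zero bd[of 0]] by simp
  have lp: "linepath p (p + v) x = p + of_real x * v" for x
    by (simp add: linepath_def scaleR_conv_of_real algebra_simps)
  have "h contour_integrable_on (linepath p (p + v))" by (rule contour_integrable_continuous_linepath[OF h])
  then have "(h has_contour_integral contour_integral (linepath p (p + v)) h) (linepath p (p + v))"
    by (rule has_contour_integral_integral)
  then have hi: "((\<lambda>x. h (p + of_real x * v) * v) has_integral contour_integral (linepath p (p + v)) h) {0..1}"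
    unfolding has_contour_integral_linepath lp by simp
  have gi: "((\<lambda>x. K * (1 + T * x) powr (\<epsilon> - 1) * T) has_integral (K * (1 + T * 1) powr \<epsilon> / \<epsilon> - K * (1 + T * 0) powr \<epsilon> / \<epsilon>)) {0..1}"
  proof (rule fundamental_theorem_of_calculus)
    fix x :: real assume "x \<in> {0..1}"
    then have "1 + T * x > 0" using T by (intro add_pos_nonneg) auto
    then have "((\<lambda>x. K * (1 + T * x) powr \<epsilon> / \<epsilon>) has_real_derivative K * (1 + T * x) powr (\<epsilon> - 1) * T) (at x within {0..1})"
      using \<epsilon> by (auto intro!: derivative_eq_intros)
    then show "((\<lambda>x. K * (1 + T * x) powr \<epsilon> / \<epsilon>) has_vector_derivative K * (1 + T * x) powr (\<epsilon> - 1) * T) (at x within {0..1})"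
      by (simp add: has_real_derivative_iff_has_vector_derivative)
  qed simp
  have "norm (contour_integral (linepath p (p + v)) h) \<le> K * (1 + T * 1) powr \<epsilon> / \<epsilon> - K * (1 + T * 0) powr \<epsilon> / \<epsilon>"
  proof -
    have "norm (integral {0..1} (\<lambda>x. h (p + of_real x * v) * v)) \<le> integral {0..1} (\<lambda>x. K * (1 + T * x) powr (\<epsilon> - 1) * T)"
      by (rule integral_norm_bound_integral)
         (use hi gi bd T in \<open>auto simp: has_integral_integrable norm_mult intro!: mult_right_mono\<close>)
    then show ?thesis using hi gi by (simp only: integral_unique)
  qed
  also have "\<dots> \<le> K * (1 + T) powr \<epsilon> / \<epsilon>" using K \<epsilon> by simp
  finally show ?thesis .
qed

text \<open>The factor \<open>1 + z\<^sup>2 / T\<^sup>2\<close> vanishes at \<open>\<plusminus>iT\<close>; this compensates the blow-up of the bounds for the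
  Dirichlet series near the imaginary axis on the horizontal sides.\<close>
definition newman_kernel :: "real \<Rightarrow> complex \<Rightarrow> complex" where
  "newman_kernel T z = (1 + z\<^sup>2 / of_real (T\<^sup>2)) / z"

lemma newman_kernel_bound:
  assumes "(norm z)\<^sup>2 \<le> 2 * T\<^sup>2" "T > 0"
  shows "norm (newman_kernel T z) \<le> 3 / norm z"
proof -
  have "norm (1 + z\<^sup>2 / of_real (T\<^sup>2)) \<le> 1 + (norm z)\<^sup>2 / T\<^sup>2"
    using norm_triangle_ineq[of 1 "z\<^sup>2 / of_real (T\<^sup>2)"] by (simp add: norm_divide norm_power)
  also have "\<dots> \<le> 3" using assms by (simp add: field_simps)
  finally show ?thesis unfolding newman_kernel_def norm_divide by (rule divide_right_mono) simp
qed

text \<open>On a horizontal side T^2 = (Im z)^2, so T^2 + z^2 factors as Re z times z + i Im z and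
  the decisive factor Re z appears. On a vertical side |Re z| = T and the general bound 3/|z| is
  enough.\<close>

lemma newman_kernel_boundary:
  assumes T: "\<bar>Re z\<bar> \<le> T" "\<bar>Im z\<bar> \<le> T" "T > 0" and boundary: "\<bar>Im z\<bar> = T \<or> \<bar>Re z\<bar> = T"
  shows "norm (newman_kernel T z) \<le> 3 * \<bar>Re z\<bar> / T\<^sup>2"
proof (cases "\<bar>Im z\<bar> = T")
  case True
    have T2: "T\<^sup>2 = (Im z)\<^sup>2" using True by (metis power2_abs)
    have e: "of_real (T\<^sup>2) + z\<^sup>2 = of_real (Re z) * (z + \<i> * of_real (Im z))"
      unfolding T2 by (simp add: complex_eq_iff power2_eq_square algebra_simps)
    have nz: "norm z \<ge> T" using abs_Im_le_cmod[of z] True by simp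
    then have z0: "z \<noteq> 0" using assms by auto
    have "norm (z + \<i> * of_real (Im z)) \<le> (\<bar>Re z\<bar> + \<bar>Im z\<bar>) + \<bar>Im z\<bar>"
      using norm_triangle_ineq[of z "\<i> * of_real (Im z)"] cmod_le[of z] by (simp add: norm_mult)
    also have "\<dots> \<le> 3 * T" using T True by simp
    finally have b: "norm (z + \<i> * of_real (Im z)) \<le> 3 * T" .
    have "newman_kernel T z = (of_real (T\<^sup>2) + z\<^sup>2) / (of_real (T\<^sup>2) * z)"
      using assms z0 by (simp add: newman_kernel_def field_simps)
    also have "norm \<dots> = \<bar>Re z\<bar> * norm (z + \<i> * of_real (Im z)) / (T\<^sup>2 * norm z)"
      unfolding e by (simp add: norm_divide norm_mult norm_power)
    also have "\<dots> \<le> \<bar>Re z\<bar> * (3 * T) / (T\<^sup>2 * T)"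
      using b nz assms by (intro frac_le mult_left_mono mult_nonneg_nonneg) auto
    finally show ?thesis using assms by (simp add: mult.commute)
next
  case False
  then have re: "\<bar>Re z\<bar> = T" using boundary by simp
  have "(Re z)\<^sup>2 = T\<^sup>2" using re by (metis power2_abs)
  moreover have "(Im z)\<^sup>2 \<le> T\<^sup>2" using T by (metis abs_le_square_iff abs_of_pos)
  ultimately have "norm (newman_kernel T z) \<le> 3 / norm z"
    using T by (intro newman_kernel_bound) (auto simp: cmod_power2)
  also have "\<dots> \<le> 3 / T" using abs_Re_le_cmod[of z] re T by (intro frac_le) auto
  finally show ?thesis using re T by (simp add: power2_eq_square)
qed

lemma norm_contour_integral_linepath_le:
  assumes "continuous_on (closed_segment A B) h" and h: "\<And>z. z \<in> closed_segment A B \<Longrightarrow> norm (h z) \<le> M"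
  shows "norm (contour_integral (linepath A B) h) \<le> M * norm (B - A)"
  by (rule contour_integral_bound_linepath[OF contour_integrable_continuous_linepath[OF assms(1)] _ h])
     (use order_trans[OF norm_ge_zero h[of A]] in auto)

text \<open>On the sides of the square the kernel cancels the blow-up 1/|Re z|, leaving O(1/T^2) per
  unit length and O(1/N) in all. The main contribution is that of 1/zeta on
  \<open>Re z = -a\<close>, where N^z saves N^(-a).\<close>

lemma mertens_sum_bound:
  assumes nz: "\<And>s. Re s > 1/2 \<Longrightarrow> zeta_reg s \<noteq> 0" and \<delta>: "0 < \<delta>" "\<delta> < 1/2" and \<epsilon>: "\<epsilon> > 0"
  obtains C where "C > 0"
    "\<And>N. N \<ge> 1 \<Longrightarrow> \<bar>\<Sum>n=1..N. of_int (moebius n) / real n\<bar> \<le> C * (real N powr (\<delta> - 1/2) * (1 + real N) powr \<epsilon>)"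
proof -
  obtain C0 where C0: "C0 > 0" "\<And>s. 1/2 + \<delta> \<le> Re s \<Longrightarrow> Re s \<le> 1 \<Longrightarrow> norm ((s - 1) / zeta_reg s) \<le> C0 * (1 + \<bar>Im s\<bar>) powr \<epsilon>"
    using inverse_zeta_bound[OF nz \<delta> \<epsilon>] by blast
  define a where "a = 1/2 - \<delta>"
  have a: "0 < a" "a < 1/2" using \<delta> by (auto simp: a_def)
  \<comment> \<open>36 = 3 + 6 + 3 + 6 + 12 + 6 collects the sides of the square, 6 C0 the two short
    horizontal pieces, and 12 C0 / (a \<epsilon>) the two halves of the side at -a.\<close>
  define C where "C = 36 + 6 * C0 + 12 * C0 / (a * \<epsilon>)"
  have "\<bar>\<Sum>n=1..N. of_int (moebius n) / real n\<bar> \<le> C * (real N powr (\<delta> - 1/2) * (1 + real N) powr \<epsilon>)"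
    if N: "N \<ge> 1" for N
  proof -
    define T where "T = real N"
    have T: "T \<ge> 1" using N by (simp add: T_def)
    let ?P = "Complex 0 (-T)"
    let ?Q = "Complex T (-T)"
    let ?U = "Complex T T"
    let ?V = "Complex 0 T"
    let ?W = "Complex (-a) T"
    let ?Y = "Complex (-a) (-T)"
    let ?Ws = "Complex (-T) T"
    let ?Ys = "Complex (-T) (-T)"
    let ?O = "Complex (-a) 0"
    define E where "E = (1 + T) powr \<epsilon>"
    have E: "E \<ge> 1" unfolding E_def using T \<epsilon> by (intro ge_one_powr_ge_zero) auto
    define \<phi>F where "\<phi>F = (\<lambda>z. z / zeta_reg (1 + z) * of_nat N powr z * (1 + z\<^sup>2 / of_real (T\<^sup>2)))"
    define \<phi>S where "\<phi>S = (\<lambda>z. moebius_sum N (1 + z) * of_nat N powr z * (1 + z\<^sup>2 / of_real (T\<^sup>2)))"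
    have F_eq: "\<phi>F z / z = (z / zeta_reg (1 + z)) * of_nat N powr z * newman_kernel T z"
      and S_eq: "\<phi>S z / z = moebius_sum N (1 + z) * of_nat N powr z * newman_kernel T z" for z
      by (simp_all add: \<phi>F_def \<phi>S_def newman_kernel_def)
    have Nz: "norm (of_nat N powr z) = T powr Re z" for z :: complex
      using norm_powr_real_powr[of "of_nat N" z] by (simp add: T_def)
    define H where "H = {z::complex. Re z > - (1/2)}"
    have H: "convex H" "open H" unfolding H_def by (rule convex_halfspace_Re_gt, rule open_halfspace_Re_gt)
    have hz: "(\<lambda>z. zeta_reg (1 + z)) holomorphic_on A" for A
      by (rule holomorphic_on_compose[of "\<lambda>z. 1 + z" _ zeta_reg, unfolded o_def]) (intro holomorphic_intros)+
    have \<phi>F: "\<phi>F holomorphic_on H" unfolding \<phi>F_def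
      by (intro holomorphic_intros hz) (use nz N T in \<open>auto simp: H_def\<close>)
    have \<phi>S: "\<phi>S holomorphic_on A" for A unfolding \<phi>S_def moebius_sum_def
      by (intro holomorphic_intros) (use N T in auto)
    \<comment> \<open>The two contours share their right half \<open>Re z \<ge> 0\<close>, where only the tail of the Dirichlet series
      remains; on the left the partial sum is integrated over the full square and \<open>1/\<zeta>\<close> only up to
      \<open>Re z = -a\<close>. As \<open>1/\<zeta>\<close> vanishes at 1, its integrand has no pole at 0.\<close>
    define IF IS where "IF = (\<lambda>A B. contour_integral (linepath A B) (\<lambda>z. \<phi>F z / z))"
      and "IS = (\<lambda>A B. contour_integral (linepath A B) (\<lambda>z. \<phi>S z / z))"
    have EF: "IF ?P ?Q + IF ?Q ?U + IF ?U ?V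
       + (IF ?V ?W + IF ?W ?Y + IF ?Y ?P)
       = 0"
    proof -
      have "cbox ?Y ?U \<subseteq> H"
        using a T by (auto simp: H_def in_cbox_complex_iff)
      moreover have "\<phi>F 0 = 0" by (simp add: \<phi>F_def)
      ultimately show ?thesis
        using rectangle_cauchy[OF H \<phi>F, of a T T] a T unfolding IF_def by simp
    qed
    have ES: "IS ?P ?Q + IS ?Q ?U + IS ?U ?V
       + (IS ?V ?Ws + IS ?Ws ?Ys + IS ?Ys ?P)
       = 2 * pi * \<i> * moebius_sum N 1"
      using rectangle_cauchy[OF convex_UNIV open_UNIV \<phi>S, of T T T] T N
      by (auto simp: IS_def \<phi>S_def[THEN fun_cong, of 0])
    have contF: "continuous_on (closed_segment A B) (\<lambda>z. \<phi>F z / z)"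
      if "A \<in> H" "B \<in> H" "0 \<notin> closed_segment A B" for A B
    proof -
      have "closed_segment A B \<subseteq> H" using that H by (intro closed_segment_subset) auto
      then show ?thesis using that
        by (intro continuous_intros continuous_on_subset[OF holomorphic_on_imp_continuous_on[OF \<phi>F]]) auto
    qed
    have contS: "continuous_on (closed_segment A B) (\<lambda>z. \<phi>S z / z)" if "0 \<notin> closed_segment A B" for A B
      using that by (intro continuous_intros holomorphic_on_imp_continuous_on[OF \<phi>S]) auto
    have D: "norm (IS A B - IF A B) \<le> 3 / T\<^sup>2 * norm (B - A)"
      if "A \<in> H" "B \<in> H" "0 \<notin> closed_segment A B"
        and "\<And>z. z \<in> closed_segment A B \<Longrightarrow> norm (\<phi>S z / z - \<phi>F z / z) \<le> 3 / T\<^sup>2" for A B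
    proof -
      note c = contS[OF that(3)] contF[OF that(1-3)]
      have "IS A B - IF A B = contour_integral (linepath A B) (\<lambda>z. \<phi>S z / z - \<phi>F z / z)"
        unfolding IS_def IF_def by (rule contour_integral_diff[symmetric]) (intro contour_integrable_continuous_linepath c)+
      then show ?thesis
        using norm_contour_integral_linepath_le[OF continuous_on_diff[OF c] that(4)] by simp
    qed
    have BS: "norm (IS A B) \<le> 6 / T\<^sup>2 * norm (B - A)"
      if "0 \<notin> closed_segment A B" and "\<And>z. z \<in> closed_segment A B \<Longrightarrow> norm (\<phi>S z / z) \<le> 6 / T\<^sup>2" for A B
      unfolding IS_def by (rule norm_contour_integral_linepath_le[OF contS that(2)]) (use that in auto)
    have BF: "norm (IF A B) \<le> 3 * C0 * E / T\<^sup>2 * norm (B - A)"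
      if "A \<in> H" "B \<in> H" "0 \<notin> closed_segment A B"
        and "\<And>z. z \<in> closed_segment A B \<Longrightarrow> norm (\<phi>F z / z) \<le> 3 * C0 * E / T\<^sup>2" for A B
      unfolding IF_def by (rule norm_contour_integral_linepath_le[OF contF that(4)]) (use that in auto)
    have right: "norm (\<phi>S z / z - \<phi>F z / z) \<le> T powr 0 / Re z * norm (newman_kernel T z)" if "Re z > 0" for z
    proof -
      have z0: "1 + z \<noteq> 1" "z \<noteq> 0" using that by auto
      have "\<phi>S z / z - \<phi>F z / z = - ((1 / zeta (1 + z) - moebius_sum N (1 + z)) * of_nat N powr z * newman_kernel T z)"
        unfolding F_eq S_eq using z0 by (simp add: zeta_reg_def algebra_simps)
      also have "norm \<dots> = norm (1 / zeta (1 + z) - moebius_sum N (1 + z)) * T powr Re z * norm (newman_kernel T z)"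
        by (simp add: norm_mult Nz)
      also have "\<dots> \<le> T powr (- Re z) / Re z * T powr Re z * norm (newman_kernel T z)"
        using moebius_sum_tail[of "1 + z" N] that N by (intro mult_right_mono) (auto simp: T_def)
      also have "\<dots> = T powr (- Re z + Re z) / Re z * norm (newman_kernel T z)" unfolding powr_add by simp
      finally show ?thesis by simp
    qed
    have right_b: "norm (\<phi>S z / z - \<phi>F z / z) \<le> 3 / T\<^sup>2"
      if "0 \<le> Re z" "Re z \<le> T" "\<bar>Im z\<bar> \<le> T" "\<bar>Im z\<bar> = T \<or> Re z = T" for z
    proof -
      have k: "norm (newman_kernel T z) \<le> 3 * Re z / T\<^sup>2" using newman_kernel_boundary[of z T] that T by simp
      show ?thesis
      \<comment> \<open>On the imaginary axis only the points at height T or -T are left; the tail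
        bound fails there, but the kernel is zero.\<close>
      proof (cases "Re z = 0")
        case True
        then show ?thesis using k unfolding F_eq S_eq by simp
      next
        case False
        then have "T powr 0 / Re z * norm (newman_kernel T z) \<le> T powr 0 / Re z * (3 * Re z / T\<^sup>2)"
          using k that by (intro mult_left_mono) auto
        also have "\<dots> = 3 / T\<^sup>2" using False T by simp
        finally show ?thesis using right[of z] False that by simp
      qed
    qed
    \<comment> \<open>The summand 1/T stems from the last term left over in
      \<open>sum_powr_head_le\<close>.\<close>
    have left: "norm (\<phi>S z / z) \<le> (1 / (- Re z) + 1 / T) * norm (newman_kernel T z)" if "Re z < 0" for z
    proof -
      have "norm (\<phi>S z / z) = norm (moebius_sum N (1 + z)) * T powr Re z * norm (newman_kernel T z)"
        unfolding S_eq by (simp add: norm_mult Nz)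
      also have "\<dots> \<le> (T powr (- Re z) / (- Re z) + T powr (- 1 - Re z)) * T powr Re z * norm (newman_kernel T z)"
        using moebius_sum_head[of "1 + z" N] that N by (intro mult_right_mono) (auto simp: T_def)
      also have "(T powr (- Re z) / (- Re z) + T powr (- 1 - Re z)) * T powr Re z = (T powr (- Re z + Re z)) / (- Re z) + T powr (- 1 - Re z + Re z)"
        unfolding powr_add distrib_right by simp
      also have "\<dots> = 1 / (- Re z) + 1 / T" using T by (simp add: powr_minus_divide)
      finally show ?thesis .
    qed
    have left_b: "norm (\<phi>S z / z) \<le> 6 / T\<^sup>2"
      if "- T \<le> Re z" "Re z \<le> 0" "\<bar>Im z\<bar> \<le> T" "\<bar>Im z\<bar> = T \<or> Re z = - T" for z
    proof -
      have k: "norm (newman_kernel T z) \<le> 3 * (- Re z) / T\<^sup>2" using newman_kernel_boundary[of z T] that T by auto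
      show ?thesis
      proof (cases "Re z = 0")
        case True
        then show ?thesis using k unfolding S_eq by simp
      next
        case False
        then have neg: "Re z < 0" using that by simp
        have "0 \<le> 1 / (- Re z) + 1 / T"
          using neg T by (intro add_nonneg_nonneg divide_nonneg_nonneg) auto
        from order_trans[OF left[OF neg] mult_left_mono[OF k this]]
        have "norm (\<phi>S z / z) \<le> (1 / (- Re z) + 1 / T) * (3 * (- Re z) / T\<^sup>2)" .
        also have "\<dots> = (3 + 3 * (- Re z) / T) / T\<^sup>2" using False T by (simp add: field_simps)
        also have "\<dots> \<le> 6 / T\<^sup>2" using that T by (intro divide_right_mono) (auto simp: field_simps)
        finally show ?thesis .
      qed
    qed
    have leftF: "norm (\<phi>F z / z) \<le> C0 * (1 + \<bar>Im z\<bar>) powr \<epsilon> * T powr Re z * norm (newman_kernel T z)"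
      if "- a \<le> Re z" "Re z \<le> 0" for z
    proof -
      have "norm (z / zeta_reg (1 + z)) \<le> C0 * (1 + \<bar>Im z\<bar>) powr \<epsilon>"
        using C0(2)[of "1 + z"] that by (simp add: a_def)
      then show ?thesis unfolding F_eq norm_mult Nz by (intro mult_right_mono) auto
    qed
    have leftF_h: "norm (\<phi>F z / z) \<le> 3 * C0 * E / T\<^sup>2" if "\<bar>Im z\<bar> = T" "- a \<le> Re z" "Re z \<le> 0" for z
    proof -
      have "norm (newman_kernel T z) \<le> 3 * (- Re z) / T\<^sup>2" using newman_kernel_boundary[of z T] that T a by simp
      also have "\<dots> \<le> 3 / T\<^sup>2" using that a by (intro divide_right_mono) auto
      finally have k: "norm (newman_kernel T z) \<le> 3 / T\<^sup>2" .
      have "T powr Re z \<le> T powr 0" using that T by (intro powr_mono) auto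
      then have "norm (\<phi>F z / z) \<le> C0 * E * 1 * (3 / T\<^sup>2)"
        using that C0(1) k T E by (intro order_trans[OF leftF] mult_mono) (auto simp: E_def)
      then show ?thesis by (simp add: mult_ac)
    qed
    \<comment> \<open>The side is halved at the real axis, so that on each half the height is T
      times the parameter; \<eta> is the direction.\<close>
    have leftF_v: "norm (IF ?O (?O + \<i> * of_real (\<eta> * T))) \<le> 6 * C0 * T powr (-a) / a * E / \<epsilon>"
      if \<eta>: "\<bar>\<eta>\<bar> = 1" for \<eta>
      unfolding IF_def E_def
    proof (rule norm_contour_integral_linepath_powr_le)
      show "continuous_on (closed_segment ?O (?O + \<i> * of_real (\<eta> * T))) (\<lambda>z. \<phi>F z / z)"
        by (rule contF) (use a in \<open>auto simp: H_def closed_segment_same_Re\<close>)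
      show "norm (\<i> * of_real (\<eta> * T)) = T" using \<eta> T by (simp add: norm_mult abs_mult)
      fix x :: real assume x: "0 \<le> x" "x \<le> 1"
      define z where "z = ?O + of_real x * (\<i> * of_real (\<eta> * T))"
      have z: "Re z = - a" "\<bar>Im z\<bar> = T * x" using \<eta> x T by (auto simp: z_def abs_mult)
      have xT: "T * x \<le> T" "0 \<le> T * x" using x T by (auto simp: mult_left_le)
      have "a\<^sup>2 \<le> T\<^sup>2" using a T by (intro power_mono) auto
      moreover have "(T * x)\<^sup>2 \<le> T\<^sup>2" using xT by (intro power_mono) auto
      moreover have "(Im z)\<^sup>2 = (T * x)\<^sup>2" using z(2) by (metis power2_abs)
      moreover have "(norm z)\<^sup>2 = a\<^sup>2 + (Im z)\<^sup>2" by (simp add: cmod_power2 z(1))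
      ultimately have "(norm z)\<^sup>2 \<le> 2 * T\<^sup>2" by linarith
      then have "norm (newman_kernel T z) \<le> 3 / norm z"
        using T by (intro newman_kernel_bound) auto
      \<comment> \<open>|z| is at least a and at least T x, hence at least the mean of a and a T x,
        as a < 1.\<close>
      also have "\<dots> \<le> 3 / (a * (1 + T * x) / 2)"
      proof (intro divide_left_mono)
        have "a \<le> norm z" "T * x \<le> norm z" using abs_Re_le_cmod[of z] abs_Im_le_cmod[of z] z a by auto
        moreover have "a * (T * x) \<le> 1 * (T * x)" using a xT by (intro mult_right_mono) auto
        ultimately show "a * (1 + T * x) / 2 \<le> norm z" by (simp add: distrib_left)
        show "0 < norm z * (a * (1 + T * x) / 2)"
          using a xT \<open>a \<le> norm z\<close> by (intro mult_pos_pos divide_pos_pos add_pos_nonneg) auto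
      qed simp
      also have "\<dots> = 6 / a * (1 / (1 + T * x))" by simp
      finally have k: "norm (newman_kernel T z) \<le> 6 / a * (1 / (1 + T * x))" .
      have "norm (\<phi>F z / z) \<le> C0 * (1 + T * x) powr \<epsilon> * T powr (-a) * norm (newman_kernel T z)"
        using leftF[of z] z a by simp
      also have "\<dots> \<le> C0 * (1 + T * x) powr \<epsilon> * T powr (-a) * (6 / a * (1 / (1 + T * x)))"
        using C0(1) k by (intro mult_left_mono) auto
      also have "\<dots> = 6 * C0 * T powr (-a) / a * (1 + T * x) powr (\<epsilon> - 1)"
        using xT by (simp add: powr_diff)
      finally show "norm (\<phi>F (?O + of_real x * (\<i> * of_real (\<eta> * T))) / (?O + of_real x * (\<i> * of_real (\<eta> * T))))
          \<le> 6 * C0 * T powr (-a) / a * (1 + T * x) powr (\<epsilon> - 1)" unfolding z_def .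
    qed (use T \<epsilon> in auto)
    have vF: "norm (IF ?W ?Y) \<le> 2 * (6 * C0 * T powr (-a) / a * E / \<epsilon>)"
    proof -
      have c: "continuous_on (closed_segment ?W ?Y) (\<lambda>z. \<phi>F z / z)"
        "continuous_on (closed_segment ?O ?W) (\<lambda>z. \<phi>F z / z)"
        by (rule contF; use a in \<open>simp add: H_def closed_segment_same_Re\<close>)+
      have "IF ?W ?Y = IF ?W ?O + IF ?O ?Y"
        unfolding IF_def by (rule contour_integral_split_linepath[OF c(1)])
          (use T in \<open>auto simp: closed_segment_same_Re closed_segment_eq_real_ivl\<close>)
      also have "IF ?W ?O = - IF ?O ?W"
        unfolding IF_def using contour_integral_reverse_linepath[OF c(2)] by simp
      finally have "norm (IF ?W ?Y) \<le> norm (IF ?O ?W) + norm (IF ?O ?Y)"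
        using norm_triangle_ineq4[of "IF ?O ?Y" "IF ?O ?W"] by simp
      moreover have "?O + \<i> * of_real (1 * T) = ?W" "?O + \<i> * of_real (- 1 * T) = ?Y"
        by (auto simp: complex_eq_iff)
      moreover define B where "B = 6 * C0 * T powr (-a) / a * E / \<epsilon>"
      ultimately have "norm (IF ?O ?W) \<le> B" "norm (IF ?O ?Y) \<le> B"
        and "norm (IF ?W ?Y) \<le> norm (IF ?O ?W) + norm (IF ?O ?Y)"
        using leftF_v[of 1] leftF_v[of "-1"] by simp_all
      then show ?thesis unfolding B_def[symmetric] by linarith
    qed
    have len: "norm (Complex x y - Complex x' y') \<le> \<bar>x - x'\<bar> + \<bar>y - y'\<bar>" for x y x' y'
      using cmod_le[of "Complex x y - Complex x' y'"] by simp
    have sc: "c / T\<^sup>2 * (k * T) = c * k / T" for c k using T by (simp add: power2_eq_square)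
    have up: "X \<le> c * k / T" if "X \<le> c / T\<^sup>2 * L" "L \<le> k * T" "c \<ge> 0" for X c k L
    proof -
      have "X \<le> c / T\<^sup>2 * L" by fact
      also have "\<dots> \<le> c / T\<^sup>2 * (k * T)" using that by (intro mult_left_mono) auto
      also have "\<dots> = c * k / T" by (rule sc)
      finally show ?thesis .
    qed
    note seg = closed_segment_same_Re closed_segment_same_Im closed_segment_eq_real_ivl
    have d1: "norm (IS ?P ?Q - IF ?P ?Q) \<le> 3 / T"
      using up[OF D, of "?P" "?Q" 1] right_b len[of T "-T" 0 "-T"] T by (simp add: H_def seg)
    have d2: "norm (IS ?Q ?U - IF ?Q ?U) \<le> 6 / T"
      using up[OF D, of "?Q" "?U" 2] right_b len[of T T T "-T"] T by (simp add: H_def seg abs_le_iff)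
    have d3: "norm (IS ?U ?V - IF ?U ?V) \<le> 3 / T"
      using up[OF D, of "?U" "?V" 1] right_b len[of 0 T T T] T by (simp add: H_def seg)
    have s1: "norm (IS ?V ?Ws) \<le> 6 / T"
      using up[OF BS, of "?V" "?Ws" 1] left_b len[of "-T" T 0 T] T by (simp add: seg)
    have s2: "norm (IS ?Ws ?Ys) \<le> 12 / T"
      using up[OF BS, of "?Ws" "?Ys" 2] left_b len[of "-T" "-T" "-T" T] T by (simp add: seg abs_le_iff)
    have s3: "norm (IS ?Ys ?P) \<le> 6 / T"
      using up[OF BS, of "?Ys" "?P" 1] left_b len[of 0 "-T" "-T" "-T"] T by (simp add: seg)
    have f1: "norm (IF ?V ?W) \<le> 3 * C0 * E / T"
      using up[OF BF, of "?V" "?W" 1] leftF_h len[of "-a" T 0 T] T a C0(1) E by (simp add: H_def seg)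
    have f3: "norm (IF ?Y ?P) \<le> 3 * C0 * E / T"
      using up[OF BF, of "?Y" "?P" 1] leftF_h len[of 0 "-T" "-a" "-T"] T a C0(1) E by (simp add: H_def seg)
    define G where "G = (\<Sum>n=1..N. of_int (moebius n) / real n)"
    have "moebius_sum N 1 = of_real G"
      unfolding moebius_sum_def G_def of_real_sum by (rule sum.cong) (auto simp: powr_minus divide_inverse)
    then have "2 * pi * \<bar>G\<bar> = norm (2 * pi * \<i> * moebius_sum N 1)" by (simp add: norm_mult)
    also have "2 * pi * \<i> * moebius_sum N 1 =
       (IS ?P ?Q - IF ?P ?Q)
       + (IS ?Q ?U - IF ?Q ?U)
       + (IS ?U ?V - IF ?U ?V)
       + IS ?V ?Ws + IS ?Ws ?Ys + IS ?Ys ?P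
       - IF ?V ?W - IF ?W ?Y - IF ?Y ?P"
      using EF ES by (simp add: algebra_simps)
    also have "norm \<dots> \<le> 3 / T + 6 / T + 3 / T + 6 / T + 12 / T + 6 / T + 3 * C0 * E / T + 2 * (6 * C0 * T powr (-a) / a * E / \<epsilon>) + 3 * C0 * E / T"
      by (intro norm_triangle_le norm_triangle_le_diff add_mono d1 d2 d3 s1 s2 s3 f1 f3 vF)
    also have "\<dots> = 36 * (1 / T) + 6 * C0 * E * (1 / T) + 12 * C0 / (a * \<epsilon>) * (T powr (-a) * E)"
      by (simp add: field_simps)
    also have "\<dots> \<le> 36 * (T powr (-a) * E) + 6 * C0 * (T powr (-a) * E) + 12 * C0 / (a * \<epsilon>) * (T powr (-a) * E)"
    proof -
      have "1 / T = T powr (-1)" using T by (simp add: powr_minus_divide)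
      also have "\<dots> \<le> T powr (-a)" using T a by (intro powr_mono) auto
      finally have 1: "1 / T \<le> T powr (-a)" .
      have "T powr (-a) * 1 \<le> T powr (-a) * E" using E by (intro mult_left_mono) auto
      then have 2: "1 / T \<le> T powr (-a) * E" using 1 by simp
      have "6 * C0 * E * (1 / T) \<le> 6 * C0 * E * T powr (-a)" using 1 C0(1) E by (intro mult_left_mono) auto
      then have 3: "6 * C0 * E * (1 / T) \<le> 6 * C0 * (T powr (-a) * E)" by (simp add: mult_ac)
      show ?thesis using 2 3 by simp
    qed
    also have "\<dots> = C * (T powr (-a) * E)" by (simp add: C_def algebra_simps)
    finally have "2 * pi * \<bar>G\<bar> \<le> C * (T powr (-a) * E)" .
    moreover have "1 * \<bar>G\<bar> \<le> 2 * pi * \<bar>G\<bar>" using pi_ge_two by (intro mult_right_mono) auto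
    ultimately show ?thesis by (simp add: G_def T_def E_def a_def)
  qed
  moreover have "C > 0" unfolding C_def using C0(1) a \<epsilon> by (intro add_pos_pos divide_pos_pos mult_pos_pos) auto
  ultimately show thesis using that by blast
qed

section \<open>From partial sums to finite norms\<close>

lemma mertens_g1_bound:
  assumes nz: "\<And>s. Re s > 1/2 \<Longrightarrow> zeta_reg s \<noteq> 0" and \<eta>: "0 < \<eta>" "\<eta> < 1/2"
  obtains C where "C > 0" "\<And>x. 0 < x \<Longrightarrow> x \<le> 1 \<Longrightarrow> \<bar>mertens_g1 x\<bar> \<le> C * x powr (-1/2 - 2 * \<eta>)"
proof -
  obtain C where C: "C > 0"
    "\<And>N. N \<ge> 1 \<Longrightarrow> \<bar>\<Sum>n=1..N. of_int (moebius n) / real n\<bar> \<le> C * (real N powr (\<eta> - 1/2) * (1 + real N) powr \<eta>)"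
    using mertens_sum_bound[OF nz \<eta> \<eta>(1)] by blast
  have "\<bar>mertens_g1 x\<bar> \<le> C * ((1/2) powr (\<eta> - 1/2) * 2 powr \<eta>) * x powr (-1/2 - 2 * \<eta>)" if x: "0 < x" "x \<le> 1" for x
  proof -
    define N where "N = nat \<lfloor>inverse x\<rfloor>"
    have ix: "inverse x \<ge> 1" using x by (simp add: one_le_inverse)
    then have N: "N \<ge> 1" "real N \<le> inverse x" "inverse x < real N + 1" unfolding N_def by linarith+
    \<comment> \<open>The exponent \<eta> - 1/2 is negative, so N must be bounded from below in
      terms of 1/x.\<close>
    have N2: "1/2 * inverse x \<le> real N" using N by linarith
    have "\<bar>mertens_g1 x\<bar> = inverse x * \<bar>\<Sum>n=1..N. of_int (moebius n) / real n\<bar>"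
      using x unfolding mertens_g1_def mertens_g_floor N_def by (simp add: abs_mult)
    also have "\<dots> \<le> inverse x * (C * (real N powr (\<eta> - 1/2) * (1 + real N) powr \<eta>))"
      using C(2)[OF N(1)] x by (intro mult_left_mono) auto
    also have "\<dots> \<le> inverse x * (C * ((1/2 * inverse x) powr (\<eta> - 1/2) * (2 * inverse x) powr \<eta>))"
      using C(1) x \<eta> N N2 ix by (intro mult_left_mono mult_mono powr_mono2 powr_mono2') auto
    also have "(1/2 * inverse x) powr (\<eta> - 1/2) = (1/2) powr (\<eta> - 1/2) * x powr (1/2 - \<eta>)"
      unfolding powr_mult using x by (simp add: powr_minus[symmetric] inverse_powr)
    also have "(2 * inverse x) powr \<eta> = 2 powr \<eta> * x powr (- \<eta>)"
      unfolding powr_mult using x by (simp add: powr_minus inverse_powr)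
    also have "inverse x * (C * ((1/2) powr (\<eta> - 1/2) * x powr (1/2 - \<eta>) * (2 powr \<eta> * x powr (- \<eta>)))) =
        C * ((1/2) powr (\<eta> - 1/2) * 2 powr \<eta>) * (x powr (-1) * x powr (1/2 - \<eta>) * x powr (- \<eta>))"
      using x by (simp add: powr_minus mult_ac)
    also have "x powr (-1) * x powr (1/2 - \<eta>) * x powr (- \<eta>) = x powr (-1 + (1/2 - \<eta>) + - \<eta>)"
      by (simp only: powr_add)
    also have "-1 + (1/2 - \<eta>) + - \<eta> = -1/2 - 2 * \<eta>" by simp
    finally show ?thesis .
  qed
  then show thesis using C(1) by (intro that[of "C * ((1/2) powr (\<eta> - 1/2) * 2 powr \<eta>)"]) auto
qed

lemma Lp_norm_mertens_g1_finite:
  assumes nz: "\<And>s. Re s > 1/2 \<Longrightarrow> zeta_reg s \<noteq> 0" and p: "1 \<le> p" "p < 2"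
  shows "Lp_norm p mertens_g1 < \<infinity>"
proof -
  \<comment> \<open>With this value the exponent (-1/2 - 2 \<eta>) p equals -(2 + p)/4, which
    exceeds -1 because p < 2.\<close>
  define \<eta> where "\<eta> = (2 - p) / (8 * p)"
  have \<eta>: "0 < \<eta>" "\<eta> < 1/2" using p by (auto simp: \<eta>_def field_simps)
  define e where "e = (-1/2 - 2 * \<eta>) * p"
  have "e = - (2 + p) / 4" using p by (simp add: e_def \<eta>_def field_simps)
  then have e: "e > -1" using p by simp
  obtain C where C: "C > 0" "\<And>x. 0 < x \<Longrightarrow> x \<le> 1 \<Longrightarrow> \<bar>mertens_g1 x\<bar> \<le> C * x powr (-1/2 - 2 * \<eta>)"
    using mertens_g1_bound[OF nz \<eta>] by blast
  have "integrable lborel (\<lambda>x. C powr p * (indicator {0<..1} x * x powr e))"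
    by (intro integrable_mult_right integrable_powr_unit_interval e)
  then have "integrable lborel (\<lambda>x. indicator {0<..} x * \<bar>mertens_g1 x\<bar> powr p)"
  proof (rule Bochner_Integration.integrable_bound)
    show "AE x in lborel. norm (indicator {0<..} x * \<bar>mertens_g1 x\<bar> powr p) \<le> norm (C powr p * (indicator {0<..1} x * x powr e))"
    proof (rule AE_I2)
      fix x :: real
      consider "x \<le> 0" | "x > 1" | "0 < x" "x \<le> 1" by linarith
      then show "norm (indicator {0<..} x * \<bar>mertens_g1 x\<bar> powr p) \<le> norm (C powr p * (indicator {0<..1} x * x powr e))"
      proof cases
        case 3
        have "\<bar>mertens_g1 x\<bar> powr p \<le> (C * x powr (-1/2 - 2 * \<eta>)) powr p"
          using C(2)[OF 3] p by (intro powr_mono2) auto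
        also have "\<dots> = C powr p * x powr e" by (simp only: powr_mult powr_powr e_def)
        finally show ?thesis using 3 by simp
      qed (auto simp: mertens_g1_eq_0)
    qed
  qed measurable
  then show ?thesis by (rule iffD2[OF Lp_norm_finite_iff[OF mertens_g1_measurable]])
qed

theorem theorem2p3:
  shows "(riemann_hypothesis \<longleftrightarrow> (\<forall>p::real. 1 \<le> p \<and> p < 2 \<longrightarrow> Lp_norm p mertens_g1 < \<infinity>))
    \<and> Lp_norm 2 mertens_g1 = \<infinity>"
proof (intro conjI iffI allI impI)
  fix p :: real assume RH: riemann_hypothesis and p: "1 \<le> p \<and> p < 2"
  \<comment> \<open>The hypothesis covers the open strip; the closed half-plane
    \<open>Re s \<ge> 1\<close> holds unconditionally.\<close>
  have "zeta_reg s \<noteq> 0" if s: "Re s > 1/2" for s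
  proof (cases "Re s \<ge> 1")
    case True
    then show ?thesis by (rule zeta_reg_nonzero_Re_ge_1)
  next
    case False
    then have "s \<noteq> 1" "zeta s \<noteq> 0" using RH s by (auto simp: riemann_hypothesis_def)
    then show ?thesis by (simp add: zeta_reg_def)
  qed
  then show "Lp_norm p mertens_g1 < \<infinity>" using p by (intro Lp_norm_mertens_g1_finite) auto
next
  assume Lp: "\<forall>p::real. 1 \<le> p \<and> p < 2 \<longrightarrow> Lp_norm p mertens_g1 < \<infinity>"
  have nz: "zeta s \<noteq> 0" if s: "1/2 < Re s" "Re s < 1" for s
  proof -
    define u where "u = 1 / Re s"
    \<comment> \<open>The midpoint between 1/Re s and 2, so that p < 2 while still 1/p < Re
      s.\<close>
    define p where "p = (u + 2) / 2"
    have "1 < u" "u < 2" using s by (auto simp: u_def field_simps)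
    then have p: "1 < p" "p < 2" "u < p" by (auto simp: p_def)
    then have "Re s > 1 / p" using s by (simp add: u_def field_simps)
    then have "zeta_reg s \<noteq> 0" using zeta_nonzero_of_Lp[of p s] Lp p by simp
    moreover have "s \<noteq> 1" using s by auto
    ultimately show ?thesis by (simp add: zeta_reg_def)
  qed
  show riemann_hypothesis unfolding riemann_hypothesis_def
  proof (intro allI impI)
    \<comment> \<open>Of s and 1 - s, one lies to the right of the critical line unless both lie on
      it.\<close>
    fix s assume s: "zeta s = 0 \<and> 0 < Re s \<and> Re s < 1"
    then have "zeta (1 - s) = 0" by (intro zeta_zero_reflect) auto
    then show "Re s = 1 / 2" using nz[of s] nz[of "1 - s"] s by force
  qed
qed (rule Lp_norm_2_mertens_g1)

end
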